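(* Let $R$ be an associative ring with unit. There is a bijection between equivalence classes of support $\tau$-tilting subcategories of $\mathrm{Mod}\text{-}R$ and equivalence classes of finendo quasitilting $R$-modules.
   Context: $\mathrm{Mod}\text{-}R$ is the category of all $R$-modules. For a module $M$: $\mathrm{Add}(M)$ is the class of modules isomorphic to a direct summand of an arbitrary direct sum of copies of $M$; $\mathrm{Gen}(M)$ is the class of epimorphic images of modules in $\mathrm{Add}(M)$; $\mathrm{Pres}(M)$ is the class of modules $X$ admitting an exact sequence $M_1\to M_0\to X\to0$ with $M_0,M_1\in\mathrm{Add}(M)$. A module $T$ is quasitilting if $\mathrm{Pres}(T)=\mathrm{Gen}(T)$ and $T$ is Ext-projective in $\mathrm{Gen}(T)$, i.e. $\mathrm{Ext}^1_R(T,\mathrm{Gen}(T))=0$. $T$ is finendo if it is finitely generated over its endomorphism ring. Two quasitilting modules $T_1,T_2$ are equivalent if $\mathrm{Add}(T_1)=\mathrm{Add}(T_2)$. $\mathrm{Fac}(\mathscr{X})$ is the class of quotients of objects of $\mathscr{X}$ (for a single object $T$, quotients of finite direct sums of copies of $T$). A left $\mathscr{X}$-approximation of $A$ is a morphism $f:A\to X$ with $X\in\mathscr{X}$ such that every morphism $A\to X'$ with $X'\in\mathscr{X}$ factors through $f$; right approximations are dual; $\mathscr{X}$ is contravariantly finite if every object has a right $\mathscr{X}$-approximation. Support $\tau$-tilting subcategory of $\mathscr{A}=\mathrm{Mod}\text{-}R$: an additive full subcategory $\mathscr{T}$ (closed under isomorphisms, finite direct sums and direct summands), contravariantly finite, such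 that (i) $\mathrm{Ext}^1_{\mathscr{A}}(T_1,\mathrm{Fac}(T_2))=0$ for all $T_1,T_2\in\mathscr{T}$; (ii) for every projective $P$ there is an exact sequence $P\xrightarrow{f}T^0\to T^1\to0$ with $T^0,T^1\in\mathscr{T}$ and $f$ a left $\mathscr{T}$-approximation of $P$. Two support $\tau$-tilting subcategories $\mathscr{T},\mathscr{T}'$ are equivalent if $\mathrm{Fac}(\mathscr{T})=\mathrm{Fac}(\mathscr{T}')$. *)

theory Defs
  imports "HOL-Algebra.Module"
begin

unbundle cardinal_syntax

section \<open>The universe\<close>

text \<open>
  A type \<open>'u\<close> of inaccessible cardinality plays the role of a Grothendieck universe: a set, of
  any type, is small if its cardinality is strictly below that of \<open>'u\<close>. The objects of
  \<open>Mod-R\<close> are the modules whose carrier is a small subset of \<open>'u\<close>, so every small \<open>R\<close>-module is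
  isomorphic to an object, and classes of modules are sets of objects. The type \<open>'u\<close> is
  determined by the types of the modules concerned.
\<close>

definition inaccessible_universe :: "'u itself \<Rightarrow> bool" where
  "inaccessible_universe (_ :: 'u itself) \<longleftrightarrow>
     natLeq <o |UNIV :: 'u set| \<and>
     regularCard |UNIV :: 'u set| \<and>
     (\<forall>A :: 'u set. |A| <o |UNIV :: 'u set| \<longrightarrow> |Pow A| <o |UNIV :: 'u set| )"

definition small :: "'u itself \<Rightarrow> 'a set \<Rightarrow> bool" where
  "small (_ :: 'u itself) A \<longleftrightarrow> |A| <o |UNIV :: 'u set|"


section \<open>Right modules over a ring\<close>

text \<open>
  The library locale \<^locale>\<open>module\<close> requires a commutative ring. For right modules over an
  arbitrary ring the record type \<^typ>\<open>('r, 'a) module\<close> is reused, \<open>a \<odot>\<^bsub>M\<^esub> x\<close> standing for \<open>x \<cdot> a\<close>;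
  hence the order of the factors in \<open>smult_assoc\<close>. As in the library, the fields
  \<^term>\<open>mult M\<close> and \<^term>\<open>one M\<close> carry no meaning.
\<close>

locale right_module = R?: ring R + M?: abelian_group M for R (structure) and M (structure) +
  assumes smult_closed:
      "\<lbrakk>a \<in> carrier R; x \<in> carrier M\<rbrakk> \<Longrightarrow> a \<odot>\<^bsub>M\<^esub> x \<in> carrier M"
    and smult_l_distr:
      "\<lbrakk>a \<in> carrier R; b \<in> carrier R; x \<in> carrier M\<rbrakk> \<Longrightarrow>
       (a \<oplus>\<^bsub>R\<^esub> b) \<odot>\<^bsub>M\<^esub> x = a \<odot>\<^bsub>M\<^esub> x \<oplus>\<^bsub>M\<^esub> b \<odot>\<^bsub>M\<^esub> x"
    and smult_r_distr:
      "\<lbrakk>a \<in> carrier R; x \<in> carrier M; y \<in> carrier M\<rbrakk> \<Longrightarrow>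
       a \<odot>\<^bsub>M\<^esub> (x \<oplus>\<^bsub>M\<^esub> y) = a \<odot>\<^bsub>M\<^esub> x \<oplus>\<^bsub>M\<^esub> a \<odot>\<^bsub>M\<^esub> y"
    and smult_assoc:
      "\<lbrakk>a \<in> carrier R; b \<in> carrier R; x \<in> carrier M\<rbrakk> \<Longrightarrow>
       (a \<otimes>\<^bsub>R\<^esub> b) \<odot>\<^bsub>M\<^esub> x = b \<odot>\<^bsub>M\<^esub> (a \<odot>\<^bsub>M\<^esub> x)"
    and smult_one:
      "x \<in> carrier M \<Longrightarrow> \<one>\<^bsub>R\<^esub> \<odot>\<^bsub>M\<^esub> x = x"

definition Mods :: "('r, 'k) ring_scheme \<Rightarrow> ('r, 'u) module set" where
  "Mods R = {M. right_module R M \<and> small TYPE('u) (carrier M)}"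

text \<open>
  Homomorphisms are not required to be extensional, so equality of homomorphisms always means
  equality on the carrier of the domain.
\<close>

definition mod_hom ::
    "('r, 'k) ring_scheme \<Rightarrow> ('r, 'a) module \<Rightarrow> ('r, 'b) module \<Rightarrow> ('a \<Rightarrow> 'b) set" where
  "mod_hom R M N =
     {f \<in> carrier M \<rightarrow> carrier N.
        (\<forall>x\<in>carrier M. \<forall>y\<in>carrier M. f (x \<oplus>\<^bsub>M\<^esub> y) = f x \<oplus>\<^bsub>N\<^esub> f y) \<and>
        (\<forall>a\<in>carrier R. \<forall>x\<in>carrier M. f (a \<odot>\<^bsub>M\<^esub> x) = a \<odot>\<^bsub>N\<^esub> f x)}"

definition mod_epi ::
    "('r, 'k) ring_scheme \<Rightarrow> ('r, 'a) module \<Rightarrow> ('r, 'b) module \<Rightarrow> ('a \<Rightarrow> 'b) set" where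
  "mod_epi R M N = {f \<in> mod_hom R M N. f ` carrier M = carrier N}"

definition mod_iso ::
    "('r, 'k) ring_scheme \<Rightarrow> ('r, 'a) module \<Rightarrow> ('r, 'b) module \<Rightarrow> ('a \<Rightarrow> 'b) set" where
  "mod_iso R M N = {f \<in> mod_hom R M N. bij_betw f (carrier M) (carrier N)}"

definition isomorphic ::
    "('r, 'k) ring_scheme \<Rightarrow> ('r, 'a) module \<Rightarrow> ('r, 'b) module \<Rightarrow> bool" where
  "isomorphic R M N \<longleftrightarrow> mod_iso R M N \<noteq> {}"

definition mod_ker :: "('r, 'a) module \<Rightarrow> ('r, 'b) module \<Rightarrow> ('a \<Rightarrow> 'b) \<Rightarrow> 'a set" where
  "mod_ker M N f = {x \<in> carrier M. f x = \<zero>\<^bsub>N\<^esub>}"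

definition right_exact ::
    "('r, 'k) ring_scheme \<Rightarrow> ('r, 'a) module \<Rightarrow> ('a \<Rightarrow> 'b) \<Rightarrow> ('r, 'b) module \<Rightarrow>
     ('b \<Rightarrow> 'c) \<Rightarrow> ('r, 'c) module \<Rightarrow> bool" where
  "right_exact R A f B g C \<longleftrightarrow>
     f \<in> mod_hom R A B \<and> g \<in> mod_epi R B C \<and> f ` carrier A = mod_ker B C g"

definition short_exact ::
    "('r, 'k) ring_scheme \<Rightarrow> ('r, 'a) module \<Rightarrow> ('a \<Rightarrow> 'b) \<Rightarrow> ('r, 'b) module \<Rightarrow>
     ('b \<Rightarrow> 'c) \<Rightarrow> ('r, 'c) module \<Rightarrow> bool" where
  "short_exact R A f B g C \<longleftrightarrow> inj_on f (carrier A) \<and> right_exact R A f B g C"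


section \<open>Direct sums\<close>

definition dsum :: "'i set \<Rightarrow> ('i \<Rightarrow> ('r, 'a) module) \<Rightarrow> ('r, 'i \<Rightarrow> 'a) module" where
  "dsum I M =
     \<lparr>carrier = {f \<in> (\<Pi>\<^sub>E i\<in>I. carrier (M i)). finite {i \<in> I. f i \<noteq> \<zero>\<^bsub>M i\<^esub>}},
      mult = undefined, one = undefined,
      zero = (\<lambda>i\<in>I. \<zero>\<^bsub>M i\<^esub>),
      add = (\<lambda>f g. \<lambda>i\<in>I. f i \<oplus>\<^bsub>M i\<^esub> g i),
      smult = (\<lambda>a f. \<lambda>i\<in>I. a \<odot>\<^bsub>M i\<^esub> f i)\<rparr>"

definition dsum2 :: "('r, 'a) module \<Rightarrow> ('r, 'b) module \<Rightarrow> ('r, 'a \<times> 'b) module" where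
  "dsum2 M N =
     \<lparr>carrier = carrier M \<times> carrier N,
      mult = undefined, one = undefined,
      zero = (\<zero>\<^bsub>M\<^esub>, \<zero>\<^bsub>N\<^esub>),
      add = (\<lambda>x y. (fst x \<oplus>\<^bsub>M\<^esub> fst y, snd x \<oplus>\<^bsub>N\<^esub> snd y)),
      smult = (\<lambda>a x. (a \<odot>\<^bsub>M\<^esub> fst x, a \<odot>\<^bsub>N\<^esub> snd x))\<rparr>"

definition is_summand ::
    "('r, 'k) ring_scheme \<Rightarrow> ('r, 'u) module \<Rightarrow> ('r, 'a) module \<Rightarrow> bool" where
  "is_summand R N X \<longleftrightarrow> (\<exists>K \<in> (Mods R :: ('r, 'u) module set). isomorphic R (dsum2 N K) X)"


section \<open>Vanishing of \<open>Ext\<^sup>1\<close>\<close>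

text \<open>
  \<open>Ext\<^sup>1(A, B)\<close> is the set of equivalence classes of extensions \<open>0 \<rightarrow> B \<rightarrow> E \<rightarrow> A \<rightarrow> 0\<close>; its zero
  element is the class of the split extension.
\<close>

type_synonym ('r, 'u) extension = "('r, 'u) module \<times> ('u \<Rightarrow> 'u) \<times> ('u \<Rightarrow> 'u)"

definition extensions ::
    "('r, 'k) ring_scheme \<Rightarrow> ('r, 'u) module \<Rightarrow> ('r, 'u) module \<Rightarrow> ('r, 'u) extension set" where
  "extensions R A B = {(E, i, p). E \<in> Mods R \<and> short_exact R B i E p A}"

definition ext_equiv ::
    "('r, 'k) ring_scheme \<Rightarrow> ('r, 'u) module \<Rightarrow> ('r, 'u) module \<Rightarrow>
     ('r, 'a) module \<times> ('u \<Rightarrow> 'a) \<times> ('a \<Rightarrow> 'u) \<Rightarrow>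
     ('r, 'b) module \<times> ('u \<Rightarrow> 'b) \<times> ('b \<Rightarrow> 'u) \<Rightarrow> bool" where
  "ext_equiv R A B = (\<lambda>(E, i, p) (E', i', p').
     \<exists>\<phi> \<in> mod_iso R E E'.
       (\<forall>b\<in>carrier B. \<phi> (i b) = i' b) \<and> (\<forall>e\<in>carrier E. p' (\<phi> e) = p e))"

definition Ext1 ::
    "('r, 'k) ring_scheme \<Rightarrow> ('r, 'u) module \<Rightarrow> ('r, 'u) module \<Rightarrow> ('r, 'u) extension set set" where
  "Ext1 R A B = extensions R A B //
     {(x, y). x \<in> extensions R A B \<and> y \<in> extensions R A B \<and> ext_equiv R A B x y}"

definition Ext1_zero ::
    "('r, 'k) ring_scheme \<Rightarrow> ('r, 'u) module \<Rightarrow> ('r, 'u) module \<Rightarrow> ('r, 'u) extension set" where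
  "Ext1_zero R A B =
     {x \<in> extensions R A B. ext_equiv R A B x (dsum2 B A, (\<lambda>b. (b, \<zero>\<^bsub>A\<^esub>)), snd)}"

definition Ext1_vanishes ::
    "('r, 'k) ring_scheme \<Rightarrow> ('r, 'u) module \<Rightarrow> ('r, 'u) module \<Rightarrow> bool" where
  "Ext1_vanishes R A B \<longleftrightarrow> Ext1 R A B = {Ext1_zero R A B}"


section \<open>Finendo quasitilting modules\<close>

definition Add :: "('r, 'k) ring_scheme \<Rightarrow> ('r, 'u) module \<Rightarrow> ('r, 'u) module set" where
  "Add R M = {N \<in> Mods R. \<exists>I :: 'u set. small TYPE('u) I \<and> is_summand R N (dsum I (\<lambda>_. M))}"

definition Gen :: "('r, 'k) ring_scheme \<Rightarrow> ('r, 'u) module \<Rightarrow> ('r, 'u) module set" where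
  "Gen R M = {X \<in> Mods R. \<exists>N \<in> Add R M. mod_epi R N X \<noteq> {}}"

definition Pres :: "('r, 'k) ring_scheme \<Rightarrow> ('r, 'u) module \<Rightarrow> ('r, 'u) module set" where
  "Pres R M = {X \<in> Mods R. \<exists>M1 \<in> Add R M. \<exists>M0 \<in> Add R M. \<exists>f g. right_exact R M1 f M0 g X}"

definition quasitilting :: "('r, 'k) ring_scheme \<Rightarrow> ('r, 'u) module \<Rightarrow> bool" where
  "quasitilting R T \<longleftrightarrow>
     T \<in> Mods R \<and> Pres R T = Gen R T \<and> (\<forall>X \<in> Gen R T. Ext1_vanishes R T X)"

definition finendo :: "('r, 'k) ring_scheme \<Rightarrow> ('r, 'a) module \<Rightarrow> bool" where
  "finendo R T \<longleftrightarrow>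
     (\<exists>F. finite F \<and> F \<subseteq> carrier T \<and>
        (\<forall>t \<in> carrier T. \<exists>e. (\<forall>x\<in>F. e x \<in> mod_hom R T T) \<and> t = (\<Oplus>\<^bsub>T\<^esub>x\<in>F. e x x)))"

definition finendo_quasitilting_modules :: "('r, 'k) ring_scheme \<Rightarrow> ('r, 'u) module set" where
  "finendo_quasitilting_modules R = {T. quasitilting R T \<and> finendo R T}"

definition quasitilting_equiv ::
    "('r, 'k) ring_scheme \<Rightarrow> (('r, 'u) module \<times> ('r, 'u) module) set" where
  "quasitilting_equiv R =
     {(T1, T2). T1 \<in> finendo_quasitilting_modules R \<and> T2 \<in> finendo_quasitilting_modules R \<and>
        Add R T1 = Add R T2}"


section \<open>Support \<open>\<tau>\<close>-tilting subcategories\<close>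

definition Fac :: "('r, 'k) ring_scheme \<Rightarrow> ('r, 'u) module set \<Rightarrow> ('r, 'u) module set" where
  "Fac R \<X> = {Y \<in> Mods R. \<exists>X \<in> \<X>. mod_epi R X Y \<noteq> {}}"

definition Fac_obj :: "('r, 'k) ring_scheme \<Rightarrow> ('r, 'u) module \<Rightarrow> ('r, 'u) module set" where
  "Fac_obj R T = {Y \<in> Mods R. \<exists>n :: nat. mod_epi R (dsum {..<n} (\<lambda>_. T)) Y \<noteq> {}}"

definition left_approx ::
    "('r, 'k) ring_scheme \<Rightarrow> ('r, 'u) module set \<Rightarrow> ('r, 'u) module \<Rightarrow> ('u \<Rightarrow> 'u) \<Rightarrow>
     ('r, 'u) module \<Rightarrow> bool" where
  "left_approx R \<X> A f X \<longleftrightarrow>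
     X \<in> \<X> \<and> f \<in> mod_hom R A X \<and>
     (\<forall>X' \<in> \<X>. \<forall>g \<in> mod_hom R A X'. \<exists>h \<in> mod_hom R X X'. \<forall>a \<in> carrier A. g a = h (f a))"

definition right_approx ::
    "('r, 'k) ring_scheme \<Rightarrow> ('r, 'u) module set \<Rightarrow> ('r, 'u) module \<Rightarrow> ('u \<Rightarrow> 'u) \<Rightarrow>
     ('r, 'u) module \<Rightarrow> bool" where
  "right_approx R \<X> X f A \<longleftrightarrow>
     X \<in> \<X> \<and> f \<in> mod_hom R X A \<and>
     (\<forall>X' \<in> \<X>. \<forall>g \<in> mod_hom R X' A. \<exists>h \<in> mod_hom R X' X. \<forall>x \<in> carrier X'. g x = f (h x))"

definition contravariantly_finite ::
    "('r, 'k) ring_scheme \<Rightarrow> ('r, 'u) module set \<Rightarrow> bool" where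
  "contravariantly_finite R \<X> \<longleftrightarrow> (\<forall>A \<in> Mods R. \<exists>X f. right_approx R \<X> X f A)"

text \<open>The empty sum is included among the finite direct sums, so zero modules belong to \<open>\<X>\<close>.\<close>

definition additive_subcategory :: "('r, 'k) ring_scheme \<Rightarrow> ('r, 'u) module set \<Rightarrow> bool" where
  "additive_subcategory R \<X> \<longleftrightarrow>
     \<X> \<subseteq> Mods R \<and>
     (\<forall>X \<in> \<X>. \<forall>Y \<in> Mods R. isomorphic R X Y \<longrightarrow> Y \<in> \<X>) \<and>
     (\<forall>(n :: nat) X. (\<forall>i<n. X i \<in> \<X>) \<longrightarrow>
        (\<forall>Y \<in> Mods R. isomorphic R Y (dsum {..<n} X) \<longrightarrow> Y \<in> \<X>)) \<and>
     (\<forall>X \<in> \<X>. \<forall>Y \<in> Mods R. is_summand R Y X \<longrightarrow> Y \<in> \<X>)"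

definition projective :: "('r, 'k) ring_scheme \<Rightarrow> ('r, 'u) module \<Rightarrow> bool" where
  "projective R P \<longleftrightarrow>
     P \<in> Mods R \<and>
     (\<forall>X \<in> (Mods R :: ('r, 'u) module set). \<forall>Y \<in> (Mods R :: ('r, 'u) module set).
        \<forall>g \<in> mod_epi R X Y. \<forall>f \<in> mod_hom R P Y.
        \<exists>h \<in> mod_hom R P X. \<forall>x \<in> carrier P. g (h x) = f x)"

definition support_tau_tilting :: "('r, 'k) ring_scheme \<Rightarrow> ('r, 'u) module set \<Rightarrow> bool" where
  "support_tau_tilting R \<T> \<longleftrightarrow>
     additive_subcategory R \<T> \<and>
     contravariantly_finite R \<T> \<and>
     (\<forall>T1 \<in> \<T>. \<forall>T2 \<in> \<T>. \<forall>Y \<in> Fac_obj R T2. Ext1_vanishes R T1 Y) \<and>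
     (\<forall>P. projective R P \<longrightarrow>
        (\<exists>T0 \<in> \<T>. \<exists>T1 \<in> \<T>. \<exists>f g. right_exact R P f T0 g T1 \<and> left_approx R \<T> P f T0))"

definition support_tau_tilting_subcategories ::
    "('r, 'k) ring_scheme \<Rightarrow> ('r, 'u) module set set" where
  "support_tau_tilting_subcategories R = {\<T>. support_tau_tilting R \<T>}"

definition tau_tilting_equiv ::
    "('r, 'k) ring_scheme \<Rightarrow> (('r, 'u) module set \<times> ('r, 'u) module set) set" where
  "tau_tilting_equiv R =
     {(\<T>, \<T>'). \<T> \<in> support_tau_tilting_subcategories R \<and>
        \<T>' \<in> support_tau_tilting_subcategories R \<and> Fac R \<T> = Fac R \<T>'}"

end

theory Submission
  imports Defs
begin

text \<open>
  Both kinds of objects are classified by the class of modules that they generate: a support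
  \<open>\<tau>\<close>-tilting subcategory \<open>\<T>\<close> by \<open>Fac \<T>\<close>, which is how equivalence is defined, and a quasitilting
  module \<open>T\<close> by \<open>Gen T\<close>, because \<open>Add T\<close> is recovered from \<open>Gen T\<close> as its class of Ext-projective
  modules (\<open>Add_eq_Ext_projectives\<close>). It remains to see that the same classes occur on both sides.

  Given \<open>\<T>\<close>, let \<open>f : R \<rightarrow> T0\<close> be a left approximation of the regular module, with cokernel
  \<open>g : T0 \<rightarrow> T1\<close>, and put \<open>T = T0 \<oplus> T1\<close>. Elements of a module are the same as maps from \<open>R\<close> to it, so the
  approximation property says that every element of a module in \<open>\<T>\<close> is the image of \<open>f 1\<close> under some
  map on \<open>T0\<close>. Thus \<open>T\<close> is generated by one element over its endomorphism ring and
  \<open>Gen T = Fac \<T>\<close>. For \<open>Pres T = Gen T\<close> one needs that the kernel \<open>K\<close> of an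
  \<open>Add T\<close>-approximation \<open>p : N \<rightarrow> X\<close> is in \<open>Gen T\<close>: an element \<open>k\<close> of \<open>K\<close> is the value at \<open>f 1\<close> of some
  \<open>h : T0 \<rightarrow> N\<close>; then \<open>p \<circ> h\<close> kills \<open>f 1\<close>, so it factors through \<open>T1\<close> and lifts to \<open>l : T1 \<rightarrow> N\<close>, and
  \<open>h - l \<circ> g\<close> maps \<open>T0\<close> into \<open>K\<close> and still sends \<open>f 1\<close> to \<open>k\<close> (\<open>quasitilting_of_support_tau_tilting\<close>).

  Given a finendo quasitilting module \<open>T\<close>, the subcategory is \<open>Add T\<close>, for which
  \<open>Fac (Add T) = Gen T\<close> by definition. Finite generation over the endomorphism ring yields left
  approximations of the regular module, hence of free and of projective modules
  (\<open>Add_left_approx_projective\<close>). The cokernel of such an approximation is Ext-projective in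
  \<open>Gen T\<close> (\<open>left_approx_cokernel_Ext_projective\<close>) and therefore belongs to \<open>Add T\<close>
  (\<open>support_tau_tilting_Add\<close>).

  Two reformulations turn all arguments into lifting of maps: the vanishing of \<open>Ext\<close> is the lifting
  of maps through epimorphisms with the given kernel (\<open>Ext1_vanishes_lift\<close>), and \<open>Add T\<close> consists of
  the modules that are projective relative to the maps through which every map from \<open>T\<close> lifts
  (\<open>Add_iff_relatively_projective\<close>).
\<close>

section \<open>Small sets\<close>

lemma small_image: "small TYPE('u) A \<Longrightarrow> small TYPE('u) (f ` A)"
  unfolding small_def by (rule ordLeq_ordLess_trans[OF card_of_image])

lemma small_subset: "small TYPE('u) A \<Longrightarrow> B \<subseteq> A \<Longrightarrow> small TYPE('u) B"
  unfolding small_def by (rule ordLeq_ordLess_trans[OF card_of_mono1])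

lemma small_inj_on:
  assumes "inj_on f A" "f ` A \<subseteq> B" "small TYPE('u) B"
  shows "small TYPE('u) A"
  using assms unfolding small_def by (metis card_of_ordLeq ordLeq_ordLess_trans)

lemma small_embedding:
  fixes A :: "'a set"
  assumes "small TYPE('u) A"
  obtains f :: "'a \<Rightarrow> 'u" where "inj_on f A"
proof -
  have "|A| \<le>o |UNIV :: 'u set|"
    using assms unfolding small_def by (rule ordLess_imp_ordLeq)
  then obtain f :: "'a \<Rightarrow> 'u" where "inj_on f A" unfolding card_of_ordLeq[symmetric] by auto
  then show ?thesis using that by blast
qed

text \<open>
  The type of the universe cannot be read off from \<open>R\<close>, so it is carried by a parameter of its own.
\<close>

locale module_universe =
  fixes R :: "('r, 'k) ring_scheme" and U :: "'u itself"
  assumes universe: "inaccessible_universe U"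
    and ring: "ring R"
    and small_ring: "small U (carrier R)"
begin

lemma infinite_universe: "infinite (UNIV :: 'u set)"
proof -
  have "natLeq <o |UNIV :: 'u set|"
    using universe unfolding inaccessible_universe_def by blast
  then have "|UNIV :: nat set| \<le>o |UNIV :: 'u set|"
    by (meson card_of_nat ordIso_ordLeq_trans ordLess_imp_ordLeq)
  then show ?thesis using infinite_iff_card_of_nat by blast
qed

lemma small_finite: "finite A \<Longrightarrow> small TYPE('u) A"
  unfolding small_def using infinite_universe
  by (intro finite_ordLess_infinite[OF card_of_Well_order card_of_Well_order])
    (auto simp: Field_card_of)

lemma small_Pow:
  assumes "small TYPE('u) A"
  shows "small TYPE('u) (Pow A)"
proof -
  obtain f where f: "inj_on (f :: _ \<Rightarrow> 'u) A" using small_embedding[OF assms] .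
  have "|f ` A| <o |UNIV :: 'u set|"
    using small_image[OF assms] unfolding small_def .
  then have "small TYPE('u) (Pow (f ` A))"
    using universe unfolding inaccessible_universe_def small_def by blast
  moreover have "inj_on ((`) f) (Pow A)"
    using f by (rule inj_on_image_Pow)
  ultimately show ?thesis
    using small_inj_on[of "(`) f" "Pow A" "Pow (f ` A)"] by blast
qed

text \<open>
  Regularity of the cardinal of the universe is what keeps small unions of small sets small.
\<close>

lemma small_UNION:
  assumes "small TYPE('u) I" "\<And>i. i \<in> I \<Longrightarrow> small TYPE('u) (A i)"
  shows "small TYPE('u) (\<Union>i\<in>I. A i)"
proof -
  have "regularCard |UNIV :: 'u set|"
    using universe unfolding inaccessible_universe_def by blast
  moreover have "infinite (Field |UNIV :: 'u set| )"
    using infinite_universe by (simp add: Field_card_of)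
  ultimately show ?thesis
    using assms card_of_UNION_ordLess_infinite_Field_regularCard[of "|UNIV :: 'u set|" I A]
    unfolding small_def by (simp add: cinfinite_def card_of_Card_order)
qed

lemma small_Times:
  assumes "small TYPE('u) A" "small TYPE('u) B"
  shows "small TYPE('u) (A \<times> B)"
proof -
  have "A \<times> B = (\<Union>a\<in>A. Pair a ` B)" by auto
  then show ?thesis using small_UNION[OF assms(1) small_image[OF assms(2)]] by simp
qed

text \<open>
  A function on \<open>I\<close> is determined by its graph, a subset of the small set \<open>I \<times> (\<Union>i\<in>I. A i)\<close>.
\<close>

lemma small_PiE:
  assumes "small TYPE('u) I" "\<And>i. i \<in> I \<Longrightarrow> small TYPE('u) (A i)"
  shows "small TYPE('u) (PiE I A)"
proof (rule small_inj_on[where f = "\<lambda>f. (\<lambda>i. (i, f i)) ` I"])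
  show "inj_on (\<lambda>f. (\<lambda>i. (i, f i)) ` I) (PiE I A)"
  proof (rule inj_onI)
    fix f g assume f: "f \<in> PiE I A" and g: "g \<in> PiE I A"
      and eq: "(\<lambda>i. (i, f i)) ` I = (\<lambda>i. (i, g i)) ` I"
    show "f = g" using eq by (intro PiE_ext[OF f g]) auto
  qed
  show "(\<lambda>f. (\<lambda>i. (i, f i)) ` I) ` PiE I A \<subseteq> Pow (I \<times> (\<Union>i\<in>I. A i))" by (auto simp: PiE_def)
  show "small TYPE('u) (Pow (I \<times> (\<Union>i\<in>I. A i)))"
    by (intro small_Pow small_Times assms small_UNION)
qed

end

section \<open>Modules and homomorphisms\<close>

lemma right_module_abelian_group: "right_module R M \<Longrightarrow> abelian_group M"
  by (simp add: right_module_def)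

lemma right_module_ring: "right_module R M \<Longrightarrow> ring R"
  by (simp add: right_module_def)

lemma right_moduleI:
  assumes "ring R" "abelian_group M"
    "\<And>a x. \<lbrakk>a \<in> carrier R; x \<in> carrier M\<rbrakk> \<Longrightarrow> a \<odot>\<^bsub>M\<^esub> x \<in> carrier M"
    "\<And>a b x. \<lbrakk>a \<in> carrier R; b \<in> carrier R; x \<in> carrier M\<rbrakk> \<Longrightarrow>
       (a \<oplus>\<^bsub>R\<^esub> b) \<odot>\<^bsub>M\<^esub> x = a \<odot>\<^bsub>M\<^esub> x \<oplus>\<^bsub>M\<^esub> b \<odot>\<^bsub>M\<^esub> x"
    "\<And>a x y. \<lbrakk>a \<in> carrier R; x \<in> carrier M; y \<in> carrier M\<rbrakk> \<Longrightarrow>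
       a \<odot>\<^bsub>M\<^esub> (x \<oplus>\<^bsub>M\<^esub> y) = a \<odot>\<^bsub>M\<^esub> x \<oplus>\<^bsub>M\<^esub> a \<odot>\<^bsub>M\<^esub> y"
    "\<And>a b x. \<lbrakk>a \<in> carrier R; b \<in> carrier R; x \<in> carrier M\<rbrakk> \<Longrightarrow>
       (a \<otimes>\<^bsub>R\<^esub> b) \<odot>\<^bsub>M\<^esub> x = b \<odot>\<^bsub>M\<^esub> (a \<odot>\<^bsub>M\<^esub> x)"
    "\<And>x. x \<in> carrier M \<Longrightarrow> \<one>\<^bsub>R\<^esub> \<odot>\<^bsub>M\<^esub> x = x"
  shows "right_module R M"
  using assms by (simp add: right_module_def right_module_axioms_def)

context right_module
begin

lemma smult_zero:
  assumes "a \<in> carrier R" shows "a \<odot>\<^bsub>M\<^esub> \<zero>\<^bsub>M\<^esub> = \<zero>\<^bsub>M\<^esub>"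
proof -
  have "a \<odot>\<^bsub>M\<^esub> \<zero>\<^bsub>M\<^esub> \<oplus>\<^bsub>M\<^esub> a \<odot>\<^bsub>M\<^esub> \<zero>\<^bsub>M\<^esub> = a \<odot>\<^bsub>M\<^esub> \<zero>\<^bsub>M\<^esub>"
    using smult_r_distr[OF assms M.zero_closed M.zero_closed] by simp
  then show ?thesis
    using M.add.l_cancel_one[of "a \<odot>\<^bsub>M\<^esub> \<zero>\<^bsub>M\<^esub>" "a \<odot>\<^bsub>M\<^esub> \<zero>\<^bsub>M\<^esub>"] smult_closed[OF assms M.zero_closed]
    by simp
qed

lemma smult_uminus:
  assumes "a \<in> carrier R" "x \<in> carrier M"
  shows "a \<odot>\<^bsub>M\<^esub> (\<ominus>\<^bsub>M\<^esub> x) = \<ominus>\<^bsub>M\<^esub> (a \<odot>\<^bsub>M\<^esub> x)"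
proof -
  have "a \<odot>\<^bsub>M\<^esub> (\<ominus>\<^bsub>M\<^esub> x) \<oplus>\<^bsub>M\<^esub> a \<odot>\<^bsub>M\<^esub> x = \<zero>\<^bsub>M\<^esub>"
    using smult_r_distr[OF assms(1) M.a_inv_closed[OF assms(2)] assms(2)] assms
    by (simp add: M.l_neg smult_zero)
  then show ?thesis
    using assms by (intro M.minus_equality[symmetric]) (auto simp: smult_closed)
qed

lemma diff_eq_zero:
  assumes "x \<ominus>\<^bsub>M\<^esub> y = \<zero>\<^bsub>M\<^esub>" "x \<in> carrier M" "y \<in> carrier M"
  shows "x = y"
  using M.minus_equality[of x "\<ominus>\<^bsub>M\<^esub> y"] assms by (simp add: a_minus_def)

lemma smult_zero_scalar:
  assumes "x \<in> carrier M" shows "\<zero>\<^bsub>R\<^esub> \<odot>\<^bsub>M\<^esub> x = \<zero>\<^bsub>M\<^esub>"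
proof -
  have "\<zero>\<^bsub>R\<^esub> \<odot>\<^bsub>M\<^esub> x \<oplus>\<^bsub>M\<^esub> \<zero>\<^bsub>R\<^esub> \<odot>\<^bsub>M\<^esub> x = \<zero>\<^bsub>R\<^esub> \<odot>\<^bsub>M\<^esub> x"
    using smult_l_distr[OF R.zero_closed R.zero_closed assms] by simp
  then show ?thesis
    using M.add.l_cancel_one[of "\<zero>\<^bsub>R\<^esub> \<odot>\<^bsub>M\<^esub> x" "\<zero>\<^bsub>R\<^esub> \<odot>\<^bsub>M\<^esub> x"] smult_closed[OF R.zero_closed assms]
    by simp
qed

end

lemma mod_homI:
  assumes "\<And>x. x \<in> carrier M \<Longrightarrow> f x \<in> carrier N"
    "\<And>x y. x \<in> carrier M \<Longrightarrow> y \<in> carrier M \<Longrightarrow> f (x \<oplus>\<^bsub>M\<^esub> y) = f x \<oplus>\<^bsub>N\<^esub> f y"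
    "\<And>a x. a \<in> carrier R \<Longrightarrow> x \<in> carrier M \<Longrightarrow> f (a \<odot>\<^bsub>M\<^esub> x) = a \<odot>\<^bsub>N\<^esub> f x"
  shows "f \<in> mod_hom R M N"
  using assms unfolding mod_hom_def by auto

lemma hom_closed: "f \<in> mod_hom R M N \<Longrightarrow> x \<in> carrier M \<Longrightarrow> f x \<in> carrier N"
  unfolding mod_hom_def by auto

lemma hom_add:
  "f \<in> mod_hom R M N \<Longrightarrow> x \<in> carrier M \<Longrightarrow> y \<in> carrier M \<Longrightarrow> f (x \<oplus>\<^bsub>M\<^esub> y) = f x \<oplus>\<^bsub>N\<^esub> f y"
  unfolding mod_hom_def by auto

lemma hom_smult:
  "f \<in> mod_hom R M N \<Longrightarrow> a \<in> carrier R \<Longrightarrow> x \<in> carrier M \<Longrightarrow> f (a \<odot>\<^bsub>M\<^esub> x) = a \<odot>\<^bsub>N\<^esub> f x"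
  unfolding mod_hom_def by auto

lemma hom_zero:
  assumes "right_module R M" "right_module R N" "f \<in> mod_hom R M N"
  shows "f \<zero>\<^bsub>M\<^esub> = \<zero>\<^bsub>N\<^esub>"
proof -
  interpret A: right_module R M by fact
  interpret B: right_module R N by fact
  have c: "f \<zero>\<^bsub>M\<^esub> \<in> carrier N" using hom_closed[OF assms(3)] by simp
  have "f \<zero>\<^bsub>M\<^esub> \<oplus>\<^bsub>N\<^esub> f \<zero>\<^bsub>M\<^esub> = f \<zero>\<^bsub>M\<^esub>"
    using hom_add[OF assms(3), of "\<zero>\<^bsub>M\<^esub>" "\<zero>\<^bsub>M\<^esub>"] by simp
  then show ?thesis using B.M.add.l_cancel_one[OF c c] by simp
qed

lemma hom_uminus:
  assumes "right_module R M" "right_module R N" "f \<in> mod_hom R M N" "x \<in> carrier M"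
  shows "f (\<ominus>\<^bsub>M\<^esub> x) = \<ominus>\<^bsub>N\<^esub> f x"
proof -
  interpret A: right_module R M by fact
  interpret B: right_module R N by fact
  have "f (\<ominus>\<^bsub>M\<^esub> x) \<oplus>\<^bsub>N\<^esub> f x = \<zero>\<^bsub>N\<^esub>"
    using hom_add[OF assms(3), of "\<ominus>\<^bsub>M\<^esub> x" x] assms hom_zero[OF assms(1-3)]
    by (simp add: A.M.l_neg)
  then show ?thesis
    using assms hom_closed[OF assms(3)] by (intro B.M.minus_equality[symmetric]) auto
qed

lemma hom_diff:
  assumes "right_module R M" "right_module R N" "f \<in> mod_hom R M N"
    "x \<in> carrier M" "y \<in> carrier M"
  shows "f (x \<ominus>\<^bsub>M\<^esub> y) = f x \<ominus>\<^bsub>N\<^esub> f y"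
proof -
  interpret A: right_module R M by fact
  show ?thesis
    using assms by (simp add: a_minus_def hom_add[OF assms(3)] hom_uminus[OF assms(1-3)])
qed

lemma hom_id: "(\<lambda>x. x) \<in> mod_hom R M M"
  by (rule mod_homI) auto

lemma hom_comp:
  "f \<in> mod_hom R M N \<Longrightarrow> g \<in> mod_hom R N K \<Longrightarrow> (\<lambda>x. g (f x)) \<in> mod_hom R M K"
  by (rule mod_homI) (simp_all add: hom_closed hom_add hom_smult)

lemma hom_cong:
  assumes "f \<in> mod_hom R M N" "right_module R M" "\<And>x. x \<in> carrier M \<Longrightarrow> f x = g x"
  shows "g \<in> mod_hom R M N"
proof -
  interpret A: right_module R M by fact
  show ?thesis
    by (rule mod_homI)
      (simp_all flip: assms(3) add: hom_closed[OF assms(1)] hom_add[OF assms(1)]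
        hom_smult[OF assms(1)] A.smult_closed)
qed

lemma hom_zero_map: "right_module R N \<Longrightarrow> (\<lambda>_. \<zero>\<^bsub>N\<^esub>) \<in> mod_hom R M N"
proof -
  assume "right_module R N"
  then interpret B: right_module R N .
  show ?thesis by (rule mod_homI) (simp_all add: B.smult_zero)
qed

lemma hom_sum:
  assumes "right_module R N" "f \<in> mod_hom R M N" "g \<in> mod_hom R M N"
  shows "(\<lambda>x. f x \<oplus>\<^bsub>N\<^esub> g x) \<in> mod_hom R M N"
proof -
  interpret B: right_module R N by fact
  note * = hom_closed[OF assms(2)] hom_closed[OF assms(3)]
  show ?thesis
    by (rule mod_homI)
      (simp_all add: hom_add[OF assms(2)] hom_add[OF assms(3)] hom_smult[OF assms(2)]
        hom_smult[OF assms(3)] * B.smult_r_distr B.M.a_ac)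
qed

lemma hom_neg:
  assumes "right_module R N" "f \<in> mod_hom R M N"
  shows "(\<lambda>x. \<ominus>\<^bsub>N\<^esub> f x) \<in> mod_hom R M N"
proof -
  interpret B: right_module R N by fact
  show ?thesis
    by (rule mod_homI)
      (simp_all add: hom_add[OF assms(2)] hom_smult[OF assms(2)] hom_closed[OF assms(2)]
        B.smult_uminus B.M.minus_add)
qed

lemma hom_minus:
  assumes "right_module R N" "f \<in> mod_hom R M N" "g \<in> mod_hom R M N"
  shows "(\<lambda>x. f x \<ominus>\<^bsub>N\<^esub> g x) \<in> mod_hom R M N"
  unfolding a_minus_def by (rule hom_sum[OF assms(1,2) hom_neg[OF assms(1,3)]])

lemma mod_epi_hom: "f \<in> mod_epi R M N \<Longrightarrow> f \<in> mod_hom R M N"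
  by (simp add: mod_epi_def)

lemma mod_epi_obtain:
  assumes "f \<in> mod_epi R M N" "y \<in> carrier N"
  obtains x where "x \<in> carrier M" "f x = y"
proof -
  have "y \<in> f ` carrier M" using assms by (simp add: mod_epi_def)
  then show ?thesis using that by auto
qed

text \<open>
  The factorisation is defined on chosen preimages; since \<open>g\<close> kills the kernel of \<open>f\<close>, its values do
  not depend on the choice, and this is what makes it linear.
\<close>

lemma hom_factor_epi:
  assumes M: "right_module R M" and f: "f \<in> mod_epi R M N" and g: "g \<in> mod_hom R M K"
    and K: "right_module R K" and N: "right_module R N"
    and ker: "\<And>x. x \<in> carrier M \<Longrightarrow> f x = \<zero>\<^bsub>N\<^esub> \<Longrightarrow> g x = \<zero>\<^bsub>K\<^esub>"
  shows "\<exists>h \<in> mod_hom R N K. \<forall>x\<in>carrier M. h (f x) = g x"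
proof -
  interpret M: right_module R M by fact
  interpret N: right_module R N by fact
  interpret K: right_module R K by fact
  note fh = mod_epi_hom[OF f]
  have eq: "g x = g y" if "x \<in> carrier M" "y \<in> carrier M" "f x = f y" for x y
  proof -
    have "f (x \<ominus>\<^bsub>M\<^esub> y) = \<zero>\<^bsub>N\<^esub>"
      using that hom_diff[OF M N fh] hom_closed[OF fh] by (simp add: a_minus_def N.M.r_neg)
    then have "g x \<ominus>\<^bsub>K\<^esub> g y = \<zero>\<^bsub>K\<^esub>"
      using ker[of "x \<ominus>\<^bsub>M\<^esub> y"] that hom_diff[OF M K g] by simp
    then show ?thesis
      by (rule K.diff_eq_zero[OF _ hom_closed[OF g that(1)] hom_closed[OF g that(2)]])
  qed
  define s where "s = inv_into (carrier M) f"
  have im: "f ` carrier M = carrier N" using f by (simp add: mod_epi_def)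
  have s: "s y \<in> carrier M" "f (s y) = y" if "y \<in> carrier N" for y
    using that im inv_into_into[of y f "carrier M"] f_inv_into_f[of y f "carrier M"]
    by (auto simp: s_def)
  have "(\<lambda>y. g (s y)) \<in> mod_hom R N K"
  proof (rule mod_homI)
    fix x y assume "x \<in> carrier N" "y \<in> carrier N"
    then show "g (s (x \<oplus>\<^bsub>N\<^esub> y)) = g (s x) \<oplus>\<^bsub>K\<^esub> g (s y)"
      using eq[of "s (x \<oplus>\<^bsub>N\<^esub> y)" "s x \<oplus>\<^bsub>M\<^esub> s y"] s by (simp add: hom_add[OF fh] hom_add[OF g])
  next
    fix a x assume "a \<in> carrier R" "x \<in> carrier N"
    then show "g (s (a \<odot>\<^bsub>N\<^esub> x)) = a \<odot>\<^bsub>K\<^esub> g (s x)"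
      using eq[of "s (a \<odot>\<^bsub>N\<^esub> x)" "a \<odot>\<^bsub>M\<^esub> s x"] s
      by (simp add: hom_smult[OF fh] hom_smult[OF g] N.smult_closed M.smult_closed)
  qed (use s hom_closed[OF g] in auto)
  moreover have "g (s (f x)) = g x" if "x \<in> carrier M" for x
    using eq[OF s(1) that s(2)] hom_closed[OF fh that] by simp
  ultimately show ?thesis by (intro bexI[of _ "\<lambda>y. g (s y)"]) auto
qed

section \<open>Submodules, images and quotients\<close>

definition submod :: "('r, 'a) module \<Rightarrow> 'a set \<Rightarrow> ('r, 'a) module" where
  "submod M S = M\<lparr>carrier := S\<rparr>"

lemma submod_simps [simp]:
  "carrier (submod M S) = S" "x \<oplus>\<^bsub>submod M S\<^esub> y = x \<oplus>\<^bsub>M\<^esub> y" "\<zero>\<^bsub>submod M S\<^esub> = \<zero>\<^bsub>M\<^esub>"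
  "a \<odot>\<^bsub>submod M S\<^esub> x = a \<odot>\<^bsub>M\<^esub> x"
  by (simp_all add: submod_def)

lemma right_module_submod:
  assumes M: "right_module R M" and S: "S \<subseteq> carrier M" "\<zero>\<^bsub>M\<^esub> \<in> S"
    "\<And>x y. x \<in> S \<Longrightarrow> y \<in> S \<Longrightarrow> x \<oplus>\<^bsub>M\<^esub> y \<in> S"
    "\<And>x. x \<in> S \<Longrightarrow> \<ominus>\<^bsub>M\<^esub> x \<in> S"
    "\<And>a x. a \<in> carrier R \<Longrightarrow> x \<in> S \<Longrightarrow> a \<odot>\<^bsub>M\<^esub> x \<in> S"
  shows "right_module R (submod M S)"
proof -
  interpret M: right_module R M by fact
  note s = subsetD[OF S(1)]
  show ?thesis
  proof (rule right_moduleI)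
    show "abelian_group (submod M S)"
    proof (rule abelian_groupI)
      fix x assume x: "x \<in> carrier (submod M S)"
      show "\<exists>y\<in>carrier (submod M S). y \<oplus>\<^bsub>submod M S\<^esub> x = \<zero>\<^bsub>submod M S\<^esub>"
        using x S(4) s by (intro bexI[of _ "\<ominus>\<^bsub>M\<^esub> x"]) (auto simp: M.M.l_neg)
    qed (use S s in \<open>auto simp: M.M.a_ac\<close>)
  qed (use S s in \<open>auto simp: M.smult_l_distr M.smult_r_distr M.smult_assoc M.smult_one
        intro: right_module_ring[OF M]\<close>)
qed

lemma hom_submod_incl: "S \<subseteq> carrier M \<Longrightarrow> (\<lambda>x. x) \<in> mod_hom R (submod M S) M"
  by (rule mod_homI) auto

lemma hom_into_submod:
  "f \<in> mod_hom R M N \<Longrightarrow> (\<And>x. x \<in> carrier M \<Longrightarrow> f x \<in> S) \<Longrightarrow> f \<in> mod_hom R M (submod N S)"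
  by (rule mod_homI) (simp_all add: hom_add hom_smult)

lemma right_module_ker:
  assumes M: "right_module R M" and N: "right_module R N" and f: "f \<in> mod_hom R M N"
  shows "right_module R (submod M (mod_ker M N f))"
proof -
  interpret M: right_module R M by fact
  interpret N: right_module R N by fact
  show ?thesis
    by (rule right_module_submod[OF M])
      (auto simp: mod_ker_def hom_zero[OF M N f] hom_add[OF f] hom_uminus[OF M N f]
        hom_smult[OF f] N.smult_zero M.smult_closed)
qed

text \<open>
  The structure that a surjection \<open>q\<close> induces on its image. It serves both to move a module to
  another type (\<open>q\<close> injective) and to form a quotient by a submodule (\<open>q\<close> choosing a
  representative of each coset), so that quotients keep the type of their elements.
\<close>

definition image_module :: "('r, 'a) module \<Rightarrow> ('a \<Rightarrow> 'b) \<Rightarrow> ('r, 'b) module" where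
  "image_module M q =
     \<lparr>carrier = q ` carrier M, mult = undefined, one = undefined, zero = q \<zero>\<^bsub>M\<^esub>,
      add = (\<lambda>a b. q (inv_into (carrier M) q a \<oplus>\<^bsub>M\<^esub> inv_into (carrier M) q b)),
      smult = (\<lambda>r a. q (r \<odot>\<^bsub>M\<^esub> inv_into (carrier M) q a))\<rparr>"

lemma image_module_epi:
  assumes M: "right_module R M"
    and add: "\<And>x x' y y'. \<lbrakk>x \<in> carrier M; x' \<in> carrier M; y \<in> carrier M; y' \<in> carrier M;
      q x = q x'; q y = q y'\<rbrakk> \<Longrightarrow> q (x \<oplus>\<^bsub>M\<^esub> y) = q (x' \<oplus>\<^bsub>M\<^esub> y')"
    and smult: "\<And>a x x'. \<lbrakk>a \<in> carrier R; x \<in> carrier M; x' \<in> carrier M; q x = q x'\<rbrakk> \<Longrightarrow>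
      q (a \<odot>\<^bsub>M\<^esub> x) = q (a \<odot>\<^bsub>M\<^esub> x')"
  shows "right_module R (image_module M q)" "q \<in> mod_epi R M (image_module M q)"
proof -
  interpret M: right_module R M by fact
  let ?N = "image_module M q" and ?s = "inv_into (carrier M) q"
  have s: "?s (q x) \<in> carrier M" "q (?s (q x)) = q x" if "x \<in> carrier M" for x
    using that inv_into_into[of "q x" q "carrier M"] f_inv_into_f[of "q x" q "carrier M"] by auto
  have qa: "q x \<oplus>\<^bsub>?N\<^esub> q y = q (x \<oplus>\<^bsub>M\<^esub> y)" if "x \<in> carrier M" "y \<in> carrier M" for x y
    using that add[of "?s (q x)" x "?s (q y)" y] s by (simp add: image_module_def)
  have qs: "a \<odot>\<^bsub>?N\<^esub> q x = q (a \<odot>\<^bsub>M\<^esub> x)" if "a \<in> carrier R" "x \<in> carrier M" for a x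
    using that smult[of a "?s (q x)" x] s by (simp add: image_module_def)
  have c: "carrier ?N = q ` carrier M" and z: "\<zero>\<^bsub>?N\<^esub> = q \<zero>\<^bsub>M\<^esub>"
    by (simp_all add: image_module_def)
  show "right_module R ?N"
  proof (rule right_moduleI)
    show "abelian_group ?N"
    proof (rule abelian_groupI)
      fix x assume "x \<in> carrier ?N"
      then obtain u where u: "u \<in> carrier M" "x = q u" using c by auto
      show "\<exists>y\<in>carrier ?N. y \<oplus>\<^bsub>?N\<^esub> x = \<zero>\<^bsub>?N\<^esub>"
        using u by (intro bexI[of _ "q (\<ominus>\<^bsub>M\<^esub> u)"]) (auto simp: c z qa M.M.l_neg)
    qed (auto simp: c z qa M.M.a_ac)
  qed (auto simp: c qa qs M.smult_closed M.smult_l_distr M.smult_r_distr M.smult_assoc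
        M.smult_one intro: right_module_ring[OF M])
  show "q \<in> mod_epi R M ?N"
    unfolding mod_epi_def by (auto intro!: mod_homI simp: c qa qs)
qed

text \<open>
  Homomorphisms are arbitrary outside their domain, so an inverse is characterised by its values on
  the carriers only.
\<close>

lemma mod_iso_inverse:
  assumes M: "right_module R M" and f: "f \<in> mod_iso R M N"
  obtains g where "g \<in> mod_iso R N M" "\<And>x. x \<in> carrier M \<Longrightarrow> g (f x) = x"
    "\<And>y. y \<in> carrier N \<Longrightarrow> f (g y) = y"
proof -
  interpret M: right_module R M by fact
  have fh: "f \<in> mod_hom R M N" and b: "bij_betw f (carrier M) (carrier N)"
    using f by (auto simp: mod_iso_def)
  let ?g = "inv_into (carrier M) f"
  have gb: "bij_betw ?g (carrier N) (carrier M)" using b by (rule bij_betw_inv_into)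
  have gf: "?g (f x) = x" if "x \<in> carrier M" for x
    using b that by (rule bij_betw_inv_into_left)
  have fg: "f (?g y) = y" if "y \<in> carrier N" for y
    using b that by (rule bij_betw_inv_into_right)
  have gc: "?g y \<in> carrier M" if "y \<in> carrier N" for y
    using gb that by (auto simp: bij_betw_def)
  have "?g \<in> mod_hom R N M"
  proof (rule mod_homI)
    fix x y assume *: "x \<in> carrier N" "y \<in> carrier N"
    have "?g (x \<oplus>\<^bsub>N\<^esub> y) = ?g (f (?g x \<oplus>\<^bsub>M\<^esub> ?g y))" using * by (simp add: hom_add[OF fh] gc fg)
    also have "\<dots> = ?g x \<oplus>\<^bsub>M\<^esub> ?g y" using * by (simp add: gf gc)
    finally show "?g (x \<oplus>\<^bsub>N\<^esub> y) = ?g x \<oplus>\<^bsub>M\<^esub> ?g y" .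
  next
    fix a x assume *: "a \<in> carrier R" "x \<in> carrier N"
    have "?g (a \<odot>\<^bsub>N\<^esub> x) = ?g (f (a \<odot>\<^bsub>M\<^esub> ?g x))" using * by (simp add: hom_smult[OF fh] gc fg)
    also have "\<dots> = a \<odot>\<^bsub>M\<^esub> ?g x" using * by (simp add: gf gc M.smult_closed)
    finally show "?g (a \<odot>\<^bsub>N\<^esub> x) = a \<odot>\<^bsub>M\<^esub> ?g x" .
  qed (rule gc)
  then have "?g \<in> mod_iso R N M" using gb by (simp add: mod_iso_def)
  then show ?thesis using that gf fg by blast
qed

lemma Mods_right_module: "M \<in> Mods R \<Longrightarrow> right_module R M"
  by (simp add: Mods_def)

lemma Mods_small: "(M :: ('r, 'u) module) \<in> Mods R \<Longrightarrow> small TYPE('u) (carrier M)"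
  by (simp add: Mods_def)

text \<open>
  Constructions such as direct sums, kernels and pullbacks change the type of the elements. This
  lemma brings their results back among the objects of the category.
\<close>

lemma transport_to_Mods:
  fixes M :: "('r, 'a) module"
  assumes M: "right_module R M" and small: "small TYPE('u) (carrier M)"
  obtains N :: "('r, 'u) module" and f g where "N \<in> Mods R" "f \<in> mod_iso R M N"
    "g \<in> mod_iso R N M" "\<And>x. x \<in> carrier M \<Longrightarrow> g (f x) = x" "\<And>y. y \<in> carrier N \<Longrightarrow> f (g y) = y"
proof -
  interpret M: right_module R M by fact
  obtain q where q: "inj_on (q :: 'a \<Rightarrow> 'u) (carrier M)" using small_embedding[OF small] .
  let ?N = "image_module M q"
  have N: "right_module R ?N" "q \<in> mod_epi R M ?N"
    by (rule image_module_epi[OF M]; simp add: inj_on_eq_iff[OF q])+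
  have "?N \<in> Mods R"
    using N(1) small_image[OF small, of q] by (simp add: Mods_def image_module_def)
  moreover have iso: "q \<in> mod_iso R M ?N"
    using N(2) q by (auto simp: mod_iso_def mod_epi_def bij_betw_def)
  ultimately show ?thesis using mod_iso_inverse[OF M iso] that by metis
qed

text \<open>
  The cokernel is the image structure of a map that picks a representative in each coset of the image
  of \<open>f\<close>.
\<close>

lemma quotient_in_Mods:
  fixes M :: "('r, 'u) module"
  assumes M: "M \<in> Mods R" and N: "right_module R N" and f: "f \<in> mod_hom R N M"
  obtains C :: "('r, 'u) module" and q where "C \<in> Mods R" "right_exact R N f M q C"
proof -
  interpret M: right_module R M using M by (rule Mods_right_module)
  interpret N: right_module R N by fact
  have Mm: "right_module R M" by (rule M.right_module_axioms)
  let ?S = "f ` carrier N"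
  have S: "\<zero>\<^bsub>M\<^esub> \<in> ?S" "\<And>x y. x \<in> ?S \<Longrightarrow> y \<in> ?S \<Longrightarrow> x \<oplus>\<^bsub>M\<^esub> y \<in> ?S"
    "\<And>x. x \<in> ?S \<Longrightarrow> \<ominus>\<^bsub>M\<^esub> x \<in> ?S" "\<And>a x. a \<in> carrier R \<Longrightarrow> x \<in> ?S \<Longrightarrow> a \<odot>\<^bsub>M\<^esub> x \<in> ?S"
    "?S \<subseteq> carrier M"
  proof -
    show "\<zero>\<^bsub>M\<^esub> \<in> ?S" using hom_zero[OF N Mm f] N.M.zero_closed by (metis imageI)
    show "x \<oplus>\<^bsub>M\<^esub> y \<in> ?S" if "x \<in> ?S" "y \<in> ?S" for x y
      using that by (auto simp flip: hom_add[OF f])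
    show "\<ominus>\<^bsub>M\<^esub> x \<in> ?S" if "x \<in> ?S" for x
      using that by (auto simp flip: hom_uminus[OF N Mm f])
    show "a \<odot>\<^bsub>M\<^esub> x \<in> ?S" if "a \<in> carrier R" "x \<in> ?S" for a x
      using that by (auto simp: N.smult_closed simp flip: hom_smult[OF f])
    show "?S \<subseteq> carrier M" using hom_closed[OF f] by auto
  qed
  define coset where "coset x = {y \<in> carrier M. y \<ominus>\<^bsub>M\<^esub> x \<in> ?S}" for x
  define q where "q x = (SOME y. y \<in> coset x)" for x
  have self: "x \<in> coset x" if "x \<in> carrier M" for x
    using that S(1) by (simp add: coset_def a_minus_def M.M.r_neg)
  have trans: "x \<ominus>\<^bsub>M\<^esub> z \<in> ?S" if "x \<ominus>\<^bsub>M\<^esub> y \<in> ?S" "y \<ominus>\<^bsub>M\<^esub> z \<in> ?S"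
    "x \<in> carrier M" "y \<in> carrier M" "z \<in> carrier M" for x y z
  proof -
    have "x \<ominus>\<^bsub>M\<^esub> z = (x \<ominus>\<^bsub>M\<^esub> y) \<oplus>\<^bsub>M\<^esub> (y \<ominus>\<^bsub>M\<^esub> z)"
      using that by (simp add: a_minus_def M.M.a_assoc M.M.r_neg1)
    then show ?thesis using S(2) that by simp
  qed
  have sym: "y \<ominus>\<^bsub>M\<^esub> x \<in> ?S" if "x \<ominus>\<^bsub>M\<^esub> y \<in> ?S" "x \<in> carrier M" "y \<in> carrier M" for x y
  proof -
    have "y \<ominus>\<^bsub>M\<^esub> x = \<ominus>\<^bsub>M\<^esub> (x \<ominus>\<^bsub>M\<^esub> y)"
      using that by (simp add: a_minus_def M.M.minus_add M.M.a_comm)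
    then show ?thesis using S(3) that by simp
  qed
  have q: "q x \<in> coset x" if "x \<in> carrier M" for x
    unfolding q_def using self[OF that] by (rule someI)
  have qc: "q x \<in> carrier M" "q x \<ominus>\<^bsub>M\<^esub> x \<in> ?S" if "x \<in> carrier M" for x
    using q[OF that] by (simp_all add: coset_def)
  have eq_iff: "q x = q y \<longleftrightarrow> x \<ominus>\<^bsub>M\<^esub> y \<in> ?S" if "x \<in> carrier M" "y \<in> carrier M" for x y
  proof
    assume "q x = q y"
    then have "q x \<ominus>\<^bsub>M\<^esub> y \<in> ?S" using qc(2)[OF that(2)] by simp
    with sym[OF qc(2)[OF that(1)] qc(1)[OF that(1)] that(1)] show "x \<ominus>\<^bsub>M\<^esub> y \<in> ?S"
      by (rule trans[OF _ _ that(1) qc(1)[OF that(1)] that(2)])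
  next
    assume "x \<ominus>\<^bsub>M\<^esub> y \<in> ?S"
    note xy = this
    have "coset x \<subseteq> coset y"
      unfolding coset_def using trans[OF _ xy _ that] by blast
    moreover have "coset y \<subseteq> coset x"
      unfolding coset_def using trans[OF _ sym[OF xy that] _ that(2,1)] by blast
    ultimately have "coset x = coset y" by blast
    then show "q x = q y" by (simp add: q_def)
  qed
  let ?C = "image_module M q"
  have C: "right_module R ?C" "q \<in> mod_epi R M ?C"
  proof -
    have cong_add: "q (x \<oplus>\<^bsub>M\<^esub> y) = q (x' \<oplus>\<^bsub>M\<^esub> y')"
      if *: "x \<in> carrier M" "x' \<in> carrier M" "y \<in> carrier M" "y' \<in> carrier M"
        "q x = q x'" "q y = q y'" for x x' y y'
    proof -
      have "(x \<oplus>\<^bsub>M\<^esub> y) \<ominus>\<^bsub>M\<^esub> (x' \<oplus>\<^bsub>M\<^esub> y') = (x \<ominus>\<^bsub>M\<^esub> x') \<oplus>\<^bsub>M\<^esub> (y \<ominus>\<^bsub>M\<^esub> y')"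
        using * by (simp add: a_minus_def M.M.minus_add M.M.a_ac)
      then show ?thesis using * S(2) by (simp add: eq_iff)
    qed
    have cong_smult: "q (a \<odot>\<^bsub>M\<^esub> x) = q (a \<odot>\<^bsub>M\<^esub> x')"
      if *: "a \<in> carrier R" "x \<in> carrier M" "x' \<in> carrier M" "q x = q x'" for a x x'
    proof -
      have "a \<odot>\<^bsub>M\<^esub> x \<ominus>\<^bsub>M\<^esub> a \<odot>\<^bsub>M\<^esub> x' = a \<odot>\<^bsub>M\<^esub> (x \<ominus>\<^bsub>M\<^esub> x')"
        using * by (simp add: a_minus_def M.smult_r_distr M.smult_uminus)
      then show ?thesis using * S(4) by (simp add: eq_iff M.smult_closed)
    qed
    show "right_module R ?C" "q \<in> mod_epi R M ?C"
      by (rule image_module_epi[OF Mm]; rule cong_add cong_smult; assumption)+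
  qed
  have "?C \<in> Mods R"
    using C(1) small_image[OF Mods_small[OF M], of q] by (simp add: Mods_def image_module_def)
  moreover have "right_exact R N f M q ?C"
  proof -
    have "mod_ker M ?C q = {x \<in> carrier M. x \<ominus>\<^bsub>M\<^esub> \<zero>\<^bsub>M\<^esub> \<in> ?S}"
      by (auto simp: mod_ker_def image_module_def eq_iff)
    also have "\<dots> = {x \<in> carrier M. x \<in> ?S}"
    proof (rule Collect_cong, rule conj_cong[OF refl])
      fix x assume x: "x \<in> carrier M"
      have neg: "\<ominus>\<^bsub>M\<^esub> \<zero>\<^bsub>M\<^esub> = \<zero>\<^bsub>M\<^esub>" by (rule M.M.minus_equality) auto
      show "(x \<ominus>\<^bsub>M\<^esub> \<zero>\<^bsub>M\<^esub> \<in> ?S) = (x \<in> ?S)" using x by (simp add: a_minus_def neg)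
    qed
    also have "\<dots> = ?S" using S(5) by blast
    finally show ?thesis using f C(2) by (simp add: right_exact_def)
  qed
  ultimately show ?thesis by (rule that)
qed

section \<open>Direct sums\<close>

lemma carrier_dsum:
  "f \<in> carrier (dsum I M) \<longleftrightarrow> f \<in> (\<Pi>\<^sub>E i\<in>I. carrier (M i)) \<and> finite {i \<in> I. f i \<noteq> \<zero>\<^bsub>M i\<^esub>}"
  by (simp add: dsum_def)

lemma dsum_simps:
  "\<zero>\<^bsub>dsum I M\<^esub> = (\<lambda>i\<in>I. \<zero>\<^bsub>M i\<^esub>)"
  "f \<oplus>\<^bsub>dsum I M\<^esub> g = (\<lambda>i\<in>I. f i \<oplus>\<^bsub>M i\<^esub> g i)"
  "a \<odot>\<^bsub>dsum I M\<^esub> f = (\<lambda>i\<in>I. a \<odot>\<^bsub>M i\<^esub> f i)"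
  by (simp_all add: dsum_def)

lemma dsum_component: "f \<in> carrier (dsum I M) \<Longrightarrow> i \<in> I \<Longrightarrow> f i \<in> carrier (M i)"
  by (auto simp: carrier_dsum)

lemma dsum_add_closed:
  assumes "\<And>i. i \<in> I \<Longrightarrow> right_module R (M i)"
    and "f \<in> carrier (dsum I M)" "g \<in> carrier (dsum I M)"
  shows "f \<oplus>\<^bsub>dsum I M\<^esub> g \<in> carrier (dsum I M)"
proof -
  note ab = abelian_group.axioms(1)[OF right_module_abelian_group[OF assms(1)]]
  have "{i \<in> I. f i \<oplus>\<^bsub>M i\<^esub> g i \<noteq> \<zero>\<^bsub>M i\<^esub>} \<subseteq> {i \<in> I. f i \<noteq> \<zero>\<^bsub>M i\<^esub>} \<union> {i \<in> I. g i \<noteq> \<zero>\<^bsub>M i\<^esub>}"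
    using abelian_monoid.l_zero[OF ab abelian_monoid.zero_closed[OF ab]] by auto
  then have "finite {i \<in> I. f i \<oplus>\<^bsub>M i\<^esub> g i \<noteq> \<zero>\<^bsub>M i\<^esub>}"
    using assms(2,3) finite_subset by (auto simp: carrier_dsum)
  moreover have "f i \<oplus>\<^bsub>M i\<^esub> g i \<in> carrier (M i)" if "i \<in> I" for i
    using abelian_monoid.a_closed[OF ab[OF that]] dsum_component that assms(2,3) by metis
  ultimately show ?thesis by (simp add: carrier_dsum dsum_simps cong: conj_cong)
qed

lemma dsum_smult_closed:
  assumes "\<And>i. i \<in> I \<Longrightarrow> right_module R (M i)"
    and "a \<in> carrier R" "f \<in> carrier (dsum I M)"
  shows "a \<odot>\<^bsub>dsum I M\<^esub> f \<in> carrier (dsum I M)"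
proof -
  have "{i \<in> I. a \<odot>\<^bsub>M i\<^esub> f i \<noteq> \<zero>\<^bsub>M i\<^esub>} \<subseteq> {i \<in> I. f i \<noteq> \<zero>\<^bsub>M i\<^esub>}"
    using right_module.smult_zero[OF assms(1) assms(2)] by auto
  then have "finite {i \<in> I. a \<odot>\<^bsub>M i\<^esub> f i \<noteq> \<zero>\<^bsub>M i\<^esub>}"
    using assms(3) finite_subset by (auto simp: carrier_dsum)
  moreover have "a \<odot>\<^bsub>M i\<^esub> f i \<in> carrier (M i)" if "i \<in> I" for i
    using right_module.smult_closed[OF assms(1)[OF that]] dsum_component that assms(2,3) by metis
  ultimately show ?thesis by (simp add: carrier_dsum dsum_simps cong: conj_cong)
qed

lemma right_module_dsum:
  assumes R: "ring R" and M: "\<And>i. i \<in> I \<Longrightarrow> right_module R (M i)"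
  shows "right_module R (dsum I M)"
proof -
  interpret R: ring R by fact
  note rm = M
  note ag = right_module_abelian_group[OF M]
  note am = abelian_group.axioms(1)[OF ag]
  have ac: "f \<oplus>\<^bsub>dsum I M\<^esub> g \<in> carrier (dsum I M)"
    if "f \<in> carrier (dsum I M)" "g \<in> carrier (dsum I M)" for f g
    by (rule dsum_add_closed[OF M that])
  have sc: "a \<odot>\<^bsub>dsum I M\<^esub> f \<in> carrier (dsum I M)"
    if "a \<in> carrier R" "f \<in> carrier (dsum I M)" for a f
    by (rule dsum_smult_closed[OF M that])
  have zc: "\<zero>\<^bsub>dsum I M\<^esub> \<in> carrier (dsum I M)"
    using abelian_monoid.zero_closed[OF am]
    by (simp add: carrier_dsum dsum_simps cong: conj_cong)
  have ext: "f = g" if "f \<in> carrier (dsum I M)" "g \<in> carrier (dsum I M)"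
    "\<And>i. i \<in> I \<Longrightarrow> f i = g i" for f g
    using that by (intro PiE_ext[of f I _ g]) (auto simp: carrier_dsum)
  have dc: "f i \<in> carrier (M i)" if "f \<in> carrier (dsum I M)" "i \<in> I" for f i
    using that by (rule dsum_component)
  show ?thesis
  proof (rule right_moduleI[OF R])
    show "abelian_group (dsum I M)"
    proof (rule abelian_groupI)
      fix f g h assume *: "f \<in> carrier (dsum I M)" "g \<in> carrier (dsum I M)"
        "h \<in> carrier (dsum I M)"
      show "f \<oplus>\<^bsub>dsum I M\<^esub> g \<oplus>\<^bsub>dsum I M\<^esub> h = f \<oplus>\<^bsub>dsum I M\<^esub> (g \<oplus>\<^bsub>dsum I M\<^esub> h)"
      proof (rule ext)
        fix i assume i: "i \<in> I"
        show "(f \<oplus>\<^bsub>dsum I M\<^esub> g \<oplus>\<^bsub>dsum I M\<^esub> h) i = (f \<oplus>\<^bsub>dsum I M\<^esub> (g \<oplus>\<^bsub>dsum I M\<^esub> h)) i"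
          using i * dc[OF _ i] by (simp add: dsum_simps abelian_monoid.a_assoc[OF am[OF i]])
      qed (simp_all add: ac *)
    next
      fix f g assume *: "f \<in> carrier (dsum I M)" "g \<in> carrier (dsum I M)"
      show "f \<oplus>\<^bsub>dsum I M\<^esub> g = g \<oplus>\<^bsub>dsum I M\<^esub> f"
      proof (rule ext)
        fix i assume i: "i \<in> I"
        show "(f \<oplus>\<^bsub>dsum I M\<^esub> g) i = (g \<oplus>\<^bsub>dsum I M\<^esub> f) i"
          using i * dc[OF _ i] by (simp add: dsum_simps abelian_monoid.a_comm[OF am[OF i]])
      qed (simp_all add: ac *)
    next
      fix f assume *: "f \<in> carrier (dsum I M)"
      show "\<zero>\<^bsub>dsum I M\<^esub> \<oplus>\<^bsub>dsum I M\<^esub> f = f"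
      proof (rule ext)
        fix i assume i: "i \<in> I"
        show "(\<zero>\<^bsub>dsum I M\<^esub> \<oplus>\<^bsub>dsum I M\<^esub> f) i = f i"
          using i * dc[OF _ i] by (simp add: dsum_simps abelian_monoid.l_zero[OF am[OF i]])
      qed (simp_all add: ac zc *)
      \<comment> \<open>Multiplying by \<open>-1\<close> gives the negative with finiteness of its support for free.\<close>
      let ?g = "\<ominus>\<^bsub>R\<^esub> \<one>\<^bsub>R\<^esub> \<odot>\<^bsub>dsum I M\<^esub> f"
      have g: "?g \<in> carrier (dsum I M)" by (simp add: sc *)
      moreover have "?g \<oplus>\<^bsub>dsum I M\<^esub> f = \<zero>\<^bsub>dsum I M\<^esub>"
      proof (rule ext)
        fix i assume i: "i \<in> I"
        interpret N: right_module R "M i" using M[OF i] .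
        have "\<ominus>\<^bsub>R\<^esub> \<one>\<^bsub>R\<^esub> \<odot>\<^bsub>M i\<^esub> f i \<oplus>\<^bsub>M i\<^esub> f i = (\<ominus>\<^bsub>R\<^esub> \<one>\<^bsub>R\<^esub> \<oplus>\<^bsub>R\<^esub> \<one>\<^bsub>R\<^esub>) \<odot>\<^bsub>M i\<^esub> f i"
          using dc[OF * i] by (subst N.smult_l_distr) (auto simp: N.smult_one)
        also have "\<dots> = \<zero>\<^bsub>M i\<^esub>" using dc[OF * i] by (simp add: R.l_neg N.smult_zero_scalar)
        finally show "(?g \<oplus>\<^bsub>dsum I M\<^esub> f) i = \<zero>\<^bsub>dsum I M\<^esub> i" using i by (simp add: dsum_simps)
      qed (simp_all add: ac zc g *)
      ultimately show "\<exists>g\<in>carrier (dsum I M). g \<oplus>\<^bsub>dsum I M\<^esub> f = \<zero>\<^bsub>dsum I M\<^esub>" by blast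
    qed (simp_all add: ac zc)
  next
    fix a f assume *: "a \<in> carrier R" "f \<in> carrier (dsum I M)"
    show "a \<odot>\<^bsub>dsum I M\<^esub> f \<in> carrier (dsum I M)" by (simp add: sc *)
  next
    fix a b f assume *: "a \<in> carrier R" "b \<in> carrier R" "f \<in> carrier (dsum I M)"
    show "(a \<oplus>\<^bsub>R\<^esub> b) \<odot>\<^bsub>dsum I M\<^esub> f = a \<odot>\<^bsub>dsum I M\<^esub> f \<oplus>\<^bsub>dsum I M\<^esub> b \<odot>\<^bsub>dsum I M\<^esub> f"
      using * dc[OF *(3)]
      by (auto simp: dsum_simps right_module.smult_l_distr[OF M] intro: restrict_ext)
    show "(a \<otimes>\<^bsub>R\<^esub> b) \<odot>\<^bsub>dsum I M\<^esub> f = b \<odot>\<^bsub>dsum I M\<^esub> (a \<odot>\<^bsub>dsum I M\<^esub> f)"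
      using * dc[OF *(3)]
      by (auto simp: dsum_simps right_module.smult_assoc[OF M] intro: restrict_ext)
  next
    fix a f g assume *: "a \<in> carrier R" "f \<in> carrier (dsum I M)" "g \<in> carrier (dsum I M)"
    show "a \<odot>\<^bsub>dsum I M\<^esub> (f \<oplus>\<^bsub>dsum I M\<^esub> g) = a \<odot>\<^bsub>dsum I M\<^esub> f \<oplus>\<^bsub>dsum I M\<^esub> a \<odot>\<^bsub>dsum I M\<^esub> g"
      using * dc[OF *(2)] dc[OF *(3)]
      by (auto simp: dsum_simps right_module.smult_r_distr[OF M] intro: restrict_ext)
  next
    fix f assume *: "f \<in> carrier (dsum I M)"
    show "\<one>\<^bsub>R\<^esub> \<odot>\<^bsub>dsum I M\<^esub> f = f"
    proof (rule ext)
      fix i assume "i \<in> I"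
      then show "(\<one>\<^bsub>R\<^esub> \<odot>\<^bsub>dsum I M\<^esub> f) i = f i"
        using dc[OF *] by (simp add: dsum_simps right_module.smult_one[OF M])
    qed (simp_all add: sc *)
  qed
qed

definition dinj :: "'i set \<Rightarrow> ('i \<Rightarrow> ('r, 'a) module) \<Rightarrow> 'i \<Rightarrow> 'a \<Rightarrow> 'i \<Rightarrow> 'a" where
  "dinj I M i x = (\<lambda>j\<in>I. if j = i then x else \<zero>\<^bsub>M j\<^esub>)"

lemma dinj_support: "{j \<in> I. dinj I M i x j \<noteq> \<zero>\<^bsub>M j\<^esub>} \<subseteq> {i}"
  by (auto simp: dinj_def)

lemma dinj_closed:
  assumes "\<And>i. i \<in> I \<Longrightarrow> right_module R (M i)" "i \<in> I" "x \<in> carrier (M i)"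
  shows "dinj I M i x \<in> carrier (dsum I M)"
proof -
  note am = abelian_group.axioms(1)[OF right_module_abelian_group[OF assms(1)]]
  have "finite {j \<in> I. dinj I M i x j \<noteq> \<zero>\<^bsub>M j\<^esub>}"
    by (rule finite_subset[OF dinj_support]) simp
  moreover have "dinj I M i x \<in> (\<Pi>\<^sub>E i\<in>I. carrier (M i))"
    using assms(2,3) abelian_monoid.zero_closed[OF am] by (auto simp: dinj_def)
  ultimately show ?thesis by (simp add: carrier_dsum)
qed

lemma dinj_hom:
  assumes M: "\<And>i. i \<in> I \<Longrightarrow> right_module R (M i)" and i: "i \<in> I"
  shows "dinj I M i \<in> mod_hom R (M i) (dsum I M)"
proof (rule mod_homI)
  note am = abelian_group.axioms(1)[OF right_module_abelian_group[OF M]]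
  fix x y assume "x \<in> carrier (M i)" "y \<in> carrier (M i)"
  show "dinj I M i (x \<oplus>\<^bsub>M i\<^esub> y) = dinj I M i x \<oplus>\<^bsub>dsum I M\<^esub> dinj I M i y"
    using abelian_monoid.l_zero[OF am abelian_monoid.zero_closed[OF am]]
    by (auto simp: dinj_def dsum_simps intro!: restrict_ext)
next
  fix a x assume "a \<in> carrier R"
  then show "dinj I M i (a \<odot>\<^bsub>M i\<^esub> x) = a \<odot>\<^bsub>dsum I M\<^esub> dinj I M i x"
    using right_module.smult_zero[OF M] by (auto simp: dinj_def dsum_simps intro!: restrict_ext)
qed (rule dinj_closed[OF M i])

text \<open>
  A finitely supported family is the sum of its components, by induction on a finite set containing
  the support.
\<close>

lemma dsum_induct:
  assumes M: "\<And>i. i \<in> I \<Longrightarrow> right_module R (M i)"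
    and zero: "P \<zero>\<^bsub>dsum I M\<^esub>"
    and add: "\<And>x y. P x \<Longrightarrow> P y \<Longrightarrow> P (x \<oplus>\<^bsub>dsum I M\<^esub> y)"
    and inj: "\<And>i x. i \<in> I \<Longrightarrow> x \<in> carrier (M i) \<Longrightarrow> P (dinj I M i x)"
    and f: "f \<in> carrier (dsum I M)"
  shows "P f"
proof -
  note am = abelian_group.axioms(1)[OF right_module_abelian_group[OF M]]
  have "finite A \<Longrightarrow> \<forall>f \<in> carrier (dsum I M). {i \<in> I. f i \<noteq> \<zero>\<^bsub>M i\<^esub>} \<subseteq> A \<longrightarrow> P f" for A
  proof (induction A rule: finite_induct)
    case empty
    have "f = \<zero>\<^bsub>dsum I M\<^esub>" if "f \<in> carrier (dsum I M)" "{i \<in> I. f i \<noteq> \<zero>\<^bsub>M i\<^esub>} \<subseteq> {}" for f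
    proof (rule PiE_ext)
      show "f \<in> (\<Pi>\<^sub>E i\<in>I. carrier (M i))" using that by (simp add: carrier_dsum)
      show "\<zero>\<^bsub>dsum I M\<^esub> \<in> (\<Pi>\<^sub>E i\<in>I. carrier (M i))"
        using abelian_monoid.zero_closed[OF am] by (auto simp: dsum_simps)
    qed (use that in \<open>auto simp: dsum_simps\<close>)
    note * = this
    show ?case
    proof (intro ballI impI)
      fix f assume f: "f \<in> carrier (dsum I M)" "{i \<in> I. f i \<noteq> \<zero>\<^bsub>M i\<^esub>} \<subseteq> {}"
      show "P f" unfolding *[OF f] by (rule zero)
    qed
  next
    case (insert a A)
    show ?case
    proof (intro ballI impI)
      fix f assume f: "f \<in> carrier (dsum I M)" "{i \<in> I. f i \<noteq> \<zero>\<^bsub>M i\<^esub>} \<subseteq> insert a A"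
      define g where "g = (\<lambda>j\<in>I. if j = a then \<zero>\<^bsub>M j\<^esub> else f j)"
      have sub: "{i \<in> I. g i \<noteq> \<zero>\<^bsub>M i\<^esub>} \<subseteq> A" using f(2) by (auto simp: g_def)
      have "finite {i \<in> I. g i \<noteq> \<zero>\<^bsub>M i\<^esub>}" using sub insert.hyps(1) finite_subset by blast
      moreover have "g \<in> (\<Pi>\<^sub>E i\<in>I. carrier (M i))"
        using dsum_component[OF f(1)] abelian_monoid.zero_closed[OF am] by (auto simp: g_def)
      ultimately have Pg: "P g" using insert.IH sub by (simp add: carrier_dsum)
      show "P f"
      proof (cases "a \<in> I")
        case True
        have fg: "f = dinj I M a (f a) \<oplus>\<^bsub>dsum I M\<^esub> g"
        proof (rule PiE_ext)
          show "f \<in> (\<Pi>\<^sub>E i\<in>I. carrier (M i))" using f(1) by (simp add: carrier_dsum)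
          show "dinj I M a (f a) \<oplus>\<^bsub>dsum I M\<^esub> g \<in> (\<Pi>\<^sub>E i\<in>I. carrier (M i))"
            using dsum_component[OF f(1)] abelian_monoid.zero_closed[OF am]
              abelian_monoid.a_closed[OF am]
            by (auto simp: dsum_simps dinj_def g_def)
          fix i assume i: "i \<in> I"
          show "f i = (dinj I M a (f a) \<oplus>\<^bsub>dsum I M\<^esub> g) i"
            using i dsum_component[OF f(1) i] abelian_monoid.l_zero[OF am[OF i]]
              abelian_monoid.r_zero[OF am[OF i]]
            by (auto simp: dsum_simps dinj_def g_def)
        qed
        show ?thesis
          by (subst fg) (rule add[OF inj[OF True dsum_component[OF f(1) True]] Pg])
      next
        case False
        then have "f = g"
          using f(1) by (auto simp: g_def carrier_dsum PiE_def extensional_def fun_eq_iff)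
        then show ?thesis using Pg by simp
      qed
    qed
  qed
  from this[of "{i \<in> I. f i \<noteq> \<zero>\<^bsub>M i\<^esub>}"] show ?thesis using f by (auto simp: carrier_dsum)
qed

lemma smult_finsum:
  assumes M: "right_module R M" and a: "a \<in> carrier R" and A: "finite A"
  shows "g \<in> A \<rightarrow> carrier M \<Longrightarrow> a \<odot>\<^bsub>M\<^esub> finsum M g A = finsum M (\<lambda>i. a \<odot>\<^bsub>M\<^esub> g i) A"
  using A
proof (induction A rule: finite_induct)
  case empty
  interpret M: right_module R M by fact
  show ?case using a by (simp add: M.smult_zero)
next
  case (insert x F)
  interpret M: right_module R M by fact
  have F: "g \<in> F \<rightarrow> carrier M" "g x \<in> carrier M" using insert.prems by auto
  have "(\<lambda>i. a \<odot>\<^bsub>M\<^esub> g i) \<in> F \<rightarrow> carrier M" using F a M.smult_closed by auto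
  then show ?case
    using insert.IH[OF F(1)] insert.hyps F a
    by (simp add: M.M.finsum_insert M.smult_r_distr M.M.finsum_closed M.smult_closed)
qed

text \<open>
  The induced map sums \<open>h i (f i)\<close> over the support of \<open>f\<close>. The support is not additive in \<open>f\<close>, so
  linearity is checked after enlarging all index sets to a common finite one, outside of which every
  term is zero.
\<close>

lemma dsum_copair:
  assumes M: "\<And>i. i \<in> I \<Longrightarrow> right_module R (M i)" and X: "right_module R X"
    and h: "\<And>i. i \<in> I \<Longrightarrow> h i \<in> mod_hom R (M i) X"
  shows "\<exists>k \<in> mod_hom R (dsum I M) X. \<forall>i\<in>I. \<forall>x\<in>carrier (M i). k (dinj I M i x) = h i x"
proof -
  interpret X: right_module R X by fact
  define supp where "supp f = {i \<in> I. f i \<noteq> \<zero>\<^bsub>M i\<^esub>}" for f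
  define k where "k f = finsum X (\<lambda>i. h i (f i)) (supp f)" for f
  have hc: "(\<lambda>i. h i (f i)) \<in> A \<rightarrow> carrier X" if "f \<in> carrier (dsum I M)" "A \<subseteq> I" for f A
    using that dsum_component[OF that(1)] hom_closed[OF h] by auto
  have k: "k f = finsum X (\<lambda>i. h i (f i)) A"
    if "f \<in> carrier (dsum I M)" "finite A" "supp f \<subseteq> A" "A \<subseteq> I" for f A
    unfolding k_def
  proof (rule X.M.add.finprod_mono_neutral_cong_left[OF that(2,3)])
    fix i assume "i \<in> A - supp f"
    then have "i \<in> I" "f i = \<zero>\<^bsub>M i\<^esub>" using that(4) by (auto simp: supp_def)
    then show "h i (f i) = \<zero>\<^bsub>X\<^esub>" using hom_zero[OF M X h] by simp
  qed (use hc[OF that(1,4)] in auto)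
  have fin: "finite (supp f)" if "f \<in> carrier (dsum I M)" for f
    using that by (simp add: supp_def carrier_dsum)
  have suppI: "supp f \<subseteq> I" for f by (auto simp: supp_def)
  have "k \<in> mod_hom R (dsum I M) X"
  proof (rule mod_homI)
    fix f assume f: "f \<in> carrier (dsum I M)"
    show "k f \<in> carrier X"
      unfolding k_def by (intro X.M.finsum_closed hc[OF f suppI])
  next
    fix f g assume f: "f \<in> carrier (dsum I M)" and g: "g \<in> carrier (dsum I M)"
    define A where "A = supp f \<union> supp g \<union> supp (f \<oplus>\<^bsub>dsum I M\<^esub> g)"
    have fg: "f \<oplus>\<^bsub>dsum I M\<^esub> g \<in> carrier (dsum I M)" by (rule dsum_add_closed[OF M f g])
    have A: "finite A" "A \<subseteq> I" using fin[OF f] fin[OF g] fin[OF fg] suppI by (auto simp: A_def)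
    have sA: "supp f \<subseteq> A" "supp g \<subseteq> A" "supp (f \<oplus>\<^bsub>dsum I M\<^esub> g) \<subseteq> A" by (auto simp: A_def)
    have "k (f \<oplus>\<^bsub>dsum I M\<^esub> g) = finsum X (\<lambda>i. h i ((f \<oplus>\<^bsub>dsum I M\<^esub> g) i)) A"
      by (rule k[OF fg A(1) sA(3) A(2)])
    also have "\<dots> = finsum X (\<lambda>i. h i (f i) \<oplus>\<^bsub>X\<^esub> h i (g i)) A"
    proof (rule X.M.finsum_cong'[OF refl])
      show "(\<lambda>i. h i (f i) \<oplus>\<^bsub>X\<^esub> h i (g i)) \<in> A \<rightarrow> carrier X"
        using hc[OF f A(2)] hc[OF g A(2)] by auto
      fix i assume "i \<in> A"
      then have i: "i \<in> I" using A(2) by blast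
      then show "h i ((f \<oplus>\<^bsub>dsum I M\<^esub> g) i) = h i (f i) \<oplus>\<^bsub>X\<^esub> h i (g i)"
        using hom_add[OF h[OF i]] dsum_component[OF f] dsum_component[OF g] by (simp add: dsum_simps)
    qed
    also have "\<dots> = finsum X (\<lambda>i. h i (f i)) A \<oplus>\<^bsub>X\<^esub> finsum X (\<lambda>i. h i (g i)) A"
      by (rule X.M.finsum_addf[OF hc[OF f A(2)] hc[OF g A(2)]])
    also have "\<dots> = k f \<oplus>\<^bsub>X\<^esub> k g"
      using k[OF f A(1) sA(1) A(2)] k[OF g A(1) sA(2) A(2)] by simp
    finally show "k (f \<oplus>\<^bsub>dsum I M\<^esub> g) = k f \<oplus>\<^bsub>X\<^esub> k g" .
  next
    fix a f assume a: "a \<in> carrier R" and f: "f \<in> carrier (dsum I M)"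
    define A where "A = supp f \<union> supp (a \<odot>\<^bsub>dsum I M\<^esub> f)"
    have af: "a \<odot>\<^bsub>dsum I M\<^esub> f \<in> carrier (dsum I M)" by (rule dsum_smult_closed[OF M a f])
    have A: "finite A" "A \<subseteq> I" using fin[OF f] fin[OF af] suppI by (auto simp: A_def)
    have sA: "supp f \<subseteq> A" "supp (a \<odot>\<^bsub>dsum I M\<^esub> f) \<subseteq> A" by (auto simp: A_def)
    have "k (a \<odot>\<^bsub>dsum I M\<^esub> f) = finsum X (\<lambda>i. h i ((a \<odot>\<^bsub>dsum I M\<^esub> f) i)) A"
      by (rule k[OF af A(1) sA(2) A(2)])
    also have "\<dots> = finsum X (\<lambda>i. a \<odot>\<^bsub>X\<^esub> h i (f i)) A"
    proof (rule X.M.finsum_cong'[OF refl])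
      show "(\<lambda>i. a \<odot>\<^bsub>X\<^esub> h i (f i)) \<in> A \<rightarrow> carrier X"
        using hc[OF f A(2)] a X.smult_closed by auto
      fix i assume "i \<in> A"
      then have i: "i \<in> I" using A(2) by blast
      then show "h i ((a \<odot>\<^bsub>dsum I M\<^esub> f) i) = a \<odot>\<^bsub>X\<^esub> h i (f i)"
        using hom_smult[OF h[OF i] a] dsum_component[OF f] by (simp add: dsum_simps)
    qed
    also have "\<dots> = a \<odot>\<^bsub>X\<^esub> finsum X (\<lambda>i. h i (f i)) A"
      by (rule smult_finsum[OF X a A(1) hc[OF f A(2)], symmetric])
    also have "\<dots> = a \<odot>\<^bsub>X\<^esub> k f" using k[OF f A(1) sA(1) A(2)] by simp
    finally show "k (a \<odot>\<^bsub>dsum I M\<^esub> f) = a \<odot>\<^bsub>X\<^esub> k f" .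
  qed
  moreover have "k (dinj I M i x) = h i x" if i: "i \<in> I" and x: "x \<in> carrier (M i)" for i x
  proof -
    have "k (dinj I M i x) = finsum X (\<lambda>j. h j (dinj I M i x j)) {i}"
      using dinj_support[of I M i x] i
      by (intro k dinj_closed[of I R M i x, OF M i x]) (auto simp: supp_def)
    also have "\<dots> = h i x"
      using i x hom_closed[OF h] by (simp add: X.M.finsum_insert dinj_def)
    finally show ?thesis .
  qed
  ultimately show ?thesis by (intro bexI[of _ k]) auto
qed

text \<open>
  In contrast to \<^const>\<open>is_summand\<close>, this notion involves no complement, so that transitivity and the
  passage of lifting properties to retracts are a matter of composing maps.
\<close>

definition retract :: "('r, 'k) ring_scheme \<Rightarrow> ('r, 'a) module \<Rightarrow> ('r, 'b) module \<Rightarrow> bool" where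
  "retract R N X \<longleftrightarrow>
     (\<exists>i \<in> mod_hom R N X. \<exists>p \<in> mod_hom R X N. \<forall>n\<in>carrier N. p (i n) = n)"

lemma retractI:
  "i \<in> mod_hom R N X \<Longrightarrow> p \<in> mod_hom R X N \<Longrightarrow> (\<And>n. n \<in> carrier N \<Longrightarrow> p (i n) = n) \<Longrightarrow>
   retract R N X"
  unfolding retract_def by blast

lemma retractE:
  assumes "retract R N X"
  obtains i p where "i \<in> mod_hom R N X" "p \<in> mod_hom R X N"
    "\<And>n. n \<in> carrier N \<Longrightarrow> p (i n) = n"
  using assms unfolding retract_def by auto

lemma retract_trans:
  assumes "retract R L M" "retract R M N"
  shows "retract R L N"
proof -
  obtain i p where 1: "i \<in> mod_hom R L M" "p \<in> mod_hom R M L" "\<And>x. x \<in> carrier L \<Longrightarrow> p (i x) = x"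
    by (rule retractE[OF assms(1)]) blast
  obtain i' p' where 2: "i' \<in> mod_hom R M N" "p' \<in> mod_hom R N M"
    "\<And>x. x \<in> carrier M \<Longrightarrow> p' (i' x) = x"
    by (rule retractE[OF assms(2)]) blast
  show ?thesis
    by (rule retractI[OF hom_comp[OF 1(1) 2(1)] hom_comp[OF 2(2) 1(2)]])
      (simp add: 1(3) 2(3) hom_closed[OF 1(1)])
qed

lemma mod_iso_retract:
  assumes M: "right_module R M" and f: "f \<in> mod_iso R M N"
  shows "retract R M N" "retract R N M"
proof -
  obtain g where g: "g \<in> mod_iso R N M" "\<And>x. x \<in> carrier M \<Longrightarrow> g (f x) = x"
    "\<And>y. y \<in> carrier N \<Longrightarrow> f (g y) = y"
    by (rule mod_iso_inverse[OF M f]) blast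
  have "f \<in> mod_hom R M N" "g \<in> mod_hom R N M" using f g(1) by (simp_all add: mod_iso_def)
  then show "retract R M N" "retract R N M" using g(2,3) by (auto intro!: retractI)
qed

text \<open>
  A coproduct inside the universe. The last clause, an induction principle, says that the coproduct
  is generated by its summands; it yields the uniqueness part of the universal property.
\<close>

definition coproduct ::
    "('r, 'k) ring_scheme \<Rightarrow> 'i set \<Rightarrow> ('i \<Rightarrow> ('r, 'u) module) \<Rightarrow> ('r, 'u) module \<Rightarrow>
     ('i \<Rightarrow> 'u \<Rightarrow> 'u) \<Rightarrow> bool" where
  "coproduct R I M S j \<longleftrightarrow>
     S \<in> Mods R \<and> (\<forall>i\<in>I. j i \<in> mod_hom R (M i) S) \<and>
     (\<forall>X \<in> (Mods R :: ('r, 'u) module set). \<forall>h. (\<forall>i\<in>I. h i \<in> mod_hom R (M i) X) \<longrightarrow>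
        (\<exists>k \<in> mod_hom R S X. \<forall>i\<in>I. \<forall>x\<in>carrier (M i). k (j i x) = h i x)) \<and>
     (\<forall>P. P \<zero>\<^bsub>S\<^esub> \<and> (\<forall>x\<in>carrier S. \<forall>y\<in>carrier S. P x \<longrightarrow> P y \<longrightarrow> P (x \<oplus>\<^bsub>S\<^esub> y)) \<and>
        (\<forall>i\<in>I. \<forall>x\<in>carrier (M i). P (j i x)) \<longrightarrow> (\<forall>s\<in>carrier S. P s))"

lemma coproduct_Mods: "coproduct R I M S j \<Longrightarrow> S \<in> Mods R"
  by (simp add: coproduct_def)

lemma coproduct_inj: "coproduct R I M S j \<Longrightarrow> i \<in> I \<Longrightarrow> j i \<in> mod_hom R (M i) S"
  by (simp add: coproduct_def)

lemma coproduct_copair: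
  fixes S X :: "('r, 'u) module"
  assumes "coproduct R I M S j" "X \<in> Mods R" "\<And>i. i \<in> I \<Longrightarrow> h i \<in> mod_hom R (M i) X"
  shows "\<exists>k \<in> mod_hom R S X. \<forall>i\<in>I. \<forall>x\<in>carrier (M i). k (j i x) = h i x"
proof -
  have "\<forall>X \<in> (Mods R :: ('r, 'u) module set). \<forall>h. (\<forall>i\<in>I. h i \<in> mod_hom R (M i) X) \<longrightarrow>
      (\<exists>k \<in> mod_hom R S X. \<forall>i\<in>I. \<forall>x\<in>carrier (M i). k (j i x) = h i x)"
    using assms(1) unfolding coproduct_def by (elim conjE)
  from this[THEN bspec, OF assms(2), THEN spec, of h] show ?thesis using assms(3) by simp
qed

lemma coproduct_induct:
  assumes "coproduct R I M S j" "s \<in> carrier S" "P \<zero>\<^bsub>S\<^esub>"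
    "\<And>x y. x \<in> carrier S \<Longrightarrow> y \<in> carrier S \<Longrightarrow> P x \<Longrightarrow> P y \<Longrightarrow> P (x \<oplus>\<^bsub>S\<^esub> y)"
    "\<And>i x. i \<in> I \<Longrightarrow> x \<in> carrier (M i) \<Longrightarrow> P (j i x)"
  shows "P s"
proof -
  have "P \<zero>\<^bsub>S\<^esub> \<and> (\<forall>x\<in>carrier S. \<forall>y\<in>carrier S. P x \<longrightarrow> P y \<longrightarrow> P (x \<oplus>\<^bsub>S\<^esub> y)) \<and>
        (\<forall>i\<in>I. \<forall>x\<in>carrier (M i). P (j i x)) \<longrightarrow> (\<forall>s\<in>carrier S. P s)"
    using assms(1) unfolding coproduct_def by (elim conjE) (erule spec)
  then show ?thesis using assms(2-5) by simp
qed

lemma coproduct_hom_eq: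
  assumes "coproduct R I M S j" "right_module R X" "f \<in> mod_hom R S X" "g \<in> mod_hom R S X"
    "\<And>i x. i \<in> I \<Longrightarrow> x \<in> carrier (M i) \<Longrightarrow> f (j i x) = g (j i x)" "s \<in> carrier S"
  shows "f s = g s"
proof (rule coproduct_induct[OF assms(1,6)])
  have S: "right_module R S" using coproduct_Mods[OF assms(1)] by (rule Mods_right_module)
  show "f \<zero>\<^bsub>S\<^esub> = g \<zero>\<^bsub>S\<^esub>"
    using hom_zero[OF S assms(2,3)] hom_zero[OF S assms(2,4)] by simp
qed (use assms(5) in \<open>auto simp: hom_add[OF assms(3)] hom_add[OF assms(4)]\<close>)

lemma coproduct_retract:
  assumes S: "coproduct R I M S j" and i: "i \<in> I" and M: "M i \<in> Mods R"
  shows "retract R (M i) S"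
proof -
  define h where "h k = (if k = i then (\<lambda>x. x) else (\<lambda>_. \<zero>\<^bsub>M i\<^esub>))" for k
  have h: "h k \<in> mod_hom R (M k) (M i)" for k
    using hom_id hom_zero_map[OF Mods_right_module[OF M]] by (auto simp: h_def)
  obtain p where p: "p \<in> mod_hom R S (M i)" "\<forall>k\<in>I. \<forall>x\<in>carrier (M k). p (j k x) = h k x"
    using coproduct_copair[OF S M h] ..
  show ?thesis
    by (rule retractI[OF coproduct_inj[OF S i] p(1)]) (use p(2) i in \<open>simp add: h_def\<close>)
qed

context module_universe
begin

lemma small_dsum:
  assumes "small TYPE('u) I" "\<And>i. i \<in> I \<Longrightarrow> small TYPE('u) (carrier (M i))"
  shows "small TYPE('u) (carrier (dsum I M))"
  by (rule small_subset[OF small_PiE[OF assms]]) (auto simp: carrier_dsum)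

lemma coproduct_exists:
  fixes M :: "'i \<Rightarrow> ('r, 'u) module"
  assumes I: "small TYPE('u) I" and M: "\<And>i. i \<in> I \<Longrightarrow> M i \<in> Mods R"
  shows "\<exists>S j. coproduct R I M S j \<and> mod_iso R (dsum I M) S \<noteq> {}"
proof -
  note Mr = Mods_right_module[OF M]
  have D: "right_module R (dsum I M)" by (rule right_module_dsum[OF ring Mr])
  have sD: "small TYPE('u) (carrier (dsum I M))"
    by (rule small_dsum[OF I Mods_small[OF M]])
  obtain S :: "('r, 'u) module" and f g where S: "S \<in> Mods R" and f: "f \<in> mod_iso R (dsum I M) S"
    and g: "g \<in> mod_iso R S (dsum I M)" and gf: "\<And>x. x \<in> carrier (dsum I M) \<Longrightarrow> g (f x) = x"
    and fg: "\<And>y. y \<in> carrier S \<Longrightarrow> f (g y) = y"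
    by (rule transport_to_Mods[OF D sD]) blast
  have fh: "f \<in> mod_hom R (dsum I M) S" and gh: "g \<in> mod_hom R S (dsum I M)"
    using f g by (auto simp: mod_iso_def)
  have "coproduct R I M S (\<lambda>i x. f (dinj I M i x))"
    unfolding coproduct_def
  proof (intro conjI ballI allI impI)
    show "S \<in> Mods R" by (rule S)
  next
    fix i assume i: "i \<in> I"
    show "(\<lambda>x. f (dinj I M i x)) \<in> mod_hom R (M i) S" by (rule hom_comp[OF dinj_hom[OF Mr i] fh])
  next
    fix X :: "('r, 'u) module" and h assume X: "X \<in> Mods R" "\<forall>i\<in>I. h i \<in> mod_hom R (M i) X"
    obtain k where k: "k \<in> mod_hom R (dsum I M) X"
      "\<forall>i\<in>I. \<forall>x\<in>carrier (M i). k (dinj I M i x) = h i x"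
      using dsum_copair[of I R M X h, OF Mr Mods_right_module[OF X(1)] bspec[OF X(2)]] by auto
    show "\<exists>k\<in>mod_hom R S X. \<forall>i\<in>I. \<forall>x\<in>carrier (M i). k (f (dinj I M i x)) = h i x"
    proof (intro bexI ballI)
      show "(\<lambda>s. k (g s)) \<in> mod_hom R S X" by (rule hom_comp[OF gh k(1)])
      fix i x assume "i \<in> I" "x \<in> carrier (M i)"
      then show "k (g (f (dinj I M i x))) = h i x"
        using k(2) gf dinj_closed[of I R M, OF Mr] by simp
    qed
  next
    fix P s
    assume P: "P \<zero>\<^bsub>S\<^esub> \<and> (\<forall>x\<in>carrier S. \<forall>y\<in>carrier S. P x \<longrightarrow> P y \<longrightarrow> P (x \<oplus>\<^bsub>S\<^esub> y)) \<and>
        (\<forall>i\<in>I. \<forall>x\<in>carrier (M i). P (f (dinj I M i x)))" and s: "s \<in> carrier S"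
    have "g s \<in> carrier (dsum I M) \<and> P (f (g s))"
    proof (rule dsum_induct[where P = "\<lambda>x. x \<in> carrier (dsum I M) \<and> P (f x)" and R = R, OF Mr])
      show "\<zero>\<^bsub>dsum I M\<^esub> \<in> carrier (dsum I M) \<and> P (f \<zero>\<^bsub>dsum I M\<^esub>)"
        using P hom_zero[OF D Mods_right_module[OF S] fh]
          abelian_monoid.zero_closed[OF abelian_group.axioms(1)[OF right_module_abelian_group[OF D]]]
        by simp
      fix x y assume "x \<in> carrier (dsum I M) \<and> P (f x)" "y \<in> carrier (dsum I M) \<and> P (f y)"
      then show "x \<oplus>\<^bsub>dsum I M\<^esub> y \<in> carrier (dsum I M) \<and> P (f (x \<oplus>\<^bsub>dsum I M\<^esub> y))"
        using P dsum_add_closed[of I R M x y, OF Mr] by (simp add: hom_add[OF fh] hom_closed[OF fh])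
    next
      show "g s \<in> carrier (dsum I M)" by (rule hom_closed[OF gh s])
    qed (use P dinj_closed[of I R M, OF Mr] in auto)
    then show "P s" using fg[OF s] by simp
  qed
  then show ?thesis using f by blast
qed

end

section \<open>Direct summands\<close>

lemma dsum2_simps [simp]:
  "carrier (dsum2 M N) = carrier M \<times> carrier N"
  "\<zero>\<^bsub>dsum2 M N\<^esub> = (\<zero>\<^bsub>M\<^esub>, \<zero>\<^bsub>N\<^esub>)"
  "x \<oplus>\<^bsub>dsum2 M N\<^esub> y = (fst x \<oplus>\<^bsub>M\<^esub> fst y, snd x \<oplus>\<^bsub>N\<^esub> snd y)"
  "a \<odot>\<^bsub>dsum2 M N\<^esub> x = (a \<odot>\<^bsub>M\<^esub> fst x, a \<odot>\<^bsub>N\<^esub> snd x)"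
  by (simp_all add: dsum2_def)

lemma right_module_dsum2:
  assumes M: "right_module R M" and N: "right_module R N"
  shows "right_module R (dsum2 M N)"
proof -
  interpret M: right_module R M by fact
  interpret N: right_module R N by fact
  show ?thesis
  proof (rule right_moduleI[OF right_module_ring[OF M]])
    show "abelian_group (dsum2 M N)"
    proof (rule abelian_groupI)
      fix x assume "x \<in> carrier (dsum2 M N)"
      then show "\<exists>y\<in>carrier (dsum2 M N). y \<oplus>\<^bsub>dsum2 M N\<^esub> x = \<zero>\<^bsub>dsum2 M N\<^esub>"
        by (intro bexI[of _ "(\<ominus>\<^bsub>M\<^esub> fst x, \<ominus>\<^bsub>N\<^esub> snd x)"]) (auto simp: M.M.l_neg N.M.l_neg)
    qed (auto simp: M.M.a_ac N.M.a_ac)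
  qed (auto simp: M.smult_closed N.smult_closed M.smult_l_distr N.smult_l_distr M.smult_r_distr
      N.smult_r_distr M.smult_assoc N.smult_assoc M.smult_one N.smult_one)
qed

text \<open>
  The complement of a retract is the kernel of the retraction \<open>p\<close>, moved into the universe; every
  \<open>x\<close> is \<open>i (p x)\<close> plus an element of that kernel.
\<close>

lemma is_summand_iff_retract:
  fixes N :: "('r, 'u) module" and X :: "('r, 'a) module"
  assumes N: "right_module R N" and X: "right_module R X" and small: "small TYPE('u) (carrier X)"
  shows "is_summand R N X \<longleftrightarrow> retract R N X"
proof
  interpret N: right_module R N by fact
  assume "is_summand R N X"
  then obtain K :: "('r, 'u) module" and f where K: "K \<in> Mods R" and f: "f \<in> mod_iso R (dsum2 N K) X"
    unfolding is_summand_def isomorphic_def by auto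
  interpret K: right_module R K using K by (rule Mods_right_module)
  have D: "right_module R (dsum2 N K)" by (rule right_module_dsum2) unfold_locales
  obtain g where g: "g \<in> mod_iso R X (dsum2 N K)" and gf: "\<And>x. x \<in> carrier (dsum2 N K) \<Longrightarrow> g (f x) = x"
    by (rule mod_iso_inverse[OF D f]) blast
  have fh: "f \<in> mod_hom R (dsum2 N K) X" and gh: "g \<in> mod_hom R X (dsum2 N K)"
    using f g by (auto simp: mod_iso_def)
  have "(\<lambda>n. (n, \<zero>\<^bsub>K\<^esub>)) \<in> mod_hom R N (dsum2 N K)"
    by (rule mod_homI) (auto simp: K.smult_zero)
  then have i: "(\<lambda>n. f (n, \<zero>\<^bsub>K\<^esub>)) \<in> mod_hom R N X" using fh by (rule hom_comp)
  have "fst \<in> mod_hom R (dsum2 N K) N" by (rule mod_homI) auto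
  then have p: "(\<lambda>x. fst (g x)) \<in> mod_hom R X N" by (rule hom_comp[OF gh])
  show "retract R N X" by (rule retractI[OF i p]) (simp add: gf)
next
  interpret N: right_module R N by fact
  interpret X: right_module R X by fact
  assume "retract R N X"
  then obtain i p where i: "i \<in> mod_hom R N X" and p: "p \<in> mod_hom R X N"
    and pi: "\<And>n. n \<in> carrier N \<Longrightarrow> p (i n) = n" by (rule retractE) blast
  let ?K = "submod X (mod_ker X N p)"
  have K0: "right_module R ?K" by (rule right_module_ker[OF X N p])
  have "small TYPE('u) (carrier ?K)"
    by (rule small_subset[OF small]) (auto simp: mod_ker_def)
  from transport_to_Mods[OF K0 this] obtain K :: "('r, 'u) module" and f g where
    K: "K \<in> Mods R" and f: "f \<in> mod_iso R ?K K" and g: "g \<in> mod_iso R K ?K"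
    and gf: "\<And>x. x \<in> carrier ?K \<Longrightarrow> g (f x) = x" and fg: "\<And>x. x \<in> carrier K \<Longrightarrow> f (g x) = x"
    by blast
  have fh: "f \<in> mod_hom R ?K K" and gh: "g \<in> mod_hom R K ?K"
    using f g by (auto simp: mod_iso_def)
  have gX: "g k \<in> carrier X" "p (g k) = \<zero>\<^bsub>N\<^esub>" if "k \<in> carrier K" for k
    using hom_closed[OF gh that] by (auto simp: mod_ker_def)
  define \<phi> where "\<phi> = (\<lambda>x. i (fst x) \<oplus>\<^bsub>X\<^esub> g (snd x))"
  note ic = hom_closed[OF i] and pc = hom_closed[OF p]
  have "\<phi> \<in> mod_hom R (dsum2 N K) X"
    by (rule mod_homI)
      (auto simp: \<phi>_def ic gX hom_add[OF i] hom_smult[OF i] hom_add[OF gh] hom_smult[OF gh]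
        X.M.a_ac X.smult_r_distr X.smult_closed)
  moreover have "bij_betw \<phi> (carrier (dsum2 N K)) (carrier X)"
  proof (rule bij_betw_byWitness[where f' = "\<lambda>x. (p x, f (x \<ominus>\<^bsub>X\<^esub> i (p x)))"])
    show "\<forall>x\<in>carrier (dsum2 N K). (p (\<phi> x), f (\<phi> x \<ominus>\<^bsub>X\<^esub> i (p (\<phi> x)))) = x"
    proof
      fix x assume x: "x \<in> carrier (dsum2 N K)"
      then have c: "fst x \<in> carrier N" "snd x \<in> carrier K" by auto
      have px: "p (\<phi> x) = fst x"
        using c by (simp add: \<phi>_def hom_add[OF p] ic gX pi)
      have "\<phi> x \<ominus>\<^bsub>X\<^esub> i (p (\<phi> x)) = g (snd x)"
        unfolding px using c ic[of "fst x"] gX[of "snd x"]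
        by (simp add: \<phi>_def a_minus_def X.M.a_ac X.M.r_neg1 X.M.r_neg2 X.M.r_neg X.M.a_assoc
            X.M.a_comm[of "i (fst x)"])
      then show "(p (\<phi> x), f (\<phi> x \<ominus>\<^bsub>X\<^esub> i (p (\<phi> x)))) = x" using c px fg by simp
    qed
    have ker: "x \<ominus>\<^bsub>X\<^esub> i (p x) \<in> carrier ?K" if "x \<in> carrier X" for x
      using that ic pc pi hom_diff[OF X N p] by (simp add: mod_ker_def a_minus_def N.M.r_neg)
    show "\<forall>x\<in>carrier X. \<phi> (p x, f (x \<ominus>\<^bsub>X\<^esub> i (p x))) = x"
    proof
      fix x assume x: "x \<in> carrier X"
      show "\<phi> (p x, f (x \<ominus>\<^bsub>X\<^esub> i (p x))) = x"
        using x ic[OF pc[OF x]] gf[OF ker[OF x]]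
        by (simp add: \<phi>_def a_minus_def X.M.a_comm[of x] X.M.r_neg2)
    qed
    show "\<phi> ` carrier (dsum2 N K) \<subseteq> carrier X" using gX ic by (auto simp: \<phi>_def)
    show "(\<lambda>x. (p x, f (x \<ominus>\<^bsub>X\<^esub> i (p x)))) ` carrier X \<subseteq> carrier (dsum2 N K)"
      using pc hom_closed[OF fh ker] by auto
  qed
  ultimately have "\<phi> \<in> mod_iso R (dsum2 N K) X" by (simp add: mod_iso_def)
  then show "is_summand R N X" using K unfolding is_summand_def isomorphic_def by blast
qed

section \<open>Vanishing of Ext as a lifting property\<close>

lemma mod_iso_comp:
  "f \<in> mod_iso R M N \<Longrightarrow> g \<in> mod_iso R N K \<Longrightarrow> (\<lambda>x. g (f x)) \<in> mod_iso R M K"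
  unfolding mod_iso_def using hom_comp bij_betw_trans[of f _ _ g] by (auto simp: comp_def)

lemma mod_iso_id: "(\<lambda>x. x) \<in> mod_iso R M M"
  by (simp add: mod_iso_def hom_id bij_betw_def)

context
  fixes R :: "('r, 'k) ring_scheme" and A B :: "('r, 'u) module"
  assumes A: "A \<in> Mods R" and B: "B \<in> Mods R"
begin

private lemmas Am = Mods_right_module[OF A] and Bm = Mods_right_module[OF B]

lemma short_exactD:
  assumes "short_exact R B i E p C"
  shows "inj_on i (carrier B)" "i \<in> mod_hom R B E" "p \<in> mod_hom R E C"
    "p ` carrier E = carrier C" "i ` carrier B = mod_ker E C p"
  using assms by (auto simp: short_exact_def right_exact_def mod_epi_def)

text \<open>
  Given a section \<open>s\<close>, the map \<open>(b, a) \<mapsto> i b + s a\<close> identifies \<open>B \<oplus> A\<close> with \<open>E\<close>.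
\<close>

lemma split_extension_iff_section:
  assumes x: "(E, i, p) \<in> extensions R A B"
  shows "(E, i, p) \<in> Ext1_zero R A B \<longleftrightarrow> (\<exists>s \<in> mod_hom R A E. \<forall>a\<in>carrier A. p (s a) = a)"
proof -
  interpret A: right_module R A by (rule Am)
  interpret B: right_module R B by (rule Bm)
  have E: "right_module R E" and se: "short_exact R B i E p A"
    using x by (auto simp: extensions_def Mods_def)
  interpret E: right_module R E by (rule E)
  note se = short_exactD[OF se]
  have D: "right_module R (dsum2 B A)" by (rule right_module_dsum2[OF Bm Am])
  have pi: "p (i b) = \<zero>\<^bsub>A\<^esub>" if "b \<in> carrier B" for b
    using se(5) that by (auto simp: mod_ker_def)
  show ?thesis
  proof
    assume "(E, i, p) \<in> Ext1_zero R A B"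
    then obtain \<phi> where \<phi>: "\<phi> \<in> mod_iso R E (dsum2 B A)"
      and snd: "\<And>e. e \<in> carrier E \<Longrightarrow> snd (\<phi> e) = p e"
      by (auto simp: Ext1_zero_def ext_equiv_def)
    obtain \<psi> where \<psi>: "\<psi> \<in> mod_iso R (dsum2 B A) E"
      and \<phi>\<psi>: "\<And>y. y \<in> carrier (dsum2 B A) \<Longrightarrow> \<phi> (\<psi> y) = y"
      by (rule mod_iso_inverse[OF E \<phi>]) blast
    have \<psi>h: "\<psi> \<in> mod_hom R (dsum2 B A) E" using \<psi> by (simp add: mod_iso_def)
    have "(\<lambda>a. (\<zero>\<^bsub>B\<^esub>, a)) \<in> mod_hom R A (dsum2 B A)"
      by (rule mod_homI) (auto simp: B.smult_zero)
    then have "(\<lambda>a. \<psi> (\<zero>\<^bsub>B\<^esub>, a)) \<in> mod_hom R A E" using \<psi>h by (rule hom_comp)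
    moreover have "p (\<psi> (\<zero>\<^bsub>B\<^esub>, a)) = a" if "a \<in> carrier A" for a
      using that snd[of "\<psi> (\<zero>\<^bsub>B\<^esub>, a)"] \<phi>\<psi>[of "(\<zero>\<^bsub>B\<^esub>, a)"] hom_closed[OF \<psi>h, of "(\<zero>\<^bsub>B\<^esub>, a)"] by simp
    ultimately show "\<exists>s \<in> mod_hom R A E. \<forall>a\<in>carrier A. p (s a) = a"
      by (intro bexI[of _ "\<lambda>a. \<psi> (\<zero>\<^bsub>B\<^esub>, a)"]) auto
  next
    assume "\<exists>s \<in> mod_hom R A E. \<forall>a\<in>carrier A. p (s a) = a"
    then obtain s where s: "s \<in> mod_hom R A E" and ps: "\<And>a. a \<in> carrier A \<Longrightarrow> p (s a) = a" by auto
    note ic = hom_closed[OF se(2)] and sc = hom_closed[OF s] and pc = hom_closed[OF se(3)]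
    define \<psi> where "\<psi> = (\<lambda>x. i (fst x) \<oplus>\<^bsub>E\<^esub> s (snd x))"
    have \<psi>h: "\<psi> \<in> mod_hom R (dsum2 B A) E"
      by (rule mod_homI)
        (auto simp: \<psi>_def ic sc hom_add[OF se(2)] hom_add[OF s] hom_smult[OF se(2)] hom_smult[OF s]
          E.smult_r_distr E.M.a_ac E.smult_closed)
    have p\<psi>: "p (\<psi> x) = snd x" if "x \<in> carrier (dsum2 B A)" for x
      using that by (auto simp: \<psi>_def hom_add[OF se(3)] ic sc pi ps)
    have "inj_on \<psi> (carrier (dsum2 B A))"
    proof (rule inj_onI)
      fix x y assume x: "x \<in> carrier (dsum2 B A)" and y: "y \<in> carrier (dsum2 B A)" and "\<psi> x = \<psi> y"
      then have 2: "snd x = snd y" using p\<psi> by metis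
      have c: "fst x \<in> carrier B" "fst y \<in> carrier B" "snd y \<in> carrier A" using x y by auto
      have "i (fst x) = i (fst y)"
        using \<open>\<psi> x = \<psi> y\<close> c ic sc unfolding \<psi>_def 2 by (simp add: E.M.add.right_cancel)
      then have "fst x = fst y" by (rule inj_onD[OF se(1) _ c(1,2)])
      then show "x = y" using 2 by (simp add: prod_eq_iff)
    qed
    moreover have "\<psi> ` carrier (dsum2 B A) = carrier E"
    proof
      show "\<psi> ` carrier (dsum2 B A) \<subseteq> carrier E" using hom_closed[OF \<psi>h] by auto
      show "carrier E \<subseteq> \<psi> ` carrier (dsum2 B A)"
      proof
        fix e assume e: "e \<in> carrier E"
        note spe = sc[OF pc[OF e]]
        have "e \<ominus>\<^bsub>E\<^esub> s (p e) \<in> mod_ker E A p"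
          using e spe ps pc hom_diff[OF E Am se(3)]
          by (simp add: mod_ker_def a_minus_def A.M.r_neg)
        then obtain b where b: "b \<in> carrier B" "e \<ominus>\<^bsub>E\<^esub> s (p e) = i b" using se(5) by auto
        have "\<psi> (b, p e) = e"
          using e spe by (simp add: \<psi>_def b(2)[symmetric] a_minus_def E.M.a_assoc E.M.l_neg)
        then show "e \<in> \<psi> ` carrier (dsum2 B A)"
          using b(1) pc[OF e] by (intro image_eqI[of _ _ "(b, p e)"]) auto
      qed
    qed
    ultimately have "\<psi> \<in> mod_iso R (dsum2 B A) E" using \<psi>h by (simp add: mod_iso_def bij_betw_def)
    then obtain \<phi> where \<phi>: "\<phi> \<in> mod_iso R E (dsum2 B A)"
      and \<phi>\<psi>: "\<And>x. x \<in> carrier (dsum2 B A) \<Longrightarrow> \<phi> (\<psi> x) = x"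
      and \<psi>\<phi>: "\<And>y. y \<in> carrier E \<Longrightarrow> \<psi> (\<phi> y) = y"
      by (rule mod_iso_inverse[OF D]) blast
    have \<phi>h: "\<phi> \<in> mod_hom R E (dsum2 B A)" using \<phi> by (simp add: mod_iso_def)
    note \<phi>c = hom_closed[OF \<phi>h]
    have "\<phi> (i b) = (b, \<zero>\<^bsub>A\<^esub>)" if b: "b \<in> carrier B" for b
    proof -
      have "\<psi> (b, \<zero>\<^bsub>A\<^esub>) = i b" using b ic by (simp add: \<psi>_def hom_zero[OF Am E s])
      then show ?thesis using \<phi>\<psi>[of "(b, \<zero>\<^bsub>A\<^esub>)"] b by simp
    qed
    moreover have "snd (\<phi> e) = p e" if "e \<in> carrier E" for e
      using p\<psi>[OF \<phi>c[OF that]] \<psi>\<phi>[OF that] by simp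
    ultimately show "(E, i, p) \<in> Ext1_zero R A B"
      unfolding Ext1_zero_def ext_equiv_def using x \<phi> by auto
  qed
qed

text \<open>
  The split extension itself has elements of a product type; a copy of it lies in the universe.
  Without it the quotient defining Ext could be empty rather than a singleton.
\<close>

lemma Ext1_zero_nonempty:
  assumes small: "small TYPE('u) (carrier (dsum2 B A))"
  shows "Ext1_zero R A B \<noteq> {}"
proof -
  interpret A: right_module R A by (rule Am)
  interpret B: right_module R B by (rule Bm)
  have D: "right_module R (dsum2 B A)" by (rule right_module_dsum2[OF Bm Am])
  obtain E :: "('r, 'u) module" and f g where E: "E \<in> Mods R" and f: "f \<in> mod_iso R (dsum2 B A) E"
    and g: "g \<in> mod_iso R E (dsum2 B A)" and gf: "\<And>x. x \<in> carrier (dsum2 B A) \<Longrightarrow> g (f x) = x"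
    and fg: "\<And>y. y \<in> carrier E \<Longrightarrow> f (g y) = y"
    by (rule transport_to_Mods[OF D small]) blast
  have fh: "f \<in> mod_hom R (dsum2 B A) E" and gh: "g \<in> mod_hom R E (dsum2 B A)"
    using f g by (auto simp: mod_iso_def)
  let ?i = "\<lambda>b. f (b, \<zero>\<^bsub>A\<^esub>)" and ?p = "\<lambda>e. snd (g e)"
  have "(\<lambda>b. (b, \<zero>\<^bsub>A\<^esub>)) \<in> mod_hom R B (dsum2 B A)"
    by (rule mod_homI) (auto simp: A.smult_zero)
  then have i: "?i \<in> mod_hom R B E" using fh by (rule hom_comp)
  have "snd \<in> mod_hom R (dsum2 B A) A" by (rule mod_homI) auto
  then have p: "?p \<in> mod_hom R E A" by (rule hom_comp[OF gh])
  have "inj_on ?i (carrier B)"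
  proof (rule inj_onI)
    fix b c assume bc: "b \<in> carrier B" "c \<in> carrier B" "?i b = ?i c"
    have "(b, \<zero>\<^bsub>A\<^esub>) = g (?i b)" using bc(1) by (subst gf) auto
    also have "\<dots> = g (?i c)" by (simp only: bc(3))
    also have "\<dots> = (c, \<zero>\<^bsub>A\<^esub>)" using bc(2) by (subst gf) auto
    finally show "b = c" by simp
  qed
  moreover have "?p ` carrier E = carrier A"
  proof
    show "?p ` carrier E \<subseteq> carrier A" using hom_closed[OF p] by auto
    show "carrier A \<subseteq> ?p ` carrier E"
    proof
      fix a assume a: "a \<in> carrier A"
      show "a \<in> ?p ` carrier E"
        using gf[of "(\<zero>\<^bsub>B\<^esub>, a)"] a hom_closed[OF fh, of "(\<zero>\<^bsub>B\<^esub>, a)"]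
        by (intro image_eqI[of _ _ "f (\<zero>\<^bsub>B\<^esub>, a)"]) auto
    qed
  qed
  moreover have "?i ` carrier B = mod_ker E A ?p"
  proof
    show "?i ` carrier B \<subseteq> mod_ker E A ?p"
      using hom_closed[OF i] gf by (auto simp: mod_ker_def)
    show "mod_ker E A ?p \<subseteq> ?i ` carrier B"
    proof
      fix e assume "e \<in> mod_ker E A ?p"
      then have e: "e \<in> carrier E" "snd (g e) = \<zero>\<^bsub>A\<^esub>" by (auto simp: mod_ker_def)
      have "f (fst (g e), \<zero>\<^bsub>A\<^esub>) = e" using fg[OF e(1)] e(2) by (metis prod.collapse)
      moreover have "fst (g e) \<in> carrier B" using hom_closed[OF gh e(1)] by auto
      ultimately show "e \<in> ?i ` carrier B" by (intro image_eqI[of _ _ "fst (g e)"]) auto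
    qed
  qed
  ultimately have "(E, ?i, ?p) \<in> extensions R A B"
    using E i p by (simp add: extensions_def short_exact_def right_exact_def mod_epi_def)
  moreover have "ext_equiv R A B (E, ?i, ?p) (dsum2 B A, (\<lambda>b. (b, \<zero>\<^bsub>A\<^esub>)), snd)"
    unfolding ext_equiv_def using g gf by (auto intro!: bexI[of _ g])
  ultimately show ?thesis unfolding Ext1_zero_def by auto
qed

text \<open>
  All split extensions are equivalent to each other and some exist, so they fill exactly one class of
  the quotient. Hence there is only this class if and only if every extension splits.
\<close>

lemma Ext1_vanishes_iff_split:
  assumes small: "small TYPE('u) (carrier (dsum2 B A))"
  shows "Ext1_vanishes R A B \<longleftrightarrow>
    (\<forall>E i p. (E, i, p) \<in> extensions R A B \<longrightarrow>
       (\<exists>s \<in> mod_hom R A E. \<forall>a\<in>carrier A. p (s a) = a))"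
proof -
  define X where "X = extensions R A B"
  define Z where "Z = Ext1_zero R A B"
  define r where "r = {(x, y). x \<in> X \<and> y \<in> X \<and> ext_equiv R A B x y}"
  have ZX: "Z \<subseteq> X" "Z \<noteq> {}"
    using Ext1_zero_nonempty[OF small] by (auto simp: Z_def X_def Ext1_zero_def)
  have refl: "(x, x) \<in> r" if "x \<in> X" for x
    using that mod_iso_id by (cases x) (auto simp: r_def ext_equiv_def intro!: bexI[of _ "\<lambda>x. x"])
  have zz: "(x, y) \<in> r" if xz: "x \<in> Z" and yz: "y \<in> Z" for x y
  proof -
    obtain E i p where x: "x = (E, i, p)" by (cases x)
    obtain F j q where y: "y = (F, j, q)" by (cases y)
    have F: "right_module R F" and E: "right_module R E"
      using xz yz ZX(1) by (auto simp: x y X_def extensions_def Mods_def)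
    have "(F, j, q) \<in> X" using yz ZX(1) y by auto
    then have "short_exact R B j F q A" by (simp add: X_def extensions_def)
    note jc = hom_closed[OF short_exactD(2)[OF this]]
    obtain \<phi> where \<phi>: "\<phi> \<in> mod_iso R E (dsum2 B A)"
      "\<And>b. b \<in> carrier B \<Longrightarrow> \<phi> (i b) = (b, \<zero>\<^bsub>A\<^esub>)" "\<And>e. e \<in> carrier E \<Longrightarrow> snd (\<phi> e) = p e"
      using xz by (auto simp: x Z_def Ext1_zero_def ext_equiv_def)
    obtain \<phi>' where \<phi>': "\<phi>' \<in> mod_iso R F (dsum2 B A)"
      "\<And>b. b \<in> carrier B \<Longrightarrow> \<phi>' (j b) = (b, \<zero>\<^bsub>A\<^esub>)" "\<And>e. e \<in> carrier F \<Longrightarrow> snd (\<phi>' e) = q e"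
      using yz by (auto simp: y Z_def Ext1_zero_def ext_equiv_def)
    obtain \<psi> where \<psi>: "\<psi> \<in> mod_iso R (dsum2 B A) F" "\<And>x. x \<in> carrier F \<Longrightarrow> \<psi> (\<phi>' x) = x"
      "\<And>y. y \<in> carrier (dsum2 B A) \<Longrightarrow> \<phi>' (\<psi> y) = y"
      by (rule mod_iso_inverse[OF F \<phi>'(1)]) blast
    have "(\<lambda>e. \<psi> (\<phi> e)) \<in> mod_iso R E F" by (rule mod_iso_comp[OF \<phi>(1) \<psi>(1)])
    moreover have "\<psi> (\<phi> (i b)) = j b" if b: "b \<in> carrier B" for b
      using \<psi>(2)[OF jc[OF b]] \<phi>(2)[OF b] \<phi>'(2)[OF b] by simp
    moreover have "q (\<psi> (\<phi> e)) = p e" if e: "e \<in> carrier E" for e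
    proof -
      have \<phi>e: "\<phi> e \<in> carrier (dsum2 B A)"
        using \<phi>(1) hom_closed[of \<phi> R E "dsum2 B A"] e by (simp add: mod_iso_def)
      have "\<psi> (\<phi> e) \<in> carrier F"
        using \<psi>(1) hom_closed[of \<psi> R "dsum2 B A" F, OF _ \<phi>e] by (simp add: mod_iso_def)
      then show ?thesis using \<phi>'(3) \<psi>(3)[OF \<phi>e] \<phi>(3)[OF e] by metis
    qed
    ultimately have "ext_equiv R A B x y"
      unfolding ext_equiv_def x y prod.case by (intro bexI[of _ "\<lambda>e. \<psi> (\<phi> e)"]) auto
    then show ?thesis using xz yz ZX(1) by (auto simp: r_def)
  qed
  have "X // r = {Z} \<longleftrightarrow> X \<subseteq> Z"
  proof
    assume q: "X // r = {Z}"
    show "X \<subseteq> Z"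
    proof
      fix x assume x: "x \<in> X"
      then have "r `` {x} \<in> X // r" by (rule quotientI)
      then have "r `` {x} = Z" using q by simp
      then show "x \<in> Z" using refl[OF x] by auto
    qed
  next
    assume "X \<subseteq> Z"
    then have XZ: "X = Z" using ZX by blast
    have "r `` {x} = Z" if x: "x \<in> X" for x
    proof
      show "r `` {x} \<subseteq> Z" using XZ by (auto simp: r_def)
      show "Z \<subseteq> r `` {x}" using zz[of x] x XZ by auto
    qed
    then show "X // r = {Z}" using ZX XZ by (auto simp: quotient_def)
  qed
  moreover have "Ext1_vanishes R A B \<longleftrightarrow> X // r = {Z}"
    by (simp add: Ext1_vanishes_def Ext1_def X_def Z_def r_def)
  ultimately have "Ext1_vanishes R A B \<longleftrightarrow> (\<forall>E i p. (E, i, p) \<in> X \<longrightarrow> (E, i, p) \<in> Z)"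
    by (simp add: subset_iff)
  then show ?thesis
    unfolding X_def Z_def using split_extension_iff_section by (simp cong: imp_cong)
qed

text \<open>
  Pulling an extension of \<open>C\<close> back along \<open>u : A \<rightarrow> C\<close> gives an extension of \<open>A\<close>, and a section of
  the pullback is a lift of \<open>u\<close>.
\<close>

lemma Ext1_vanishes_lift:
  fixes E :: "('r, 'u) module"
  assumes ext: "Ext1_vanishes R A B" and E: "E \<in> Mods R" and C: "right_module R C"
    and se: "short_exact R B i E p C" and u: "u \<in> mod_hom R A C"
    and small: "small TYPE('u) (carrier (dsum2 B A))" "small TYPE('u) (carrier (dsum2 A E))"
  shows "\<exists>v \<in> mod_hom R A E. \<forall>a\<in>carrier A. p (v a) = u a"
proof -
  interpret A: right_module R A by (rule Am)
  interpret B: right_module R B by (rule Bm)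
  have Em: "right_module R E" using E by (rule Mods_right_module)
  interpret E: right_module R E by (rule Em)
  interpret C: right_module R C by fact
  note se = short_exactD[OF se]
  define S where "S = {x \<in> carrier A \<times> carrier E. u (fst x) = p (snd x)}"
  have D: "right_module R (dsum2 A E)" by (rule right_module_dsum2[OF Am Em])
  interpret D: right_module R "dsum2 A E" by (rule D)
  have neg: "\<ominus>\<^bsub>dsum2 A E\<^esub> x = (\<ominus>\<^bsub>A\<^esub> fst x, \<ominus>\<^bsub>E\<^esub> snd x)" if "x \<in> carrier A \<times> carrier E" for x
    using that by (intro D.M.minus_equality) (auto simp: A.M.l_neg E.M.l_neg)
  have Q0: "right_module R (submod (dsum2 A E) S)"
    by (rule right_module_submod[OF D])
      (auto simp: S_def neg hom_zero[OF Am C u] hom_zero[OF Em C se(3)] hom_add[OF u]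
        hom_add[OF se(3)] hom_uminus[OF Am C u] hom_uminus[OF Em C se(3)] hom_smult[OF u]
        hom_smult[OF se(3)] A.smult_closed E.smult_closed)
  let ?Q = "submod (dsum2 A E) S"
  have "small TYPE('u) (carrier ?Q)" by (rule small_subset[OF small(2)]) (auto simp: S_def)
  from transport_to_Mods[OF Q0 this] obtain Q :: "('r, 'u) module" and f g where
    Q: "Q \<in> Mods R" and f: "f \<in> mod_iso R ?Q Q" and g: "g \<in> mod_iso R Q ?Q"
    and gf: "\<And>x. x \<in> carrier ?Q \<Longrightarrow> g (f x) = x" and fg: "\<And>x. x \<in> carrier Q \<Longrightarrow> f (g x) = x"
    by blast
  have fh: "f \<in> mod_hom R ?Q Q" and gh: "g \<in> mod_hom R Q ?Q"
    using f g by (auto simp: mod_iso_def)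
  have pi: "p (i b) = \<zero>\<^bsub>C\<^esub>" if "b \<in> carrier B" for b
    using se(5) that by (auto simp: mod_ker_def)
  let ?i = "\<lambda>b. f (\<zero>\<^bsub>A\<^esub>, i b)" and ?p = "\<lambda>x. fst (g x)"
  have inS: "(\<zero>\<^bsub>A\<^esub>, i b) \<in> S" if "b \<in> carrier B" for b
    using that hom_closed[OF se(2)] pi by (auto simp: S_def hom_zero[OF Am C u])
  have "(\<lambda>b. (\<zero>\<^bsub>A\<^esub>, i b)) \<in> mod_hom R B ?Q"
    by (rule mod_homI) (auto simp: inS A.smult_zero hom_add[OF se(2)] hom_smult[OF se(2)])
  then have i: "?i \<in> mod_hom R B Q" using fh by (rule hom_comp)
  have "fst \<in> mod_hom R ?Q A" by (rule mod_homI) (auto simp: S_def)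
  then have p: "?p \<in> mod_hom R Q A" by (rule hom_comp[OF gh])
  have "inj_on ?i (carrier B)"
  proof (rule inj_onI)
    fix b c assume bc: "b \<in> carrier B" "c \<in> carrier B" "?i b = ?i c"
    have "(\<zero>\<^bsub>A\<^esub>, i b) = g (?i b)" using inS[OF bc(1)] by (subst gf) auto
    also have "\<dots> = g (?i c)" by (simp only: bc(3))
    also have "\<dots> = (\<zero>\<^bsub>A\<^esub>, i c)" using inS[OF bc(2)] by (subst gf) auto
    finally have "i b = i c" by simp
    then show "b = c" by (rule inj_onD[OF se(1) _ bc(1,2)])
  qed
  moreover have "?p ` carrier Q = carrier A"
  proof
    show "?p ` carrier Q \<subseteq> carrier A" using hom_closed[OF p] by auto
    show "carrier A \<subseteq> ?p ` carrier Q"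
    proof
      fix a assume a: "a \<in> carrier A"
      have "u a \<in> p ` carrier E" using hom_closed[OF u a] se(4) by simp
      then obtain e where e: "e \<in> carrier E" "u a = p e" by auto
      then have "(a, e) \<in> S" using a by (auto simp: S_def)
      then show "a \<in> ?p ` carrier Q"
        using gf[of "(a, e)"] hom_closed[OF fh, of "(a, e)"]
        by (intro image_eqI[of _ _ "f (a, e)"]) auto
    qed
  qed
  moreover have "?i ` carrier B = mod_ker Q A ?p"
  proof
    show "?i ` carrier B \<subseteq> mod_ker Q A ?p"
      using hom_closed[OF i] gf inS by (auto simp: mod_ker_def)
    show "mod_ker Q A ?p \<subseteq> ?i ` carrier B"
    proof
      fix x assume "x \<in> mod_ker Q A ?p"
      then have x: "x \<in> carrier Q" "fst (g x) = \<zero>\<^bsub>A\<^esub>" by (auto simp: mod_ker_def)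
      have gS: "g x \<in> S" using hom_closed[OF gh x(1)] by simp
      then have "snd (g x) \<in> mod_ker E C p"
        using x(2) hom_zero[OF Am C u] by (auto simp: S_def mod_ker_def)
      then obtain b where b: "b \<in> carrier B" "snd (g x) = i b" using se(5) by auto
      have "f (\<zero>\<^bsub>A\<^esub>, i b) = x" using fg[OF x(1)] b(2) x(2) by (metis prod.collapse)
      then show "x \<in> ?i ` carrier B" using b(1) by (intro image_eqI[of _ _ b]) auto
    qed
  qed
  ultimately have "(Q, ?i, ?p) \<in> extensions R A B"
    using Q i p by (simp add: extensions_def short_exact_def right_exact_def mod_epi_def)
  from ext[unfolded Ext1_vanishes_iff_split[OF small(1)], THEN spec, THEN spec, THEN spec,
      THEN mp, OF this]
  obtain s where s: "s \<in> mod_hom R A Q" and ps: "\<And>a. a \<in> carrier A \<Longrightarrow> ?p (s a) = a"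
    by auto
  have gS: "g (s a) \<in> S" if "a \<in> carrier A" for a
    using hom_closed[OF gh hom_closed[OF s that]] by simp
  show ?thesis
  proof (intro bexI ballI)
    have "snd \<in> mod_hom R ?Q E" by (rule mod_homI) (auto simp: S_def)
    then show "(\<lambda>a. snd (g (s a))) \<in> mod_hom R A E"
      by (rule hom_comp[OF hom_comp[OF s gh]])
    show "p (snd (g (s a))) = u a" if "a \<in> carrier A" for a
      using gS[OF that] ps[OF that] by (simp add: S_def)
  qed
qed

end

section \<open>Relative projectivity and the class Add\<close>

text \<open>
  The maps \<open>p\<close> through which every homomorphism from \<open>T\<close> lifts are the \<open>T\<close>-epimorphisms, and \<open>M\<close> is
  required to be projective with respect to them. This condition is visibly inherited by coproducts
  and retracts of \<open>M\<close>. It turns out to describe \<open>Add T\<close>, which reduces the closure properties of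
  \<open>Add T\<close> to lifting maps and avoids iterated direct sums.
\<close>

definition relatively_projective ::
    "('r, 'k) ring_scheme \<Rightarrow> ('r, 'u) module \<Rightarrow> ('r, 'u) module \<Rightarrow> bool" where
  "relatively_projective R T M \<longleftrightarrow>
     (\<forall>X \<in> (Mods R :: ('r, 'u) module set). \<forall>Y \<in> (Mods R :: ('r, 'u) module set).
        \<forall>p \<in> mod_hom R X Y.
        (\<forall>g \<in> mod_hom R T Y. \<exists>h \<in> mod_hom R T X. \<forall>t\<in>carrier T. p (h t) = g t) \<longrightarrow>
        (\<forall>u \<in> mod_hom R M Y. \<exists>v \<in> mod_hom R M X. \<forall>m\<in>carrier M. p (v m) = u m))"

lemma relatively_projectiveI:
  fixes T M :: "('r, 'u) module"
  assumes "\<And>(X :: ('r, 'u) module) (Y :: ('r, 'u) module) p u.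
    \<lbrakk>X \<in> Mods R; Y \<in> Mods R; p \<in> mod_hom R X Y;
     \<And>g. g \<in> mod_hom R T Y \<Longrightarrow> \<exists>h \<in> mod_hom R T X. \<forall>t\<in>carrier T. p (h t) = g t;
     u \<in> mod_hom R M Y\<rbrakk> \<Longrightarrow> \<exists>v \<in> mod_hom R M X. \<forall>m\<in>carrier M. p (v m) = u m"
  shows "relatively_projective R T M"
  using assms unfolding relatively_projective_def by simp

lemma relatively_projectiveD:
  fixes T M X Y :: "('r, 'u) module"
  assumes "relatively_projective R T M" "X \<in> Mods R" "Y \<in> Mods R" "p \<in> mod_hom R X Y"
    "\<And>g. g \<in> mod_hom R T Y \<Longrightarrow> \<exists>h \<in> mod_hom R T X. \<forall>t\<in>carrier T. p (h t) = g t"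
    "u \<in> mod_hom R M Y"
  shows "\<exists>v \<in> mod_hom R M X. \<forall>m\<in>carrier M. p (v m) = u m"
  using assms unfolding relatively_projective_def by simp

lemma relatively_projective_self: "relatively_projective R T T"
  by (rule relatively_projectiveI) simp

lemma relatively_projective_retract:
  fixes T M N :: "('r, 'u) module"
  assumes M: "relatively_projective R T M" and N: "retract R N M"
  shows "relatively_projective R T N"
proof (rule relatively_projectiveI)
  fix X Y :: "('r, 'u) module" and p u
  assume XY: "X \<in> Mods R" "Y \<in> Mods R" "p \<in> mod_hom R X Y"
    and lift: "\<And>g. g \<in> mod_hom R T Y \<Longrightarrow> \<exists>h \<in> mod_hom R T X. \<forall>t\<in>carrier T. p (h t) = g t"
    and u: "u \<in> mod_hom R N Y"
  obtain i r where ir: "i \<in> mod_hom R N M" "r \<in> mod_hom R M N"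
    "\<And>x. x \<in> carrier N \<Longrightarrow> r (i x) = x"
    by (rule retractE[OF N]) blast
  obtain v where v: "v \<in> mod_hom R M X" "\<forall>m\<in>carrier M. p (v m) = u (r m)"
    using relatively_projectiveD[OF M XY lift hom_comp[OF ir(2) u]] ..
  show "\<exists>v \<in> mod_hom R N X. \<forall>m\<in>carrier N. p (v m) = u m"
  proof (intro bexI ballI)
    show "(\<lambda>n. v (i n)) \<in> mod_hom R N X" by (rule hom_comp[OF ir(1) v(1)])
    show "p (v (i n)) = u n" if "n \<in> carrier N" for n
      using that v(2) ir(3) hom_closed[OF ir(1)] by simp
  qed
qed

lemma relatively_projective_coproduct:
  fixes T S :: "('r, 'u) module"
  assumes S: "coproduct R I M S j" and M: "\<And>i. i \<in> I \<Longrightarrow> relatively_projective R T (M i)"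
  shows "relatively_projective R T S"
proof (rule relatively_projectiveI)
  fix X Y :: "('r, 'u) module" and p u
  assume XY: "X \<in> Mods R" "Y \<in> Mods R" "p \<in> mod_hom R X Y"
    and lift: "\<And>g. g \<in> mod_hom R T Y \<Longrightarrow> \<exists>h \<in> mod_hom R T X. \<forall>t\<in>carrier T. p (h t) = g t"
    and u: "u \<in> mod_hom R S Y"
  have "\<exists>v. v \<in> mod_hom R (M i) X \<and> (\<forall>m\<in>carrier (M i). p (v m) = u (j i m))" if i: "i \<in> I" for i
    using relatively_projectiveD[OF M[OF i] XY lift hom_comp[OF coproduct_inj[OF S i] u]]
    unfolding Bex_def .
  then have "\<exists>v. \<forall>i\<in>I. v i \<in> mod_hom R (M i) X \<and> (\<forall>m\<in>carrier (M i). p (v i m) = u (j i m))"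
    by (intro bchoice ballI)
  then obtain v where v: "\<And>i. i \<in> I \<Longrightarrow> v i \<in> mod_hom R (M i) X"
    "\<And>i m. i \<in> I \<Longrightarrow> m \<in> carrier (M i) \<Longrightarrow> p (v i m) = u (j i m)" by auto
  obtain k where k: "k \<in> mod_hom R S X" "\<forall>i\<in>I. \<forall>x\<in>carrier (M i). k (j i x) = v i x"
    using coproduct_copair[OF S XY(1) v(1)] ..
  have "p (k s) = u s" if "s \<in> carrier S" for s
    by (rule coproduct_hom_eq[OF S Mods_right_module[OF XY(2)] hom_comp[OF k(1) XY(3)] u _ that])
      (simp add: k(2) v(2))
  then show "\<exists>v \<in> mod_hom R S X. \<forall>s\<in>carrier S. p (v s) = u s" using k(1) by (intro bexI[of _ k]) auto
qed

lemma Add_Mods: "M \<in> Add R T \<Longrightarrow> M \<in> Mods R"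
  by (simp add: Add_def)

lemma right_approxD:
  assumes "right_approx R \<X> X f A"
  shows "X \<in> \<X>" "f \<in> mod_hom R X A"
    "\<And>X' g. X' \<in> \<X> \<Longrightarrow> g \<in> mod_hom R X' A \<Longrightarrow>
      \<exists>h \<in> mod_hom R X' X. \<forall>x \<in> carrier X'. g x = f (h x)"
  using assms by (auto simp: right_approx_def)

context module_universe
begin

lemma small_dsum2:
  fixes A B :: "('r, 'u) module"
  assumes "A \<in> Mods R" "B \<in> Mods R"
  shows "small TYPE('u) (carrier (dsum2 A B))"
  using small_Times[OF Mods_small[OF assms(1)] Mods_small[OF assms(2)]] by simp

lemma submod_in_Mods:
  fixes M :: "('r, 'u) module"
  assumes "M \<in> Mods R" "right_module R N" "f \<in> mod_hom R M N"
  shows "submod M (mod_ker M N f) \<in> Mods R"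
  using right_module_ker[OF Mods_right_module[OF assms(1)] assms(2,3)]
    small_subset[OF Mods_small[OF assms(1)], of "mod_ker M N f"]
  by (auto simp: Mods_def mod_ker_def)

lemma Add_iff_retract_dsum:
  fixes M T :: "('r, 'u) module"
  assumes T: "T \<in> Mods R"
  shows "M \<in> Add R T \<longleftrightarrow>
    M \<in> Mods R \<and> (\<exists>I :: 'u set. small TYPE('u) I \<and> retract R M (dsum I (\<lambda>_. T)))"
proof -
  have "is_summand R M (dsum I (\<lambda>_. T)) \<longleftrightarrow> retract R M (dsum I (\<lambda>_. T))"
    if "M \<in> Mods R" "small TYPE('u) I" for I :: "'u set"
    by (rule is_summand_iff_retract[OF Mods_right_module[OF that(1)]
        right_module_dsum[OF ring Mods_right_module[OF T]] small_dsum[OF that(2) Mods_small[OF T]]])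
  then show ?thesis by (auto simp: Add_def)
qed

lemma Add_retract:
  fixes M N T :: "('r, 'u) module"
  assumes "T \<in> Mods R" "M \<in> Add R T" "N \<in> Mods R" "retract R N M"
  shows "N \<in> Add R T"
  using assms(2,3) retract_trans[OF assms(4)] by (auto simp: Add_iff_retract_dsum[OF assms(1)])

lemma small_coproduct:
  fixes T :: "('r, 'u) module" and I :: "'u set"
  assumes T: "T \<in> Mods R" and I: "small TYPE('u) I"
  obtains S j where "coproduct R I (\<lambda>_. T) S j" "retract R S (dsum I (\<lambda>_. T))"
    "retract R (dsum I (\<lambda>_. T)) S"
proof -
  obtain S j f where S: "coproduct R I (\<lambda>_. T) S j" and f: "f \<in> mod_iso R (dsum I (\<lambda>_. T)) S"
    using coproduct_exists[of I "\<lambda>_. T", OF I T] by auto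
  note r = mod_iso_retract[OF right_module_dsum[OF ring Mods_right_module[OF T]] f]
  show ?thesis by (rule that[OF S r(2,1)])
qed

lemma Add_retract_coproduct:
  fixes M T :: "('r, 'u) module"
  assumes T: "T \<in> Mods R" and M: "M \<in> Add R T"
  obtains I :: "'u set" and S j where "coproduct R I (\<lambda>_. T) S j" "retract R M S"
proof -
  obtain I :: "'u set" where I: "small TYPE('u) I" "retract R M (dsum I (\<lambda>_. T))"
    using M by (auto simp: Add_iff_retract_dsum[OF T])
  obtain S j where S: "coproduct R I (\<lambda>_. T) S j" "retract R (dsum I (\<lambda>_. T)) S"
    by (rule small_coproduct[OF T I(1)])
  show ?thesis by (rule that[OF S(1) retract_trans[OF I(2) S(2)]])
qed

lemma Add_relatively_projective:
  fixes M T :: "('r, 'u) module"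
  assumes T: "T \<in> Mods R" and M: "M \<in> Add R T"
  shows "relatively_projective R T M"
proof -
  obtain I :: "'u set" and S j where S: "coproduct R I (\<lambda>_. T) S j" "retract R M S"
    by (rule Add_retract_coproduct[OF T M])
  show ?thesis
    by (rule relatively_projective_retract[OF relatively_projective_coproduct[OF S(1)] S(2)])
      (rule relatively_projective_self)
qed

text \<open>
  The evaluation map from the direct sum of copies of \<open>T\<close> indexed by \<open>Hom(T, A)\<close>. As a set of total
  functions \<open>Hom(T, A)\<close> is not small, because homomorphisms are arbitrary outside the carrier; so the
  index set consists of their restrictions, recoded as elements of the universe.
\<close>

lemma Add_cover:
  fixes A T :: "('r, 'u) module"
  assumes T: "T \<in> Mods R" and A: "A \<in> Mods R"
  shows "\<exists>S \<in> Add R T. \<exists>p \<in> mod_hom R S A.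
    \<forall>g \<in> mod_hom R T A. \<exists>h \<in> mod_hom R T S. \<forall>t\<in>carrier T. p (h t) = g t"
proof -
  define H where "H = (\<lambda>g. restrict g (carrier T)) ` mod_hom R T A"
  have "H \<subseteq> (\<Pi>\<^sub>E t\<in>carrier T. carrier A)" using hom_closed by (auto simp: H_def)
  then have smH: "small TYPE('u) H"
    by (rule small_subset[OF small_PiE[OF Mods_small[OF T] Mods_small[OF A]]])
  obtain c :: "('u \<Rightarrow> 'u) \<Rightarrow> 'u" where c: "inj_on c H" by (rule small_embedding[OF smH])
  define I where "I = c ` H"
  have I: "small TYPE('u) I" unfolding I_def by (rule small_image[OF smH])
  define d where "d = inv_into H c"
  have d: "d (c h) = h" if "h \<in> H" for h using c that by (simp add: d_def)
  have Hh: "h \<in> mod_hom R T A" if "h \<in> H" for h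
  proof -
    obtain g where g: "g \<in> mod_hom R T A" "h = restrict g (carrier T)"
      using \<open>h \<in> H\<close> by (auto simp: H_def)
    show ?thesis by (rule hom_cong[OF g(1) Mods_right_module[OF T]]) (simp add: g(2))
  qed
  have dI: "d i \<in> mod_hom R T A" if "i \<in> I" for i
    using that d Hh by (auto simp: I_def)
  obtain S j where S: "coproduct R I (\<lambda>_. T) S j" and r: "retract R S (dsum I (\<lambda>_. T))"
    by (rule small_coproduct[OF T I])
  obtain p where p: "p \<in> mod_hom R S A" "\<forall>i\<in>I. \<forall>x\<in>carrier T. p (j i x) = d i x"
    using coproduct_copair[OF S A dI] ..
  have "S \<in> Add R T"
    using coproduct_Mods[OF S] I r by (auto simp: Add_iff_retract_dsum[OF T])
  moreover have "\<exists>h \<in> mod_hom R T S. \<forall>t\<in>carrier T. p (h t) = u t"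
    if u: "u \<in> mod_hom R T A" for u
  proof -
    have uH: "restrict u (carrier T) \<in> H" using u by (simp add: H_def)
    then have i: "c (restrict u (carrier T)) \<in> I" by (simp add: I_def)
    show ?thesis
      using coproduct_inj[OF S i] bspec[OF p(2) i] d[OF uH]
      by (intro bexI[of _ "j (c (restrict u (carrier T)))"]) auto
  qed
  ultimately show ?thesis by (intro bexI[of _ S] bexI[OF _ p(1)] ballI)
qed

text \<open>
  If \<open>M\<close> is relatively projective, the identity of \<open>M\<close> lifts through the evaluation map to \<open>M\<close>, a
  \<open>T\<close>-epimorphism, so that \<open>M\<close> is a retract of a sum of copies of \<open>T\<close>.
\<close>

lemma Add_iff_relatively_projective:
  fixes M T :: "('r, 'u) module"
  assumes T: "T \<in> Mods R"
  shows "M \<in> Add R T \<longleftrightarrow> M \<in> Mods R \<and> relatively_projective R T M"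
proof
  assume "M \<in> Add R T"
  then show "M \<in> Mods R \<and> relatively_projective R T M"
    using Add_relatively_projective[OF T] Add_Mods by auto
next
  assume M: "M \<in> Mods R \<and> relatively_projective R T M"
  obtain S p where S: "S \<in> Add R T" and p: "p \<in> mod_hom R S M"
    and lift: "\<forall>g \<in> mod_hom R T M. \<exists>h \<in> mod_hom R T S. \<forall>t\<in>carrier T. p (h t) = g t"
    using Add_cover[OF T conjunct1[OF M]] by auto
  obtain v where v: "v \<in> mod_hom R M S" "\<forall>m\<in>carrier M. p (v m) = m"
    using relatively_projectiveD[OF conjunct2[OF M] Add_Mods[OF S] conjunct1[OF M] p
        bspec[OF lift] hom_id] ..
  have "retract R M S" by (rule retractI[OF v(1) p]) (simp add: v(2))
  then show "M \<in> Add R T" using Add_retract[OF T S] M by simp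
qed

lemma Add_self: "(T :: ('r, 'u) module) \<in> Mods R \<Longrightarrow> T \<in> Add R T"
  by (simp add: Add_iff_relatively_projective relatively_projective_self)

lemma Add_coproduct:
  fixes S T :: "('r, 'u) module"
  assumes "T \<in> Mods R" "coproduct R I M S j" "\<And>i. i \<in> I \<Longrightarrow> M i \<in> Add R T"
  shows "S \<in> Add R T"
  using assms(3) Add_iff_relatively_projective[OF assms(1)] coproduct_Mods[OF assms(2)]
    relatively_projective_coproduct[OF assms(2), of T] by simp

lemma Add_right_approx:
  fixes T A :: "('r, 'u) module"
  assumes T: "T \<in> Mods R" and A: "A \<in> Mods R"
  obtains M p where "right_approx R (Add R T) M p A"
proof -
  obtain S p where S: "S \<in> Add R T" and p: "p \<in> mod_hom R S A"
    and lift: "\<forall>g \<in> mod_hom R T A. \<exists>h \<in> mod_hom R T S. \<forall>t\<in>carrier T. p (h t) = g t"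
    using Add_cover[OF T A] by auto
  have "\<exists>h \<in> mod_hom R N S. \<forall>x \<in> carrier N. g x = p (h x)"
    if N: "N \<in> Add R T" and g: "g \<in> mod_hom R N A" for N g
  proof -
    obtain v where "v \<in> mod_hom R N S" "\<forall>m\<in>carrier N. p (v m) = g m"
      using relatively_projectiveD[OF Add_relatively_projective[OF T N] Add_Mods[OF S] A p
          bspec[OF lift] g] ..
    then show ?thesis by (intro bexI[of _ v]) auto
  qed
  then have "right_approx R (Add R T) S p A" using S p by (simp add: right_approx_def)
  then show ?thesis by (rule that)
qed

section \<open>The class Gen and Ext-projectivity\<close>

lemma Gen_Mods: "X \<in> Gen R T \<Longrightarrow> X \<in> Mods R"
  by (simp add: Gen_def)

lemma Gen_epi:
  assumes "X \<in> Gen R T"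
  obtains M p where "M \<in> Add R T" "p \<in> mod_epi R M X"
  using assms by (auto simp: Gen_def)

lemma Add_subset_Gen: "M \<in> Add R T \<Longrightarrow> M \<in> Gen R T"
proof -
  assume M: "M \<in> Add R T"
  have "(\<lambda>x. x) \<in> mod_epi R M M" by (simp add: mod_epi_def hom_id)
  then show ?thesis using M Add_Mods[OF M] by (auto simp: Gen_def)
qed

lemma mod_epi_comp:
  "f \<in> mod_epi R M N \<Longrightarrow> g \<in> mod_epi R N K \<Longrightarrow> (\<lambda>x. g (f x)) \<in> mod_epi R M K"
  by (auto simp: mod_epi_def hom_comp simp flip: image_image)

lemma Gen_quotient:
  assumes "X \<in> Gen R T" "Y \<in> Mods R" "q \<in> mod_epi R X Y"
  shows "Y \<in> Gen R T"
proof -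
  obtain M p where "M \<in> Add R T" "p \<in> mod_epi R M X" by (rule Gen_epi[OF assms(1)])
  then show ?thesis
    using assms(2) mod_epi_comp[OF _ assms(3), of p M] by (auto simp: Gen_def)
qed

text \<open>
  Any map from \<open>Add T\<close> that hits \<open>x\<close> factors through the approximation, so it is enough to hit the
  elements of \<open>X\<close> one at a time.
\<close>

lemma right_approx_epi:
  fixes X :: "('r, 'u) module"
  assumes app: "right_approx R (Add R T) M p X"
    and gen: "\<And>x. x \<in> carrier X \<Longrightarrow> \<exists>N \<in> Add R T. \<exists>h \<in> mod_hom R N X. x \<in> h ` carrier N"
  shows "p \<in> mod_epi R M X"
proof -
  note p = right_approxD[OF app]
  have "x \<in> p ` carrier M" if x: "x \<in> carrier X" for x
  proof -
    obtain N h n where N: "N \<in> Add R T" "h \<in> mod_hom R N X" "n \<in> carrier N" "x = h n"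
      using gen[OF x] by auto
    obtain v where v: "v \<in> mod_hom R N M" "\<forall>y\<in>carrier N. h y = p (v y)" using p(3)[OF N(1,2)] ..
    show ?thesis using N v(2) hom_closed[OF v(1)] by (intro image_eqI[of _ _ "v n"]) auto
  qed
  then show ?thesis using p(2) hom_closed[OF p(2)] by (auto simp: mod_epi_def)
qed

lemma Gen_right_approx_epi:
  fixes X T :: "('r, 'u) module"
  assumes "X \<in> Gen R T" "right_approx R (Add R T) M p X"
  shows "p \<in> mod_epi R M X"
proof (rule right_approx_epi[OF assms(2)])
  fix x assume x: "x \<in> carrier X"
  obtain N h where N: "N \<in> Add R T" "h \<in> mod_epi R N X" by (rule Gen_epi[OF assms(1)])
  then show "\<exists>N \<in> Add R T. \<exists>h \<in> mod_hom R N X. x \<in> h ` carrier N"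
    using x by (intro bexI[OF _ N(1)] bexI[of _ h]) (auto simp: mod_epi_def)
qed

text \<open>
  Membership in \<open>Gen T\<close> can be tested on single elements: the approximation of \<open>X\<close> collects all the
  maps at once.
\<close>

lemma GenI:
  fixes X T :: "('r, 'u) module"
  assumes T: "T \<in> Mods R" and X: "X \<in> Mods R"
    and gen: "\<And>x. x \<in> carrier X \<Longrightarrow> \<exists>N \<in> Add R T. \<exists>h \<in> mod_hom R N X. x \<in> h ` carrier N"
  shows "X \<in> Gen R T"
proof -
  obtain M p where app: "right_approx R (Add R T) M p X" by (rule Add_right_approx[OF T X])
  have "p \<in> mod_epi R M X" by (rule right_approx_epi[OF app gen])
  then show ?thesis using X right_approxD(1)[OF app] by (auto simp: Gen_def)
qed

lemma Ext1_vanishes_section: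
  fixes A B :: "('r, 'u) module"
  assumes "A \<in> Mods R" "B \<in> Mods R"
    and "\<And>(E :: ('r, 'u) module) i p. E \<in> Mods R \<Longrightarrow> short_exact R B i E p A \<Longrightarrow>
      \<exists>s \<in> mod_hom R A E. \<forall>a\<in>carrier A. p (s a) = a"
  shows "Ext1_vanishes R A B"
  unfolding Ext1_vanishes_iff_split[OF assms(1,2) small_dsum2[OF assms(2,1)]]
proof (intro allI impI)
  fix E i p assume "(E, i, p) \<in> extensions R A B"
  then have "E \<in> Mods R" "short_exact R B i E p A" by (simp_all add: extensions_def)
  then show "\<exists>s \<in> mod_hom R A E. \<forall>a\<in>carrier A. p (s a) = a" by (rule assms(3))
qed

lemma Ext1_vanishes_lift_Mods:
  fixes A B E :: "('r, 'u) module"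
  assumes "A \<in> Mods R" "B \<in> Mods R" "Ext1_vanishes R A B" "E \<in> Mods R" "right_module R C"
    "short_exact R B i E p C" "u \<in> mod_hom R A C"
  shows "\<exists>v \<in> mod_hom R A E. \<forall>a\<in>carrier A. p (v a) = u a"
  by (rule Ext1_vanishes_lift[OF assms(1-7) small_dsum2[OF assms(2,1)] small_dsum2[OF assms(1,4)]])

text \<open>
  If \<open>Ext(T, B) = 0\<close>, every extension \<open>E \<rightarrow> M\<close> with kernel \<open>B\<close> is a \<open>T\<close>-epimorphism, so it splits for
  \<open>M\<close> in \<open>Add T\<close> by relative projectivity.
\<close>

lemma Ext1_vanishes_Add:
  fixes T M B :: "('r, 'u) module"
  assumes T: "T \<in> Mods R" and M: "M \<in> Add R T" and B: "B \<in> Mods R" and ext: "Ext1_vanishes R T B"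
  shows "Ext1_vanishes R M B"
proof (rule Ext1_vanishes_section[OF Add_Mods[OF M] B])
  fix E :: "('r, 'u) module" and i p assume E: "E \<in> Mods R" and se: "short_exact R B i E p M"
  have p: "p \<in> mod_hom R E M" using se by (simp add: short_exact_def right_exact_def mod_epi_def)
  have lift: "\<exists>h \<in> mod_hom R T E. \<forall>t\<in>carrier T. p (h t) = g t" if g: "g \<in> mod_hom R T M" for g
    by (rule Ext1_vanishes_lift_Mods[OF T B ext E Mods_right_module[OF Add_Mods[OF M]] se g])
  show "\<exists>s \<in> mod_hom R M E. \<forall>a\<in>carrier M. p (s a) = a"
    by (rule relatively_projectiveD[OF Add_relatively_projective[OF T M] E Add_Mods[OF M] p lift hom_id])
qed

lemma kernel_short_exact:
  "p \<in> mod_epi R E C \<Longrightarrow> short_exact R (submod E (mod_ker E C p)) (\<lambda>x. x) E p C"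
  unfolding short_exact_def right_exact_def
  by (auto intro: hom_submod_incl simp: mod_ker_def)

text \<open>
  A module \<open>X\<close> in \<open>Gen T = Pres T\<close> has a presentation by \<open>M0\<close> in \<open>Add T\<close> whose kernel again lies in
  \<open>Gen T\<close>. If \<open>X\<close> is Ext-projective the presentation splits, and \<open>X\<close> is a summand of \<open>M0\<close>. In
  particular \<open>Add T\<close> depends on \<open>Gen T\<close> only, so the class of \<open>T\<close> is determined by \<open>Gen T\<close>.
\<close>

lemma Add_eq_Ext_projectives:
  fixes T :: "('r, 'u) module"
  assumes q: "quasitilting R T"
  shows "Add R T = {X \<in> Gen R T. \<forall>Y \<in> Gen R T. Ext1_vanishes R X Y}"
proof (intro equalityI subsetI)
  have T: "T \<in> Mods R" and pres: "Pres R T = Gen R T"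
    and ext: "\<And>Y. Y \<in> Gen R T \<Longrightarrow> Ext1_vanishes R T Y"
    using q by (auto simp: quasitilting_def)
  {
    fix M assume "M \<in> Add R T"
    then show "M \<in> {X \<in> Gen R T. \<forall>Y \<in> Gen R T. Ext1_vanishes R X Y}"
      using Add_subset_Gen Ext1_vanishes_Add[OF T _ Gen_Mods ext] by simp
  next
    fix X assume "X \<in> {X \<in> Gen R T. \<forall>Y \<in> Gen R T. Ext1_vanishes R X Y}"
    then have X: "X \<in> Mods R" "X \<in> Pres R T" and ep: "\<And>Y. Y \<in> Gen R T \<Longrightarrow> Ext1_vanishes R X Y"
      using pres Gen_Mods by auto
    obtain M1 M0 f g where M: "M1 \<in> Add R T" "M0 \<in> Add R T" and re: "right_exact R M1 f M0 g X"
      using X(2) by (auto simp: Pres_def)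
    have g: "g \<in> mod_epi R M0 X" and f: "f \<in> mod_hom R M1 M0"
      and im: "f ` carrier M1 = mod_ker M0 X g"
      using re by (auto simp: right_exact_def)
    let ?K = "submod M0 (mod_ker M0 X g)"
    have K: "?K \<in> Mods R"
      by (rule submod_in_Mods[OF Add_Mods[OF M(2)] Mods_right_module[OF X(1)] mod_epi_hom[OF g]])
    have "f \<in> mod_hom R M1 ?K" by (rule hom_into_submod[OF f]) (use im in auto)
    then have "f \<in> mod_epi R M1 ?K" using im by (simp add: mod_epi_def)
    then have "?K \<in> Gen R T" using K M(1) by (auto simp: Gen_def)
    from Ext1_vanishes_lift_Mods[OF X(1) K ep[OF this] Add_Mods[OF M(2)] Mods_right_module[OF X(1)]
        kernel_short_exact[OF g] hom_id]
    obtain v where v: "v \<in> mod_hom R X M0" "\<forall>x\<in>carrier X. g (v x) = x" ..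
    have "retract R X M0" by (rule retractI[OF v(1) mod_epi_hom[OF g]]) (simp add: v(2))
    then show "X \<in> Add R T" by (rule Add_retract[OF T M(2) X(1)])
  }
qed

section \<open>The regular module\<close>

text \<open>
  The ring as a right module over itself, copied into the universe: it is generated by one element
  \<open>e\<close>, the image of the unit, which can be sent anywhere. It serves to turn elements of modules
  into homomorphisms.
\<close>

lemma regular_module:
  obtains P :: "('r, 'u) module" and e where "P \<in> Mods R" "e \<in> carrier P"
    "\<And>x. x \<in> carrier P \<Longrightarrow> \<exists>a\<in>carrier R. x = a \<odot>\<^bsub>P\<^esub> e"
    "\<And>(X :: ('r, 'u) module) x. right_module R X \<Longrightarrow> x \<in> carrier X \<Longrightarrow> \<exists>h \<in> mod_hom R P X. h e = x"
proof -
  interpret R: ring R by (rule ring)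
  define P0 :: "('r, 'r) module" where
    "P0 = \<lparr>carrier = carrier R, mult = undefined, one = undefined, zero = \<zero>\<^bsub>R\<^esub>,
      add = add R, smult = (\<lambda>a x. x \<otimes>\<^bsub>R\<^esub> a)\<rparr>"
  have P0s: "carrier P0 = carrier R" "\<zero>\<^bsub>P0\<^esub> = \<zero>\<^bsub>R\<^esub>" "\<And>x y. x \<oplus>\<^bsub>P0\<^esub> y = x \<oplus>\<^bsub>R\<^esub> y"
    "\<And>a x. a \<odot>\<^bsub>P0\<^esub> x = x \<otimes>\<^bsub>R\<^esub> a" by (simp_all add: P0_def)
  have P0: "right_module R P0"
  proof (rule right_moduleI[OF ring])
    show "abelian_group P0"
    proof (rule abelian_groupI)
      fix x assume "x \<in> carrier P0"
      then show "\<exists>y\<in>carrier P0. y \<oplus>\<^bsub>P0\<^esub> x = \<zero>\<^bsub>P0\<^esub>"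
        by (intro bexI[of _ "\<ominus>\<^bsub>R\<^esub> x"]) (auto simp: P0s R.l_neg)
    qed (auto simp: P0s R.a_ac)
  qed (auto simp: P0s R.l_distr R.r_distr R.m_assoc)
  obtain P :: "('r, 'u) module" and f g where P: "P \<in> Mods R" and f: "f \<in> mod_iso R P0 P"
    and g: "g \<in> mod_iso R P P0" and gf: "\<And>x. x \<in> carrier P0 \<Longrightarrow> g (f x) = x"
    and fg: "\<And>y. y \<in> carrier P \<Longrightarrow> f (g y) = y"
    by (rule transport_to_Mods[OF P0]) (use small_ring in \<open>auto simp: P0s small_def\<close>)
  have fh: "f \<in> mod_hom R P0 P" and gh: "g \<in> mod_hom R P P0"
    using f g by (auto simp: mod_iso_def)
  show ?thesis
  proof (rule that[OF P])
    show "f \<one>\<^bsub>R\<^esub> \<in> carrier P" using hom_closed[OF fh] by (simp add: P0s)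
    show "\<exists>a\<in>carrier R. x = a \<odot>\<^bsub>P\<^esub> f \<one>\<^bsub>R\<^esub>" if x: "x \<in> carrier P" for x
    proof -
      have a: "g x \<in> carrier R" using hom_closed[OF gh x] by (simp add: P0s)
      have "x = f (g x \<odot>\<^bsub>P0\<^esub> \<one>\<^bsub>R\<^esub>)" using fg[OF x] a by (simp add: P0s)
      also have "\<dots> = g x \<odot>\<^bsub>P\<^esub> f \<one>\<^bsub>R\<^esub>" using a by (subst hom_smult[OF fh]) (auto simp: P0s)
      finally show ?thesis using a by auto
    qed
    fix X :: "('r, 'u) module" and x assume X: "right_module R X" and x: "x \<in> carrier X"
    interpret X: right_module R X by (rule X)
    have "(\<lambda>a. a \<odot>\<^bsub>X\<^esub> x) \<in> mod_hom R P0 X"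
      using x by (intro mod_homI) (auto simp: P0s X.smult_closed X.smult_l_distr X.smult_assoc)
    then have "(\<lambda>y. g y \<odot>\<^bsub>X\<^esub> x) \<in> mod_hom R P X" by (rule hom_comp[OF gh])
    moreover have "g (f \<one>\<^bsub>R\<^esub>) \<odot>\<^bsub>X\<^esub> x = x" using gf x by (simp add: P0s X.smult_one)
    ultimately show "\<exists>h \<in> mod_hom R P X. h (f \<one>\<^bsub>R\<^esub>) = x"
      by (intro bexI[of _ "\<lambda>y. g y \<odot>\<^bsub>X\<^esub> x"])
  qed
qed

lemma generator_hom_eq:
  assumes "\<And>x. x \<in> carrier P \<Longrightarrow> \<exists>a\<in>carrier R. x = a \<odot>\<^bsub>P\<^esub> e" "e \<in> carrier P"
    "f \<in> mod_hom R P X" "g \<in> mod_hom R P X" "f e = g e" "x \<in> carrier P"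
  shows "f x = g x"
proof -
  obtain a where "a \<in> carrier R" "x = a \<odot>\<^bsub>P\<^esub> e" using assms(1)[OF assms(6)] by auto
  then show ?thesis using assms(2,5) by (simp add: hom_smult[OF assms(3)] hom_smult[OF assms(4)])
qed

lemma projective_generator:
  fixes P :: "('r, 'u) module"
  assumes P: "P \<in> Mods R" and e: "e \<in> carrier P"
    and gen: "\<And>x. x \<in> carrier P \<Longrightarrow> \<exists>a\<in>carrier R. x = a \<odot>\<^bsub>P\<^esub> e"
    and free: "\<And>(X :: ('r, 'u) module) x. right_module R X \<Longrightarrow> x \<in> carrier X \<Longrightarrow>
      \<exists>h \<in> mod_hom R P X. h e = x"
  shows "projective R P"
  unfolding projective_def
proof (intro conjI ballI)
  show "P \<in> Mods R" by (rule P)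
  fix X Y :: "('r, 'u) module" and g f
  assume X: "X \<in> Mods R" and g: "g \<in> mod_epi R X Y" and f: "f \<in> mod_hom R P Y"
  obtain x where x: "x \<in> carrier X" "g x = f e"
    by (rule mod_epi_obtain[OF g hom_closed[OF f e]])
  obtain h where h: "h \<in> mod_hom R P X" "h e = x" using free[OF Mods_right_module[OF X] x(1)] ..
  have "g (h y) = f y" if "y \<in> carrier P" for y
    by (rule generator_hom_eq[OF gen e hom_comp[OF h(1) mod_epi_hom[OF g]] f _ that])
      (simp_all add: h(2) x(2))
  then show "\<exists>h \<in> mod_hom R P X. \<forall>x\<in>carrier P. g (h x) = f x"
    using h(1) by (intro bexI[of _ h]) auto
qed

end

context module_universe
begin

section \<open>From support tau-tilting subcategories to quasitilting modules\<close>

text \<open>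
  Apply the axiom on projectives to the regular module \<open>P\<close> with generator \<open>e\<close>: there are an exact
  sequence \<open>P \<rightarrow> T0 \<rightarrow> T1 \<rightarrow> 0\<close> and a left approximation \<open>f : P \<rightarrow> T0\<close>. Every element of a module in
  \<open>\<T>\<close> is the value at \<open>f e\<close> of a homomorphism on \<open>T0\<close>, so \<open>T0\<close> generates all of \<open>\<T>\<close>. The module
  \<open>T = T0 \<oplus> T1\<close> is the quasitilting module sought; \<open>T1\<close> is there to make \<open>Pres T = Gen T\<close> hold.
\<close>

lemma quasitilting_of_support_tau_tilting:
  fixes \<T> :: "('r, 'u) module set"
  assumes \<T>: "support_tau_tilting R \<T>"
  shows "\<exists>T \<in> finendo_quasitilting_modules R. Gen R T = Fac R \<T>"
proof -
  note D = \<T>[unfolded support_tau_tilting_def]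
  note D' = D[THEN conjunct1, unfolded additive_subcategory_def]
  note cf = D[THEN conjunct2, THEN conjunct1]
  note ext = D[THEN conjunct2, THEN conjunct2, THEN conjunct1, rule_format]
  note approx = D[THEN conjunct2, THEN conjunct2, THEN conjunct2, rule_format]
  note sub = D'[THEN conjunct1]
  note sums = D'[THEN conjunct2, THEN conjunct2, THEN conjunct1, rule_format]
  note summands = D'[THEN conjunct2, THEN conjunct2, THEN conjunct2, rule_format]
  obtain P :: "('r, 'u) module" and e where P: "P \<in> Mods R" and e: "e \<in> carrier P"
    and gen: "\<And>x. x \<in> carrier P \<Longrightarrow> \<exists>a\<in>carrier R. x = a \<odot>\<^bsub>P\<^esub> e"
    and free: "\<And>(X :: ('r, 'u) module) x. right_module R X \<Longrightarrow> x \<in> carrier X \<Longrightarrow>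
      \<exists>h \<in> mod_hom R P X. h e = x"
    using regular_module by blast
  have "projective R P" by (rule projective_generator[OF P e gen free])
  from approx[OF this] obtain T0 T1 f g where T01: "T0 \<in> \<T>" "T1 \<in> \<T>" and re: "right_exact R P f T0 g T1"
    and la: "left_approx R \<T> P f T0"
    by auto
  have T01M: "T0 \<in> Mods R" "T1 \<in> Mods R" using T01 sub by auto
  have f: "f \<in> mod_hom R P T0" and g: "g \<in> mod_epi R T0 T1" and im: "f ` carrier P = mod_ker T0 T1 g"
    using re by (auto simp: right_exact_def)
  have factor: "\<exists>h \<in> mod_hom R T0 X. \<forall>a \<in> carrier P. u a = h (f a)"
    if "X \<in> \<T>" "u \<in> mod_hom R P X" for X u
    using la that by (simp add: left_approx_def)
  have generic: "\<exists>h \<in> mod_hom R T0 X. h (f e) = x" if X: "X \<in> \<T>" and x: "x \<in> carrier X" for X x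
  proof -
    have "right_module R X" using X sub Mods_right_module by auto
    from free[OF this x] obtain u where u: "u \<in> mod_hom R P X" "u e = x" ..
    obtain h where "h \<in> mod_hom R T0 X" "\<forall>a \<in> carrier P. u a = h (f a)" using factor[OF X u(1)] ..
    then show ?thesis using u(2) e by (intro bexI[of _ h]) auto
  qed
  define M where "M i = (if i = 0 then T0 else T1)" for i :: nat
  have MT: "M i \<in> \<T>" for i using T01 by (simp add: M_def)
  have MM: "M i \<in> Mods R" for i using MT sub by auto
  have small2: "small TYPE('u) {..<2::nat}" by (rule small_finite) simp
  obtain T j c where T: "coproduct R {..<2::nat} M T j" and c: "c \<in> mod_iso R (dsum {..<2} M) T"
    using coproduct_exists[of "{..<2::nat}" M, OF small2 MM] by auto
  have TM: "T \<in> Mods R" by (rule coproduct_Mods[OF T])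
  have "isomorphic R T (dsum {..<2} M)"
    using mod_iso_inverse[OF right_module_dsum[OF ring Mods_right_module[OF MM]] c]
    by (auto simp: isomorphic_def)
  then have TT: "T \<in> \<T>" by (intro sums[of 2 M T]) (simp_all add: MT TM)
  have r0: "retract R T0 T" using coproduct_retract[OF T, of 0] MM[of 0] by (simp add: M_def)
  have r1: "retract R T1 T" using coproduct_retract[OF T, of 1] MM[of 1] by (simp add: M_def)
  have Add01: "T0 \<in> Add R T" "T1 \<in> Add R T"
    using Add_retract[OF TM Add_self[OF TM]] r0 r1 T01M by auto
  \<comment> \<open>A right approximation \<open>X \<rightarrow> N\<close> by \<open>\<T>\<close> is a \<open>T\<close>-epimorphism since \<open>T\<close> is in \<open>\<T>\<close>, so it splits:
    contravariant finiteness replaces closure of \<open>\<T>\<close> under infinite sums.\<close>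
  have AddT: "N \<in> \<T>" if N: "N \<in> Add R T" for N
  proof -
    have NM: "N \<in> Mods R" by (rule Add_Mods[OF N])
    obtain X p where X: "right_approx R \<T> X p N"
      using cf NM by (auto simp: contravariantly_finite_def)
    note p = right_approxD[OF X]
    have XM: "X \<in> Mods R" using p(1) sub by auto
    have "\<exists>h \<in> mod_hom R T X. \<forall>t\<in>carrier T. p (h t) = u t" if u: "u \<in> mod_hom R T N" for u
    proof -
      obtain h where "h \<in> mod_hom R T X" "\<forall>t\<in>carrier T. u t = p (h t)" using p(3)[OF TT u] ..
      then show ?thesis by (intro bexI[of _ h]) auto
    qed
    from relatively_projectiveD[OF Add_relatively_projective[OF TM N] XM NM p(2) this hom_id]
    obtain v where v: "v \<in> mod_hom R N X" "\<forall>n\<in>carrier N. p (v n) = n" ..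
    have "retract R N X" by (rule retractI[OF v(1) p(2)]) (simp add: v(2))
    then have "is_summand R N X"
      using is_summand_iff_retract[OF Mods_right_module[OF NM] Mods_right_module[OF XM] Mods_small[OF XM]]
      by simp
    then show ?thesis by (rule summands[OF p(1) NM])
  qed
  have GenFac: "Gen R T = Fac R \<T>"
  proof (intro equalityI subsetI)
    fix Y assume "Y \<in> Gen R T"
    then show "Y \<in> Fac R \<T>" using AddT by (auto simp: Gen_def Fac_def)
  next
    fix Y assume "Y \<in> Fac R \<T>"
    then obtain X p where Y: "Y \<in> Mods R" and X: "X \<in> \<T>" and p: "p \<in> mod_epi R X Y"
      by (auto simp: Fac_def)
    show "Y \<in> Gen R T"
    proof (rule GenI[OF TM Y])
      fix y assume "y \<in> carrier Y"
      from mod_epi_obtain[OF p this] obtain x where x: "x \<in> carrier X" "p x = y" .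
      obtain h where h: "h \<in> mod_hom R T0 X" "h (f e) = x" using generic[OF X x(1)] ..
      show "\<exists>N \<in> Add R T. \<exists>h \<in> mod_hom R N Y. y \<in> h ` carrier N"
      proof (intro bexI)
        show "(\<lambda>z. p (h z)) \<in> mod_hom R T0 Y" by (rule hom_comp[OF h(1) mod_epi_hom[OF p]])
        show "y \<in> (\<lambda>z. p (h z)) ` carrier T0"
          using h(2) x(2) hom_closed[OF f e] by (intro image_eqI[of _ _ "f e"]) auto
      qed (rule Add01(1))
    qed
  qed
  have extT: "Ext1_vanishes R T Y" if Y: "Y \<in> Gen R T" for Y
  proof -
    obtain N p where N: "N \<in> Add R T" and p: "p \<in> mod_epi R N Y" by (rule Gen_epi[OF Y])
    have Nm: "right_module R N" by (rule Mods_right_module[OF Add_Mods[OF N]])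
    \<comment> \<open>\<^const>\<open>Fac_obj\<close> allows finite sums of \<open>N\<close>; one copy suffices.\<close>
    have q: "(\<lambda>z. z (0::nat)) \<in> mod_epi R (dsum {..<1} (\<lambda>_. N)) N"
    proof -
      have h: "(\<lambda>z. z (0::nat)) \<in> mod_hom R (dsum {..<1} (\<lambda>_. N)) N"
        by (rule mod_homI) (auto simp: carrier_dsum dsum_simps)
      have "n \<in> (\<lambda>z. z (0::nat)) ` carrier (dsum {..<1} (\<lambda>_. N))" if "n \<in> carrier N" for n
        using that by (intro image_eqI[of _ _ "\<lambda>i\<in>{..<1}. n"]) (auto simp: carrier_dsum)
      then show ?thesis using h hom_closed[OF h] by (auto simp: mod_epi_def)
    qed
    have "Y \<in> Fac_obj R N"
      using mod_epi_comp[OF q p] Gen_Mods[OF Y] unfolding Fac_obj_def by blast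
    then show ?thesis by (rule ext[OF TT AddT[OF N]])
  qed
  have "X \<in> Pres R T" if X: "X \<in> Gen R T" for X
  proof -
    have XM: "X \<in> Mods R" by (rule Gen_Mods[OF X])
    have Xm: "right_module R X" by (rule Mods_right_module[OF XM])
    obtain N p where app: "right_approx R (Add R T) N p X" by (rule Add_right_approx[OF TM XM])
    note pD = right_approxD[OF app]
    have pe: "p \<in> mod_epi R N X" by (rule Gen_right_approx_epi[OF X app])
    have NM: "N \<in> Mods R" by (rule Add_Mods[OF pD(1)])
    have Nm: "right_module R N" by (rule Mods_right_module[OF NM])
    interpret N: right_module R N by (rule Nm)
    interpret X: right_module R X by (rule Xm)
    let ?K = "submod N (mod_ker N X p)"
    have K: "?K \<in> Mods R" by (rule submod_in_Mods[OF NM Xm pD(2)])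
    have "?K \<in> Gen R T"
    proof (rule GenI[OF TM K])
      fix k assume "k \<in> carrier ?K"
      then have k: "k \<in> carrier N" "p k = \<zero>\<^bsub>X\<^esub>" by (auto simp: mod_ker_def)
      obtain h where h: "h \<in> mod_hom R T0 N" "h (f e) = k" using generic[OF AddT[OF pD(1)] k(1)] ..
      have ph: "(\<lambda>z. p (h z)) \<in> mod_hom R T0 X" by (rule hom_comp[OF h(1) pD(2)])
      \<comment> \<open>The map \<open>p \<circ> h\<close> kills the image of \<open>P\<close>, hence descends to \<open>T1\<close>. It lifts from there to \<open>N\<close>, and
        correcting \<open>h\<close> by this lift moves it into the kernel of \<open>p\<close> with the value at \<open>f e\<close> unchanged.\<close>
      have phf: "p (h (f x)) = \<zero>\<^bsub>X\<^esub>" if "x \<in> carrier P" for x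
        by (rule generator_hom_eq[OF gen e hom_comp[OF f ph] hom_zero_map[OF Xm] _ that])
          (simp_all add: h(2) k(2))
      have "p (h z) = \<zero>\<^bsub>X\<^esub>" if "z \<in> carrier T0" "g z = \<zero>\<^bsub>T1\<^esub>" for z
      proof -
        have "z \<in> f ` carrier P" using that im by (simp add: mod_ker_def)
        then show ?thesis using phf by auto
      qed
      from hom_factor_epi[OF Mods_right_module[OF T01M(1)] g ph Xm Mods_right_module[OF T01M(2)] this]
      obtain w where w: "w \<in> mod_hom R T1 X" "\<forall>z\<in>carrier T0. w (g z) = p (h z)" by auto
      obtain l where l: "l \<in> mod_hom R T1 N" "\<forall>x\<in>carrier T1. w x = p (l x)"
        using pD(3)[OF Add01(2) w(1)] ..
      have gh: "g \<in> mod_hom R T0 T1" by (rule mod_epi_hom[OF g])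
      define d where "d = (\<lambda>z. h z \<ominus>\<^bsub>N\<^esub> l (g z))"
      have d: "d \<in> mod_hom R T0 N" unfolding d_def by (rule hom_minus[OF Nm h(1) hom_comp[OF gh l(1)]])
      have "d z \<in> mod_ker N X p" if z: "z \<in> carrier T0" for z
      proof -
        have "p (l (g z)) = p (h z)" using bspec[OF w(2) z] bspec[OF l(2) hom_closed[OF gh z]] by simp
        then have "p (d z) = \<zero>\<^bsub>X\<^esub>"
          using hom_diff[OF Nm Xm pD(2) hom_closed[OF h(1) z] hom_closed[OF l(1) hom_closed[OF gh z]]]
            hom_closed[OF ph z]
          by (simp add: d_def a_minus_def X.M.r_neg)
        then show ?thesis using hom_closed[OF d z] by (simp add: mod_ker_def)
      qed
      then have dK: "d \<in> mod_hom R T0 ?K" by (rule hom_into_submod[OF d])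
      have fe: "f e \<in> carrier T0" by (rule hom_closed[OF f e])
      have "g (f e) = \<zero>\<^bsub>T1\<^esub>" using im e by (auto simp: mod_ker_def)
      then have "l (g (f e)) = \<zero>\<^bsub>N\<^esub>" using hom_zero[OF Mods_right_module[OF T01M(2)] Nm l(1)] by simp
      moreover have neg: "\<ominus>\<^bsub>N\<^esub> \<zero>\<^bsub>N\<^esub> = \<zero>\<^bsub>N\<^esub>" by (rule N.M.minus_equality) auto
      ultimately have "d (f e) = k" using h(2) k(1) by (simp add: d_def a_minus_def neg)
      then show "\<exists>N' \<in> Add R T. \<exists>h \<in> mod_hom R N' ?K. k \<in> h ` carrier N'"
        using fe by (intro bexI[OF _ Add01(1)] bexI[OF _ dK] image_eqI[of _ _ "f e"]) auto
    qed
    then obtain N1 q where N1: "N1 \<in> Add R T" and q: "q \<in> mod_epi R N1 ?K" by (rule Gen_epi)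
    have "right_exact R N1 q N p X"
      unfolding right_exact_def
    proof (intro conjI pe)
      have "mod_ker N X p \<subseteq> carrier N" by (auto simp: mod_ker_def)
      from hom_comp[OF mod_epi_hom[OF q] hom_submod_incl[OF this]] show "q \<in> mod_hom R N1 N" by simp
      show "q ` carrier N1 = mod_ker N X p" using q by (simp add: mod_epi_def)
    qed
    then show ?thesis using XM N1 pD(1) unfolding Pres_def by blast
  qed
  moreover have "X \<in> Gen R T" if "X \<in> Pres R T" for X
    using that by (auto simp: Pres_def Gen_def right_exact_def)
  ultimately have q: "quasitilting R T" using TM extT by (auto simp: quasitilting_def)
  have "finendo R T"
  proof -
    obtain i p where ip: "i \<in> mod_hom R T0 T" "p \<in> mod_hom R T T0"
      "\<And>x. x \<in> carrier T0 \<Longrightarrow> p (i x) = x" by (rule retractE[OF r0]) blast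
    interpret T: right_module R T by (rule Mods_right_module[OF TM])
    have fe: "f e \<in> carrier T0" by (rule hom_closed[OF f e])
    \<comment> \<open>The copy of \<open>f e\<close> in \<open>T\<close> generates \<open>T\<close> over its endomorphism ring.\<close>
    let ?b = "i (f e)"
    have b: "?b \<in> carrier T" by (rule hom_closed[OF ip(1) fe])
    have "\<exists>d. (\<forall>x\<in>{?b}. d x \<in> mod_hom R T T) \<and> t = (\<Oplus>\<^bsub>T\<^esub>x\<in>{?b}. d x x)"
      if t: "t \<in> carrier T" for t
    proof -
      obtain h where h: "h \<in> mod_hom R T0 T" "h (f e) = t" using generic[OF TT t] ..
      have "(\<lambda>z. h (p z)) \<in> mod_hom R T T" by (rule hom_comp[OF ip(2) h(1)])
      moreover have "h (p ?b) = t" using ip(3)[OF fe] h(2) by simp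
      ultimately show ?thesis
        using t by (intro exI[of _ "\<lambda>_ z. h (p z)"]) (simp add: T.M.finsum_insert)
    qed
    then show ?thesis unfolding finendo_def using b by (intro exI[of _ "{?b}"]) auto
  qed
  with q have "T \<in> finendo_quasitilting_modules R" by (simp add: finendo_quasitilting_modules_def)
  then show ?thesis using GenFac by blast
qed

section \<open>From quasitilting modules to support tau-tilting subcategories\<close>

lemma finsum_induct:
  assumes "abelian_group G" "finite F" "g \<in> F \<rightarrow> carrier G" "P \<zero>\<^bsub>G\<^esub>"
    "\<And>x y. x \<in> carrier G \<Longrightarrow> y \<in> carrier G \<Longrightarrow> P x \<Longrightarrow> P y \<Longrightarrow> P (x \<oplus>\<^bsub>G\<^esub> y)"
    "\<And>i. i \<in> F \<Longrightarrow> P (g i)"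
  shows "P (finsum G g F)"
proof -
  interpret G: abelian_group G by fact
  show ?thesis using assms(2,3,6)
  proof (induction F rule: finite_induct)
    case empty
    then show ?case using assms(4) by simp
  next
    case (insert i F)
    then have "g \<in> F \<rightarrow> carrier G" "g i \<in> carrier G" by auto
    then show ?case using insert assms(5) by (simp add: G.finsum_insert)
  qed
qed

text \<open>
  Realised elements are closed under sums and homomorphisms; arguing with them spares writing down
  the homomorphisms that realise them.
\<close>

definition realises :: "('r, 'u) module \<Rightarrow> 'u \<Rightarrow> ('r, 'u) module \<Rightarrow> 'u \<Rightarrow> bool" where
  "realises N a X x \<longleftrightarrow> (\<exists>h \<in> mod_hom R N X. h a = x)"

lemma realises_zero: "right_module R X \<Longrightarrow> realises N a X \<zero>\<^bsub>X\<^esub>"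
  unfolding realises_def by (rule bexI[OF refl hom_zero_map])

lemma realises_add:
  assumes "right_module R X" "realises N a X x" "realises N a X y"
  shows "realises N a X (x \<oplus>\<^bsub>X\<^esub> y)"
proof -
  obtain h where h: "h \<in> mod_hom R N X" "h a = x" using assms(2) by (auto simp: realises_def)
  obtain k where k: "k \<in> mod_hom R N X" "k a = y" using assms(3) by (auto simp: realises_def)
  show ?thesis
    unfolding realises_def using hom_sum[OF assms(1) h(1) k(1)] h(2) k(2)
    by (intro bexI[of _ "\<lambda>z. h z \<oplus>\<^bsub>X\<^esub> k z"]) auto
qed

lemma realises_hom:
  assumes "realises N a X x" "u \<in> mod_hom R X Y"
  shows "realises N a Y (u x)"
proof -
  obtain h where h: "h \<in> mod_hom R N X" "h a = x" using assms(1) by (auto simp: realises_def)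
  then show ?thesis
    unfolding realises_def using hom_comp[OF h(1) assms(2)] by (intro bexI[of _ "\<lambda>z. u (h z)"]) auto
qed

text \<open>
  If \<open>T\<close> is generated over its endomorphism ring by the finite set \<open>F\<close>, then the tuple of all
  elements of \<open>F\<close> in \<open>T\<^sup>F\<close> realises every element of \<open>T\<close>, hence of every sum of copies of \<open>T\<close>, hence
  of every module in \<open>Add T\<close>. Sending the unit of the ring to it is a left approximation of the
  regular module.
\<close>

lemma finendo_generic_element:
  fixes T :: "('r, 'u) module"
  assumes T: "T \<in> Mods R" and fin: "finendo R T"
  obtains N a where "N \<in> Add R T" "a \<in> carrier N"
    "\<And>X x. X \<in> Add R T \<Longrightarrow> x \<in> carrier X \<Longrightarrow> \<exists>h \<in> mod_hom R N X. h a = x"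
proof -
  have Tm: "right_module R T" by (rule Mods_right_module[OF T])
  obtain F where F: "finite F" "F \<subseteq> carrier T" and
    Fgen: "\<And>t. t \<in> carrier T \<Longrightarrow> \<exists>e. (\<forall>x\<in>F. e x \<in> mod_hom R T T) \<and> t = (\<Oplus>\<^bsub>T\<^esub>x\<in>F. e x x)"
    using fin by (auto simp: finendo_def)
  have sF: "small TYPE('u) F" by (rule small_finite[OF F(1)])
  have D: "right_module R (dsum F (\<lambda>_. T))" by (rule right_module_dsum[OF ring Tm])
  obtain N j c where N: "coproduct R F (\<lambda>_. T) N j" and c: "c \<in> mod_iso R (dsum F (\<lambda>_. T)) N"
    using coproduct_exists[of F "\<lambda>_. T", OF sF T] by auto
  obtain d where d: "d \<in> mod_iso R N (dsum F (\<lambda>_. T))"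
    and dc: "\<And>x. x \<in> carrier (dsum F (\<lambda>_. T)) \<Longrightarrow> d (c x) = x"
    by (rule mod_iso_inverse[OF D c]) blast
  have NA: "N \<in> Add R T" by (rule Add_coproduct[OF T N Add_self[OF T]])
  \<comment> \<open>The tuple of the generators, indexed by the generators themselves.\<close>
  define b where "b = (\<lambda>x\<in>F. x)"
  have b: "b \<in> carrier (dsum F (\<lambda>_. T))" using F by (auto simp: b_def carrier_dsum)
  define a where "a = c b"
  have a: "a \<in> carrier N"
    using c hom_closed[OF _ b, of c R N] by (simp add: a_def mod_iso_def)
  have proj: "realises N a T x" if x: "x \<in> F" for x
  proof -
    have "(\<lambda>z. z x) \<in> mod_hom R (dsum F (\<lambda>_. T)) T"
      using x by (intro mod_homI) (auto simp: carrier_dsum dsum_simps)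
    moreover have "d \<in> mod_hom R N (dsum F (\<lambda>_. T))" using d by (simp add: mod_iso_def)
    ultimately have "(\<lambda>z. d z x) \<in> mod_hom R N T" using hom_comp by fastforce
    moreover have "d a x = x" using dc[OF b] x by (simp add: a_def b_def)
    ultimately show ?thesis unfolding realises_def by (intro bexI[of _ "\<lambda>z. d z x"])
  qed
  have onT: "realises N a T t" if t: "t \<in> carrier T" for t
  proof -
    obtain e where e: "\<And>x. x \<in> F \<Longrightarrow> e x \<in> mod_hom R T T" and te: "t = (\<Oplus>\<^bsub>T\<^esub>x\<in>F. e x x)"
      using Fgen[OF t] by auto
    show ?thesis unfolding te
    proof (rule finsum_induct[OF right_module_abelian_group[OF Tm] F(1)])
      show "(\<lambda>x. e x x) \<in> F \<rightarrow> carrier T" using hom_closed[OF e] F(2) by auto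
      show "realises N a T (e x x)" if "x \<in> F" for x by (rule realises_hom[OF proj[OF that] e[OF that]])
    qed (simp_all add: realises_zero realises_add Tm)
  qed
  have "realises N a X x" if X: "X \<in> Add R T" and x: "x \<in> carrier X" for X x
  proof -
    obtain I :: "'u set" and S k where S: "coproduct R I (\<lambda>_. T) S k" and r: "retract R X S"
      by (rule Add_retract_coproduct[OF T X])
    have Sm: "right_module R S" by (rule Mods_right_module[OF coproduct_Mods[OF S]])
    obtain i p where ip: "i \<in> mod_hom R X S" "p \<in> mod_hom R S X"
      "\<And>x. x \<in> carrier X \<Longrightarrow> p (i x) = x" by (rule retractE[OF r]) blast
    have "realises N a S (i x)"
    proof (rule coproduct_induct[OF S hom_closed[OF ip(1) x]])
      show "realises N a S (k l t)" if "l \<in> I" "t \<in> carrier T" for l t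
        by (rule realises_hom[OF onT[OF that(2)] coproduct_inj[OF S that(1)]])
    qed (simp_all add: realises_zero realises_add Sm)
    then have "realises N a X (p (i x))" by (rule realises_hom[OF _ ip(2)])
    then show ?thesis using ip(3)[OF x] by simp
  qed
  then show ?thesis unfolding realises_def by (rule that[OF NA a])
qed

lemma projective_lift:
  fixes P X Y :: "('r, 'u) module"
  assumes "projective R P" "X \<in> Mods R" "Y \<in> Mods R" "g \<in> mod_epi R X Y" "f \<in> mod_hom R P Y"
  shows "\<exists>h \<in> mod_hom R P X. \<forall>x \<in> carrier P. g (h x) = f x"
  using assms by (simp add: projective_def)

text \<open>
  A coproduct of copies of the approximation \<open>\<phi>\<close> of the regular module \<open>Q\<close> is an approximation of
  the free module \<open>L\<close> on the elements of \<open>P\<close>. Restricting it to \<open>P\<close> along a splitting of \<open>L \<rightarrow> P\<close>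
  gives an approximation of \<open>P\<close>, because maps on \<open>P\<close> extend to \<open>L\<close>.
\<close>

lemma Add_left_approx_projective:
  fixes T P :: "('r, 'u) module"
  assumes T: "T \<in> Mods R" and fin: "finendo R T" and proj: "projective R P"
  obtains T0 f where "left_approx R (Add R T) P f T0"
proof -
  have P: "P \<in> Mods R" using proj by (simp add: projective_def)
  obtain N a where N: "N \<in> Add R T" and a: "a \<in> carrier N"
    and generic: "\<And>X x. X \<in> Add R T \<Longrightarrow> x \<in> carrier X \<Longrightarrow> \<exists>h \<in> mod_hom R N X. h a = x"
    by (rule finendo_generic_element[OF T fin]) blast
  obtain Q :: "('r, 'u) module" and e where Q: "Q \<in> Mods R" and e: "e \<in> carrier Q"
    and gen: "\<And>x. x \<in> carrier Q \<Longrightarrow> \<exists>a\<in>carrier R. x = a \<odot>\<^bsub>Q\<^esub> e"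
    and free: "\<And>(X :: ('r, 'u) module) x. right_module R X \<Longrightarrow> x \<in> carrier X \<Longrightarrow>
      \<exists>h \<in> mod_hom R Q X. h e = x"
    using regular_module by blast
  have NM: "N \<in> Mods R" by (rule Add_Mods[OF N])
  obtain \<phi> where \<phi>: "\<phi> \<in> mod_hom R Q N" "\<phi> e = a" using free[OF Mods_right_module[OF NM] a] ..
  obtain L jL where L: "coproduct R (carrier P) (\<lambda>_. Q) L jL"
    using coproduct_exists[of "carrier P" "\<lambda>_. Q", OF Mods_small[OF P] Q] by auto
  obtain T0 jT where T0: "coproduct R (carrier P) (\<lambda>_. N) T0 jT"
    using coproduct_exists[of "carrier P" "\<lambda>_. N", OF Mods_small[OF P] NM] by auto
  have LM: "L \<in> Mods R" and T0M: "T0 \<in> Mods R" by (rule coproduct_Mods[OF L], rule coproduct_Mods[OF T0])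
  have T0A: "T0 \<in> Add R T" by (rule Add_coproduct[OF T T0 N])
  have "\<forall>x\<in>carrier P. \<exists>r. r \<in> mod_hom R Q P \<and> r e = x"
    using free[OF Mods_right_module[OF P]] by auto
  from bchoice[OF this] obtain r where r: "\<And>x. x \<in> carrier P \<Longrightarrow> r x \<in> mod_hom R Q P"
    "\<And>x. x \<in> carrier P \<Longrightarrow> r x e = x" by auto
  obtain \<rho> where \<rho>: "\<rho> \<in> mod_hom R L P" "\<forall>x\<in>carrier P. \<forall>y\<in>carrier Q. \<rho> (jL x y) = r x y"
    using coproduct_copair[OF L P r(1)] ..
  have "x \<in> \<rho> ` carrier L" if "x \<in> carrier P" for x
    using that \<rho>(2) r(2) e hom_closed[OF coproduct_inj[OF L that] e]
    by (intro image_eqI[of _ _ "jL x e"]) auto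
  then have "\<rho> \<in> mod_epi R L P" using \<rho>(1) hom_closed[OF \<rho>(1)] by (auto simp: mod_epi_def)
  from projective_lift[OF proj LM P this hom_id]
  obtain s where s: "s \<in> mod_hom R P L" "\<forall>x\<in>carrier P. \<rho> (s x) = x" ..
  have "(\<lambda>y. jT x (\<phi> y)) \<in> mod_hom R Q T0" if "x \<in> carrier P" for x
    by (rule hom_comp[OF \<phi>(1) coproduct_inj[OF T0 that]])
  from coproduct_copair[OF L T0M this]
  obtain \<alpha> where \<alpha>: "\<alpha> \<in> mod_hom R L T0"
    "\<forall>x\<in>carrier P. \<forall>y\<in>carrier Q. \<alpha> (jL x y) = jT x (\<phi> y)" ..
  have f: "(\<lambda>x. \<alpha> (s x)) \<in> mod_hom R P T0" by (rule hom_comp[OF s(1) \<alpha>(1)])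
  have "\<exists>h \<in> mod_hom R T0 X. \<forall>x \<in> carrier P. g x = h (\<alpha> (s x))"
    if X: "X \<in> Add R T" and g: "g \<in> mod_hom R P X" for X g
  proof -
    have XM: "X \<in> Mods R" by (rule Add_Mods[OF X])
    have "\<forall>x\<in>carrier P. \<exists>h. h \<in> mod_hom R N X \<and> h a = g x"
      using generic[OF X hom_closed[OF g]] by auto
    from bchoice[OF this] obtain h where h: "\<And>x. x \<in> carrier P \<Longrightarrow> h x \<in> mod_hom R N X"
      "\<And>x. x \<in> carrier P \<Longrightarrow> h x a = g x" by auto
    obtain k where k: "k \<in> mod_hom R T0 X" "\<forall>x\<in>carrier P. \<forall>y\<in>carrier N. k (jT x y) = h x y"
      using coproduct_copair[OF T0 XM h(1)] ..
    have agree: "k (\<alpha> (jL x y)) = g (\<rho> (jL x y))" if x: "x \<in> carrier P" and y: "y \<in> carrier Q" for x y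
    proof (rule generator_hom_eq[OF gen e _ _ _ y])
      note jx = coproduct_inj[OF L x]
      show "(\<lambda>y. k (\<alpha> (jL x y))) \<in> mod_hom R Q X"
        by (rule hom_comp[OF hom_comp[OF jx \<alpha>(1)] k(1)])
      show "(\<lambda>y. g (\<rho> (jL x y))) \<in> mod_hom R Q X"
        by (rule hom_comp[OF hom_comp[OF jx \<rho>(1)] g])
      show "k (\<alpha> (jL x e)) = g (\<rho> (jL x e))"
        using bspec[OF bspec[OF \<alpha>(2) x] e] bspec[OF bspec[OF \<rho>(2) x] e]
          bspec[OF bspec[OF k(2) x] a] x
        by (simp add: \<phi>(2) h(2) r(2))
    qed
    have "k (\<alpha> l) = g (\<rho> l)" if "l \<in> carrier L" for l
      by (rule coproduct_hom_eq[OF L Mods_right_module[OF XM] hom_comp[OF \<alpha>(1) k(1)]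
            hom_comp[OF \<rho>(1) g] agree that])
    then have "g x = k (\<alpha> (s x))" if "x \<in> carrier P" for x
      using that s(2) hom_closed[OF s(1)] by simp
    then show ?thesis using k(1) by (intro bexI[of _ k]) auto
  qed
  then have "left_approx R (Add R T) P (\<lambda>x. \<alpha> (s x)) T0" using T0A f by (simp add: left_approx_def)
  then show ?thesis by (rule that)
qed

lemma hom_factor_mono:
  assumes i: "i \<in> mod_hom R Y E" and inj: "inj_on i (carrier Y)" and h: "h \<in> mod_hom R P E"
    and Y: "right_module R Y" and P: "right_module R P"
    and im: "\<And>x. x \<in> carrier P \<Longrightarrow> h x \<in> i ` carrier Y"
  shows "\<exists>v \<in> mod_hom R P Y. \<forall>x\<in>carrier P. i (v x) = h x"
proof -
  interpret Y: right_module R Y by fact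
  interpret P: right_module R P by fact
  define v where "v = (\<lambda>x. inv_into (carrier Y) i (h x))"
  have vc: "v x \<in> carrier Y" and iv: "i (v x) = h x" if "x \<in> carrier P" for x
    using inv_into_into[OF im[OF that]] f_inv_into_f[OF im[OF that]] by (simp_all add: v_def)
  have "v \<in> mod_hom R P Y"
  proof (rule mod_homI[OF vc])
    fix x y assume *: "x \<in> carrier P" "y \<in> carrier P"
    show "v (x \<oplus>\<^bsub>P\<^esub> y) = v x \<oplus>\<^bsub>Y\<^esub> v y"
      by (rule inj_onD[OF inj]) (use * in \<open>simp_all add: iv vc hom_add[OF i] hom_add[OF h]\<close>)
  next
    fix a x assume *: "a \<in> carrier R" "x \<in> carrier P"
    show "v (a \<odot>\<^bsub>P\<^esub> x) = a \<odot>\<^bsub>Y\<^esub> v x"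
      by (rule inj_onD[OF inj])
        (use * in \<open>simp_all add: iv vc hom_smult[OF i] hom_smult[OF h] P.smult_closed Y.smult_closed\<close>)
  qed
  then show ?thesis using iv by (intro bexI[of _ v]) auto
qed

text \<open>
  Given an extension \<open>0 \<rightarrow> Y \<rightarrow> E \<rightarrow> C \<rightarrow> 0\<close>, the map \<open>q : T0 \<rightarrow> C\<close> lifts to \<open>u : T0 \<rightarrow> E\<close>. On \<open>P\<close> this
  lift takes values in \<open>Y\<close>; since \<open>Y\<close> is a quotient of some \<open>N\<close> in \<open>Add T\<close> and \<open>P\<close> is projective, that
  restriction comes from a map \<open>P \<rightarrow> N\<close>, which extends to \<open>T0\<close> by the approximation property.
  Subtracting the extension from \<open>u\<close> gives a lift that kills \<open>P\<close>, that is, a section over \<open>C\<close>.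
\<close>

lemma left_approx_cokernel_Ext_projective:
  fixes T P C T0 :: "('r, 'u) module"
  assumes T: "T \<in> Mods R" and ext: "Ext1_vanishes R T Y" and Y: "Y \<in> Gen R T"
    and proj: "projective R P" and la: "left_approx R (Add R T) P f T0"
    and C: "C \<in> Mods R" and re: "right_exact R P f T0 q C"
  shows "Ext1_vanishes R C Y"
proof -
  have YM: "Y \<in> Mods R" by (rule Gen_Mods[OF Y])
  have T0: "T0 \<in> Add R T" using la by (simp add: left_approx_def)
  have T0M: "T0 \<in> Mods R" by (rule Add_Mods[OF T0])
  have P: "P \<in> Mods R" using proj by (simp add: projective_def)
  note Ym = Mods_right_module[OF YM] and T0m = Mods_right_module[OF T0M]
    and Pm = Mods_right_module[OF P] and Cm = Mods_right_module[OF C]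
  have f: "f \<in> mod_hom R P T0" and q: "q \<in> mod_epi R T0 C" and fq: "f ` carrier P = mod_ker T0 C q"
    using re by (auto simp: right_exact_def)
  show ?thesis
  proof (rule Ext1_vanishes_section[OF C YM])
    fix E :: "('r, 'u) module" and i p assume E: "E \<in> Mods R" and se: "short_exact R Y i E p C"
    have Em: "right_module R E" by (rule Mods_right_module[OF E])
    interpret E: right_module R E by (rule Em)
    interpret C: right_module R C by (rule Cm)
    have i: "i \<in> mod_hom R Y E" "inj_on i (carrier Y)" and p: "p \<in> mod_hom R E C"
      and ip: "i ` carrier Y = mod_ker E C p"
      using se by (auto simp: short_exact_def right_exact_def mod_epi_def)
    have pi: "p (i y) = \<zero>\<^bsub>C\<^esub>" if "y \<in> carrier Y" for y using ip that by (auto simp: mod_ker_def)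
    obtain u where u: "u \<in> mod_hom R T0 E" "\<forall>x\<in>carrier T0. p (u x) = q x"
      using Ext1_vanishes_lift_Mods[OF T0M YM Ext1_vanishes_Add[OF T T0 YM ext] E Cm se mod_epi_hom[OF q]] ..
    have uf: "(\<lambda>x. u (f x)) \<in> mod_hom R P E" by (rule hom_comp[OF f u(1)])
    have "u (f x) \<in> i ` carrier Y" if x: "x \<in> carrier P" for x
    proof -
      have "q (f x) = \<zero>\<^bsub>C\<^esub>" using fq x by (auto simp: mod_ker_def)
      then show ?thesis
        unfolding ip using u(2) hom_closed[OF f x] hom_closed[OF uf x] by (simp add: mod_ker_def)
    qed
    from hom_factor_mono[OF i(1,2) uf Ym Pm this]
    obtain v where v: "v \<in> mod_hom R P Y" "\<forall>x\<in>carrier P. i (v x) = u (f x)" by auto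
    obtain N \<pi> where N: "N \<in> Add R T" and \<pi>: "\<pi> \<in> mod_epi R N Y" by (rule Gen_epi[OF Y])
    obtain v' where v': "v' \<in> mod_hom R P N" "\<forall>x\<in>carrier P. \<pi> (v' x) = v x"
      using projective_lift[OF proj Add_Mods[OF N] YM \<pi> v(1)] ..
    have "\<exists>w \<in> mod_hom R T0 N. \<forall>x\<in>carrier P. v' x = w (f x)"
      using la N v'(1) by (simp add: left_approx_def)
    then obtain w where w: "w \<in> mod_hom R T0 N" "\<forall>x\<in>carrier P. v' x = w (f x)" ..
    have \<pi>w: "(\<lambda>x. \<pi> (w x)) \<in> mod_hom R T0 Y" by (rule hom_comp[OF w(1) mod_epi_hom[OF \<pi>]])
    have i\<pi>w: "(\<lambda>x. i (\<pi> (w x))) \<in> mod_hom R T0 E" by (rule hom_comp[OF \<pi>w i(1)])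
    define u' where "u' = (\<lambda>x. u x \<ominus>\<^bsub>E\<^esub> i (\<pi> (w x)))"
    have u': "u' \<in> mod_hom R T0 E" unfolding u'_def by (rule hom_minus[OF Em u(1) i\<pi>w])
    have "u' x = \<zero>\<^bsub>E\<^esub>" if x: "x \<in> carrier T0" "q x = \<zero>\<^bsub>C\<^esub>" for x
    proof -
      have "x \<in> f ` carrier P" unfolding fq using x by (simp add: mod_ker_def)
      then obtain y where y: "y \<in> carrier P" "x = f y" by auto
      have "i (\<pi> (w x)) = u x"
        using bspec[OF v(2) y(1)] bspec[OF v'(2) y(1)] bspec[OF w(2) y(1)] y(2) by simp
      then show ?thesis using hom_closed[OF u(1) x(1)] by (simp add: u'_def a_minus_def E.M.r_neg)
    qed
    from hom_factor_epi[OF T0m q u' Em Cm this]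
    obtain \<sigma> where \<sigma>: "\<sigma> \<in> mod_hom R C E" "\<forall>x\<in>carrier T0. \<sigma> (q x) = u' x" by auto
    have "p (\<sigma> c) = c" if c: "c \<in> carrier C" for c
    proof -
      obtain x where x: "x \<in> carrier T0" "q x = c" by (rule mod_epi_obtain[OF q c])
      have "p (u' x) = p (u x) \<ominus>\<^bsub>C\<^esub> p (i (\<pi> (w x)))"
        unfolding u'_def by (rule hom_diff[OF Em Cm p hom_closed[OF u(1) x(1)] hom_closed[OF i\<pi>w x(1)]])
      also have "\<dots> = c"
      proof -
        have neg: "\<ominus>\<^bsub>C\<^esub> \<zero>\<^bsub>C\<^esub> = \<zero>\<^bsub>C\<^esub>" by (rule C.M.minus_equality) auto
        show ?thesis using u(2) x pi[OF hom_closed[OF \<pi>w x(1)]] c by (simp add: a_minus_def neg)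
      qed
      finally show ?thesis using \<sigma>(2) x by auto
    qed
    then show "\<exists>s \<in> mod_hom R C E. \<forall>c\<in>carrier C. p (s c) = c" using \<sigma>(1) by (intro bexI[of _ \<sigma>]) auto
  qed
qed

text \<open>
  The cokernel of a left approximation of a projective module lies in \<open>Gen T\<close> and is Ext-projective
  there, hence in \<open>Add T\<close>; the other axioms hold because \<open>Add T\<close> is given by relative projectivity.
\<close>

lemma support_tau_tilting_Add:
  fixes T :: "('r, 'u) module"
  assumes q: "quasitilting R T" and fin: "finendo R T"
  shows "support_tau_tilting R (Add R T)"
proof -
  have T: "T \<in> Mods R" and ext: "\<And>Y. Y \<in> Gen R T \<Longrightarrow> Ext1_vanishes R T Y"
    using q by (auto simp: quasitilting_def)
  have finsum: "Y \<in> Add R T" if X: "\<forall>i<n. X i \<in> Add R T" and Y: "Y \<in> Mods R"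
    and iso: "isomorphic R Y (dsum {..<n} X)" for n :: nat and X Y
  proof -
    have XM: "X i \<in> Mods R" if "i \<in> {..<n}" for i using X that Add_Mods by auto
    have D: "right_module R (dsum {..<n} X)" by (rule right_module_dsum[OF ring Mods_right_module[OF XM]])
    have "small TYPE('u) {..<n}" by (rule small_finite) simp
    from coproduct_exists[of "{..<n}" X, OF this XM]
    obtain S j c where S: "coproduct R {..<n} X S j" and c: "c \<in> mod_iso R (dsum {..<n} X) S" by auto
    obtain d where d: "d \<in> mod_iso R Y (dsum {..<n} X)" using iso by (auto simp: isomorphic_def)
    have "retract R Y S"
      by (rule retract_trans[OF mod_iso_retract(1)[OF Mods_right_module[OF Y] d] mod_iso_retract(1)[OF D c]])
    moreover have "S \<in> Add R T" by (rule Add_coproduct[OF T S]) (use X in auto)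
    ultimately show ?thesis using Add_retract[OF T _ Y] by simp
  qed
  have iso: "Y \<in> Add R T" if X: "X \<in> Add R T" and Y: "Y \<in> Mods R" and "isomorphic R X Y" for X Y
  proof -
    obtain c where "c \<in> mod_iso R X Y" using \<open>isomorphic R X Y\<close> by (auto simp: isomorphic_def)
    from mod_iso_retract(2)[OF Mods_right_module[OF Add_Mods[OF X]] this]
    show ?thesis by (rule Add_retract[OF T X Y])
  qed
  have summand: "Y \<in> Add R T" if X: "X \<in> Add R T" and Y: "Y \<in> Mods R" and s: "is_summand R Y X" for X Y
    using s is_summand_iff_retract[OF Mods_right_module[OF Y] Mods_right_module[OF Add_Mods[OF X]]
        Mods_small[OF Add_Mods[OF X]]] Add_retract[OF T X Y] by simp
  have "additive_subcategory R (Add R T)"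
    unfolding additive_subcategory_def using Add_Mods iso finsum summand by blast
  moreover have "contravariantly_finite R (Add R T)"
    unfolding contravariantly_finite_def using Add_right_approx[OF T] by metis
  moreover have "Ext1_vanishes R T1 Y" if T1: "T1 \<in> Add R T" and T2: "T2 \<in> Add R T"
    and Y: "Y \<in> Fac_obj R T2" for T1 T2 Y
  proof -
    obtain n :: nat and p where YM: "Y \<in> Mods R" and p: "p \<in> mod_epi R (dsum {..<n} (\<lambda>_. T2)) Y"
      using Y by (auto simp: Fac_obj_def)
    have T2M: "T2 \<in> Mods R" by (rule Add_Mods[OF T2])
    have D: "right_module R (dsum {..<n} (\<lambda>_. T2))"
      by (rule right_module_dsum[OF ring Mods_right_module[OF T2M]])
    have "small TYPE('u) {..<n}" by (rule small_finite) simp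
    from coproduct_exists[of "{..<n}" "\<lambda>_. T2", OF this T2M]
    obtain S j c where S: "coproduct R {..<n} (\<lambda>_. T2) S j"
      and c: "c \<in> mod_iso R (dsum {..<n} (\<lambda>_. T2)) S" by auto
    obtain d where "d \<in> mod_iso R S (dsum {..<n} (\<lambda>_. T2))" by (rule mod_iso_inverse[OF D c])
    then have "d \<in> mod_epi R S (dsum {..<n} (\<lambda>_. T2))"
      by (auto simp: mod_iso_def mod_epi_def bij_betw_def)
    from mod_epi_comp[OF this p] have "Y \<in> Gen R T"
      using YM Add_coproduct[OF T S T2] unfolding Gen_def by blast
    then show ?thesis using Ext1_vanishes_Add[OF T T1 YM ext] by simp
  qed
  moreover have "\<exists>T0 \<in> Add R T. \<exists>T1 \<in> Add R T. \<exists>f g. right_exact R P f T0 g T1 \<and> left_approx R (Add R T) P f T0"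
    if proj: "projective R P" for P
  proof -
    obtain T0 f where la: "left_approx R (Add R T) P f T0"
      by (rule Add_left_approx_projective[OF T fin proj])
    have P: "P \<in> Mods R" using proj by (simp add: projective_def)
    have T0: "T0 \<in> Add R T" and f: "f \<in> mod_hom R P T0" using la by (auto simp: left_approx_def)
    obtain C :: "('r, 'u) module" and g where C: "C \<in> Mods R" and re: "right_exact R P f T0 g C"
      by (rule quotient_in_Mods[OF Add_Mods[OF T0] Mods_right_module[OF P] f])
    have "g \<in> mod_epi R T0 C" using re by (simp add: right_exact_def)
    then have "C \<in> Gen R T" by (rule Gen_quotient[OF Add_subset_Gen[OF T0] C])
    moreover have "Ext1_vanishes R C Y" if "Y \<in> Gen R T" for Y
      by (rule left_approx_cokernel_Ext_projective[OF T ext[OF that] that proj la C re])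
    ultimately have "C \<in> Add R T" unfolding Add_eq_Ext_projectives[OF q] by simp
    then show ?thesis using T0 re la by blast
  qed
  ultimately show ?thesis by (simp add: support_tau_tilting_def)
qed

lemma Fac_Add: "Fac R (Add R T) = Gen R T"
  by (simp add: Fac_def Gen_def)

lemma Add_eq_iff_Gen_eq:
  fixes T1 T2 :: "('r, 'u) module"
  assumes "quasitilting R T1" "quasitilting R T2"
  shows "Add R T1 = Add R T2 \<longleftrightarrow> Gen R T1 = Gen R T2"
  using Add_eq_Ext_projectives[OF assms(1)] Add_eq_Ext_projectives[OF assms(2)] Fac_Add by metis

end

section \<open>The bijection\<close>

text \<open>
  Both equivalence relations compare values of a function, namely \<open>Fac\<close> and \<open>Gen\<close>. The classes
  of such a relation correspond to the values, so that it remains to compare the two sets of values.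
\<close>

lemma quotient_bij_image:
  "bij_betw (\<lambda>c. f (SOME x. x \<in> c)) (A // {(x, y). x \<in> A \<and> y \<in> A \<and> f x = f y}) (f ` A)"
proof -
  let ?r = "{(x, y). x \<in> A \<and> y \<in> A \<and> f x = f y}"
  have cls: "f (SOME y. y \<in> ?r `` {x}) = f x" if "x \<in> A" for x
  proof -
    define y where "y = (SOME y. y \<in> ?r `` {x})"
    have "x \<in> ?r `` {x}" using that by simp
    then have "y \<in> ?r `` {x}" unfolding y_def by (rule someI)
    then show ?thesis unfolding y_def[symmetric] by simp
  qed
  show ?thesis
  proof (rule bij_betw_imageI)
    show "inj_on (\<lambda>c. f (SOME x. x \<in> c)) (A // ?r)"
    proof (rule inj_onI)
      fix c d assume "c \<in> A // ?r" "d \<in> A // ?r" and eq: "f (SOME x. x \<in> c) = f (SOME x. x \<in> d)"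
      then obtain x y where x: "x \<in> A" "c = ?r `` {x}" and y: "y \<in> A" "d = ?r `` {y}"
        by (auto elim!: quotientE)
      have "f x = f y" using eq unfolding x(2) y(2) cls[OF x(1)] cls[OF y(1)] .
      then show "c = d" using x y by auto
    qed
    show "(\<lambda>c. f (SOME x. x \<in> c)) ` (A // ?r) = f ` A"
    proof (intro equalityI subsetI)
      fix z assume "z \<in> (\<lambda>c. f (SOME x. x \<in> c)) ` (A // ?r)"
      then obtain x where x: "x \<in> A" "z = f (SOME y. y \<in> ?r `` {x})" by (auto elim!: quotientE)
      then show "z \<in> f ` A" unfolding x(2) cls[OF x(1)] by simp
    next
      fix z assume "z \<in> f ` A"
      then obtain x where x: "x \<in> A" "z = f x" by auto
      show "z \<in> (\<lambda>c. f (SOME x. x \<in> c)) ` (A // ?r)"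
        unfolding x(2) cls[OF x(1), symmetric] by (rule imageI[OF quotientI[OF x(1)]])
    qed
  qed
qed

theorem theorem8p1p10:
  fixes R :: "('r, 'k) ring_scheme"
  assumes "inaccessible_universe TYPE('u)"
    and "ring R"
    and "small TYPE('u) (carrier R)"
  shows "\<exists>\<Phi> :: ('r, 'u) module set set \<Rightarrow> ('r, 'u) module set.
           bij_betw \<Phi>
             (support_tau_tilting_subcategories R // tau_tilting_equiv R)
             (finendo_quasitilting_modules R // quasitilting_equiv R)"
proof -
  interpret module_universe R "TYPE('u)" by (rule module_universe.intro[OF assms])
  let ?S = "support_tau_tilting_subcategories R :: ('r, 'u) module set set"
  let ?Q = "finendo_quasitilting_modules R :: ('r, 'u) module set"
  have t: "tau_tilting_equiv R = {(x, y). x \<in> ?S \<and> y \<in> ?S \<and> Fac R x = Fac R y}"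
    by (simp add: tau_tilting_equiv_def)
  have q: "quasitilting_equiv R = {(x, y). x \<in> ?Q \<and> y \<in> ?Q \<and> Gen R x = Gen R y}"
    using Add_eq_iff_Gen_eq unfolding quasitilting_equiv_def finendo_quasitilting_modules_def by auto
  have "Fac R ` ?S = Gen R ` ?Q"
  proof (intro equalityI subsetI)
    fix Z assume "Z \<in> Fac R ` ?S"
    then obtain \<T> where "support_tau_tilting R \<T>" "Z = Fac R \<T>"
      by (auto simp: support_tau_tilting_subcategories_def)
    then show "Z \<in> Gen R ` ?Q" using quasitilting_of_support_tau_tilting[of \<T>] by auto
  next
    fix Z assume "Z \<in> Gen R ` ?Q"
    then obtain T where T: "quasitilting R T" "finendo R T" "Z = Gen R T"
      by (auto simp: finendo_quasitilting_modules_def)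
    have "Add R T \<in> ?S"
      using support_tau_tilting_Add[OF T(1,2)] by (simp add: support_tau_tilting_subcategories_def)
    then show "Z \<in> Fac R ` ?S" using T(3) Fac_Add by auto
  qed
  then have 1: "bij_betw (\<lambda>c. Fac R (SOME x. x \<in> c)) (?S // tau_tilting_equiv R) (Gen R ` ?Q)"
    using quotient_bij_image[of "Fac R" ?S] by (simp add: t)
  have 2: "bij_betw (\<lambda>c. Gen R (SOME x. x \<in> c)) (?Q // quasitilting_equiv R) (Gen R ` ?Q)"
    using quotient_bij_image[of "Gen R" ?Q] by (simp add: q)
  show ?thesis using bij_betw_trans[OF 1 bij_betw_inv_into[OF 2]] by blast
qed

end
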